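(* Let $d\ge 1$, let $\sigma\colon\Omega\to\Omega$ be an invertible ergodic transformation preserving a probability measure $\mathbb{P}$, and let $O\colon\Omega\to O(d,\mathbb{R})$, $\omega\mapsto O_\omega$, be a measurable map into the $d\times d$ real orthogonal matrices. Suppose that $N\colon\Omega\to M_{d\times d}(\mathbb{R})$, $\omega\mapsto N_\omega$, is measurable and that, conditioned on $(O_{\sigma^n\omega})_{n\in\mathbb{Z}}$ and $(N_{\sigma^n\omega})_{n\neq 0}$, the matrix $N_\omega$ has independent standard normal entries. For $\epsilon>0$ let $\lambda_1(\epsilon),\dots,\lambda_d(\epsilon)$ be the Lyapunov exponents of the cocycle generated by $A_\omega=O_\omega+\epsilon N_\omega$. Then for each $1\le j\le d$, $$\lambda_j(\epsilon)=(d-2j)\frac{\epsilon^2}{2}+O\big(\epsilon^4|\log\epsilon|^4\big)\qquad\text{as }\epsilon\to 0^+.$$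
   Context: The cocycle of partial products is $A^{(n)}_\omega=A_{\sigma^{n-1}\omega}\cdots A_{\sigma\omega}A_\omega$. For a $d\times d$ matrix $B$, $s_1(B)\ge\dots\ge s_d(B)$ denote its singular values. The $j$th Lyapunov exponent is the almost sure constant limit $\lambda_j=\lim_{n\to\infty}\frac1n\log s_j(A^{(n)}_\omega)$. *)

theory Defs
  imports "HOL-Probability.Probability" "HOL-Library.Landau_Symbols"
begin

section \<open>Singular values\<close>

definition eigenspace :: "real^'n^'n \<Rightarrow> real \<Rightarrow> (real^'n) set" where
  "eigenspace S t = {v. S *v v = t *\<^sub>R v}"

text \<open>
  The singular values of \<open>B\<close> are the square roots of the eigenvalues of the symmetric matrix
  \<open>B\<^sup>T B\<close>, each repeated according to the dimension of its eigenspace.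
\<close>

definition singular_values :: "real^'n^'n \<Rightarrow> real multiset" where
  "singular_values B =
     (\<Sum>t\<in>{t. eigenspace (transpose B ** B) t \<noteq> {0}}.
        replicate_mset (dim (eigenspace (transpose B ** B) t)) (sqrt t))"

text \<open>
  \<open>singular_value j B\<close> is the \<open>j\<close>-th largest singular value; the index \<open>j\<close> starts at 1 and is
  meaningful for \<open>j \<le> CARD('n)\<close>.
\<close>

definition singular_value :: "nat \<Rightarrow> real^'n^'n \<Rightarrow> real" where
  "singular_value j B = rev (sorted_list_of_multiset (singular_values B)) ! (j - 1)"


section \<open>Invertible ergodic transformations of a probability space\<close>

definition measure_preserving_automorphism :: "'w measure \<Rightarrow> ('w \<Rightarrow> 'w) \<Rightarrow> bool" where
  "measure_preserving_automorphism M T \<longleftrightarrow>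
     T \<in> measurable M M \<and>
     bij_betw T (space M) (space M) \<and>
     the_inv_into (space M) T \<in> measurable M M \<and>
     distr M M T = M"

definition ergodic :: "'w measure \<Rightarrow> ('w \<Rightarrow> 'w) \<Rightarrow> bool" where
  "ergodic M T \<longleftrightarrow>
     (\<forall>A\<in>sets M. T -` A \<inter> space M = A \<longrightarrow> measure M A = 0 \<or> measure M A = 1)"

definition int_iterate :: "'w measure \<Rightarrow> ('w \<Rightarrow> 'w) \<Rightarrow> int \<Rightarrow> 'w \<Rightarrow> 'w" where
  "int_iterate M T n =
     (if 0 \<le> n then T ^^ nat n else the_inv_into (space M) T ^^ nat (- n))"


section \<open>Matrix cocycles and Lyapunov exponents\<close>

primrec cocycle :: "('w \<Rightarrow> 'w) \<Rightarrow> ('w \<Rightarrow> real^'n^'n) \<Rightarrow> nat \<Rightarrow> 'w \<Rightarrow> real^'n^'n" where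
  "cocycle T A 0 w = mat 1"
| "cocycle T A (Suc n) w = A ((T ^^ n) w) ** cocycle T A n w"

text \<open>
  Positivity of the singular values for all large \<open>n\<close> is part of having a finite limit when
  \<open>log 0 = - \<infinity>\<close>; it has to be stated since \<open>ln 0 = 0\<close> in HOL.
\<close>

definition is_lyapunov_exponent ::
  "'w measure \<Rightarrow> ('w \<Rightarrow> 'w) \<Rightarrow> ('w \<Rightarrow> real^'n^'n) \<Rightarrow> nat \<Rightarrow> real \<Rightarrow> bool" where
  "is_lyapunov_exponent M T A j l \<longleftrightarrow>
     (AE w in M.
        (\<forall>\<^sub>F n in sequentially. 0 < singular_value j (cocycle T A n w)) \<and>
        (\<lambda>n. 1 / real n * ln (singular_value j (cocycle T A n w))) \<longlonglongrightarrow> l)"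

definition lyapunov_exponent ::
  "'w measure \<Rightarrow> ('w \<Rightarrow> 'w) \<Rightarrow> ('w \<Rightarrow> real^'n^'n) \<Rightarrow> nat \<Rightarrow> real" where
  "lyapunov_exponent M T A j = (THE l. is_lyapunov_exponent M T A j l)"


section \<open>Conditionally Gaussian matrices\<close>

text \<open>The law of a random matrix whose entries are independent standard normal variables.\<close>

definition std_normal_matrix :: "(real^'n^'n) measure" where
  "std_normal_matrix =
     distr (\<Pi>\<^sub>M p\<in>(UNIV :: ('n \<times> 'n) set). density lborel std_normal_density) borel
       (\<lambda>x. \<chi> i j. x (i, j))"

text \<open>
  The sub-sigma-algebra generated by \<open>Q \<circ> T\<^sup>n\<close> for all integers \<open>n\<close> and
  \<open>N \<circ> T\<^sup>n\<close> for all integers \<open>n \<noteq> 0\<close>.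
\<close>

definition environment_algebra ::
  "'w measure \<Rightarrow> ('w \<Rightarrow> 'w) \<Rightarrow> ('w \<Rightarrow> real^'n^'n) \<Rightarrow> ('w \<Rightarrow> real^'n^'n) \<Rightarrow> 'w measure" where
  "environment_algebra M T Q N =
     vimage_algebra (space M)
       (\<lambda>w. (\<lambda>n\<in>UNIV. Q (int_iterate M T n w), \<lambda>n\<in>- {0}. N (int_iterate M T n w)))
       ((\<Pi>\<^sub>M n\<in>UNIV. borel) \<Otimes>\<^sub>M (\<Pi>\<^sub>M n\<in>- {0}. borel))"

definition has_conditional_law ::
  "'w measure \<Rightarrow> 'w measure \<Rightarrow> ('w \<Rightarrow> 'b::topological_space) \<Rightarrow> 'b measure \<Rightarrow> bool" where
  "has_conditional_law M F X \<nu> \<longleftrightarrow>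
     (\<forall>B\<in>sets borel. AE w in M. real_cond_exp M F (\<lambda>w. indicator B (X w)) w = measure \<nu> B)"

end

theory Submission
  imports Defs
begin

text \<open>
  Write \<open>B n\<close> for the \<open>n\<close>-step cocycle, and for a list \<open>L\<close> of coordinates and \<open>k\<close> not in \<open>L\<close> let
  \<open>r L k n\<close> be the distance from column \<open>k\<close> of \<open>B n\<close> to the span of its columns in \<open>L\<close>. Up to
  dimensional constants, the \<open>j\<close>-th singular value of \<open>B n\<close> lies between the smallest and the largest
  \<open>r L k n\<close> with \<open>length L = j - 1\<close>. Since the Gaussian law is invariant under multiplication by
  orthogonal matrices on both sides, the ratio \<open>r L k (n + 1) / r L k n\<close> is independent of the past and
  has the law of the residual of \<open>1 + \<epsilon> G\<close> with \<open>G\<close> standard normal. So \<open>ln (r L k n)\<close> behaves like a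
  sum of independent identically distributed terms, and \<open>\<lambda> j\<close> is the mean logarithm of that residual.
  This mean is computed by a fourth-order expansion in \<open>\<epsilon> G\<close>, whose odd terms cancel.
\<close>

section \<open>Gram-Schmidt residuals\<close>

text \<open>Existence of the exponents is part of the claim, so the limit itself has to be produced.
  Residuals make this possible because the law of one step ratio depends on the list
  \<open>L\<close> only through its length: the smallest and the largest of the finitely many
  residuals then grow at the same rate and squeeze the singular value. No family of independent
  increments is constructed. It suffices that the moment generating function of
  \<open>ln (r L k n)\<close> is an \<open>n\<close>-th power, since a Chernoff bound and
  Borel-Cantelli use nothing else. This requires exponential moments of the logarithm, and the
  delicate side is a residual near zero. A bound of order \<open>1 / sqrt \<epsilon>\<close> for the
  mean of the residual to the power -1/2 settles it, gives positivity almost surely, and makes the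
  second moment of the logarithm at most of order \<open>1 / \<epsilon>\<close>, mild enough for the
  rare event that \<open>\<epsilon> G\<close> is not small. The main term is half of
  \<open>d - 2 (j - 1) - 2\<close>: the squared column has mean \<open>d\<close>, each of the
  \<open>j - 1\<close> projections costs 2, and the square of the first-order term costs 2.\<close>

primrec resid :: "'a::real_inner list \<Rightarrow> 'a \<Rightarrow> 'a" where
  "resid [] x = x"
| "resid (a # as) x =
     resid as x - (resid as x \<bullet> resid as a / (resid as a \<bullet> resid as a)) *\<^sub>R resid as a"

lemma diff_resid_in_span: "x - resid as x \<in> span (set as)"
proof (induction as arbitrary: x)
  case Nil
  show ?case by simp
next
  case (Cons a as)
  have sub: "span (set as) \<subseteq> span (set (a # as))"
    by (intro span_mono) auto
  have "resid as a = a - (a - resid as a)" by simp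
  then have "resid as a \<in> span (set (a # as))"
    using Cons[of a] sub by (metis list.set_intros(1) span_base span_diff subsetD)
  then have "(x - resid as x) + c *\<^sub>R resid as a \<in> span (set (a # as))" for c
    using Cons[of x] sub by (blast intro: span_add span_scale)
  then show ?case by (simp add: algebra_simps)
qed

text \<open>If \<open>resid as a\<close> vanishes, the division by zero returns 0 and
  \<open>a\<close> is skipped. Hence \<open>resid\<close> is the orthogonal projection onto the
  complement of the span for every list, linearly dependent ones included.\<close>

lemma resid_orthogonal_span: "b \<in> span (set as) \<Longrightarrow> resid as x \<bullet> b = 0"
proof -
  have gen: "\<forall>b\<in>set as. resid as x \<bullet> b = 0" for x
  proof (induction as arbitrary: x)
    case Nil
    show ?case by simp
  next
    case (Cons a as)
    let ?y = "resid (a # as) x"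
    have old: "?y \<bullet> b = 0" if "b \<in> set as" for b
      using Cons that by (simp add: inner_diff_left)
    have "?y \<bullet> (a - resid as a) = 0"
      using old orthogonal_to_span[OF diff_resid_in_span, of as ?y a]
      by (simp add: orthogonal_def)
    moreover have "?y \<bullet> resid as a = 0"
      by (simp add: inner_diff_left)
    ultimately have "?y \<bullet> a = 0"
      by (simp add: inner_diff_right)
    with old show ?case by simp
  qed
  show "b \<in> span (set as) \<Longrightarrow> resid as x \<bullet> b = 0"
    using gen[of x] orthogonal_to_span[of b "set as" "resid as x"] by (simp add: orthogonal_def)
qed

text \<open>The two properties determine the projection, because the difference of two candidates
  lies in the span and is orthogonal to it. The residual therefore depends on the list only through
  its span.\<close>

lemma resid_unique:
  assumes "x - y \<in> span (set as)" and "\<And>b. b \<in> span (set as) \<Longrightarrow> y \<bullet> b = 0"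
  shows "resid as x = y"
proof -
  have "(x - y) - (x - resid as x) \<in> span (set as)"
    using assms(1) diff_resid_in_span by (rule span_diff)
  then have d: "resid as x - y \<in> span (set as)" by simp
  have "(resid as x - y) \<bullet> (resid as x - y) = 0"
    using resid_orthogonal_span[OF d] assms(2)[OF d] by (simp add: inner_diff_left)
  then show ?thesis by simp
qed

lemma resid_span_cong:
  assumes "span (set as) = span (set bs)"
  shows "resid as x = resid bs x"
  using diff_resid_in_span[of x bs] resid_orthogonal_span[of _ bs x] assms
  by (intro resid_unique) auto

text \<open>Turns a triangular relation between columns into a product of residuals: the part in the
  span disappears and the scalar factors out.\<close>

lemma resid_add_scale:
  assumes "w \<in> span (set as)"
  shows "resid as (w + c *\<^sub>R x) = c *\<^sub>R resid as x"
proof (rule resid_unique)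
  have "w + c *\<^sub>R (x - resid as x) \<in> span (set as)"
    using assms diff_resid_in_span by (intro span_add span_scale)
  then show "w + c *\<^sub>R x - c *\<^sub>R resid as x \<in> span (set as)"
    by (simp add: algebra_simps)
qed (simp add: resid_orthogonal_span)

lemma resid_in_span_insert: "resid as x \<in> span (insert x (set as))"
proof -
  have "x - resid as x \<in> span (insert x (set as))"
    using diff_resid_in_span by (rule subsetD[OF span_mono, rotated]) auto
  then have "x - (x - resid as x) \<in> span (insert x (set as))"
    by (rule span_diff[rotated]) (auto intro: span_base)
  then show ?thesis by simp
qed

lemma norm_resid_le:
  assumes "w \<in> span (set as)"
  shows "norm (resid as x) \<le> norm (x - w)"
proof -
  let ?r = "resid as x"
  have v: "x - w - ?r \<in> span (set as)"
    using span_diff[OF diff_resid_in_span assms, of x] by (simp add: algebra_simps)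
  have "(norm (x - w))\<^sup>2 = (norm (?r + (x - w - ?r)))\<^sup>2" by simp
  also have "\<dots> = (norm ?r)\<^sup>2 + (norm (x - w - ?r))\<^sup>2"
    using resid_orthogonal_span[OF v]
    by (intro norm_add_Pythagorean) (simp add: orthogonal_def)
  finally have "(norm ?r)\<^sup>2 \<le> (norm (x - w))\<^sup>2" by simp
  then show ?thesis by (rule power2_le_imp_le) simp
qed

text \<open>A unit normal to the list bounds the residual below by a linear functional of
  \<open>x\<close>. In the small-ball estimate this replaces the nonlinear residual by an affine
  function of Gaussian entries.\<close>

lemma inner_le_norm_resid:
  assumes "norm n = 1" and "\<And>b. b \<in> set as \<Longrightarrow> n \<bullet> b = 0"
  shows "\<bar>n \<bullet> x\<bar> \<le> norm (resid as x)"
proof -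
  have "n \<bullet> (x - resid as x) = 0"
    using orthogonal_to_span[OF diff_resid_in_span, of as n x] assms(2) by (simp add: orthogonal_def)
  then have "n \<bullet> x = n \<bullet> resid as x" by (simp add: inner_diff_right)
  then show ?thesis
    using Cauchy_Schwarz_ineq2[of n "resid as x"] assms(1) by simp
qed

lemma resid_map:
  assumes "linear f" and "\<And>x y. f x \<bullet> f y = x \<bullet> y"
  shows "resid (map f as) (f x) = f (resid as x)"
  using assms by (induction as arbitrary: x) (auto simp: linear_diff linear_scale)

text \<open>After isolating the term of index \<open>l\<close>, the remaining terms are, up to sign,
  one particular point of the span of the other vectors, hence no closer to
  \<open>y l *\<^sub>R c l\<close> than the projection.\<close>

lemma norm_resid_le_coeff:
  assumes "distinct bs" and "l \<in> set bs"
  shows "\<bar>y l\<bar> * norm (resid (map c (remove1 l bs)) (c l)) \<le> norm (\<Sum>m\<in>set bs. y m *\<^sub>R c m)"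
proof -
  let ?as = "map c (remove1 l bs)"
  have as: "set ?as = c ` (set bs - {l})" using assms by auto
  let ?w = "\<Sum>m\<in>set bs - {l}. y m *\<^sub>R c m"
  have w: "- ?w \<in> span (set ?as)"
    unfolding as by (intro span_neg span_sum span_scale span_base) auto
  have "\<bar>y l\<bar> * norm (resid ?as (c l)) = norm (resid ?as (0 + y l *\<^sub>R c l))"
    by (subst resid_add_scale) (auto simp: span_zero)
  also have "\<dots> \<le> norm (y l *\<^sub>R c l - - ?w)"
    using norm_resid_le[OF w] by simp
  also have "y l *\<^sub>R c l - - ?w = (\<Sum>m\<in>set bs. y m *\<^sub>R c m)"
    using assms by (simp add: sum.remove)
  finally show ?thesis .
qed

definition colres :: "'n list \<Rightarrow> 'n \<Rightarrow> real^'n^'n \<Rightarrow> real" where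
  "colres L k C = norm (resid (map (\<lambda>l. column l C) L) (column k C))"

text \<open>The normalised Gram-Schmidt vectors as long as the residuals do not vanish; otherwise
  \<open>sgn 0 = 0\<close>.\<close>

definition frame_vector :: "'a::real_inner list \<Rightarrow> nat \<Rightarrow> 'a" where
  "frame_vector xs j = sgn (resid (take j xs) (xs ! j))"

text \<open>Both families generate the same flag of subspaces. This is the triangularity of the
  second factor in a QR decomposition, the nonzero residuals being its diagonal.\<close>

lemma span_frame_vector:
  assumes "\<And>j. j < length xs \<Longrightarrow> resid (take j xs) (xs ! j) \<noteq> 0" and "j \<le> length xs"
  shows "span (frame_vector xs ` {..<j}) = span (set (take j xs))"
  using assms(2)
proof (induction j)
  case 0
  show ?case by simp
next
  case (Suc j)
  let ?r = "resid (take j xs) (xs ! j)"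
  have IH: "span (frame_vector xs ` {..<j}) = span (set (take j xs))" and j: "j < length xs"
    using Suc by auto
  have T: "set (take (Suc j) xs) = insert (xs ! j) (set (take j xs))"
    using j by (simp add: take_Suc_conv_app_nth)
  have U: "frame_vector xs ` {..<Suc j} = insert (frame_vector xs j) (frame_vector xs ` {..<j})"
    by (simp add: lessThan_Suc)
  have r: "?r = norm ?r *\<^sub>R frame_vector xs j"
    using assms(1)[OF j] by (simp add: frame_vector_def sgn_div_norm)
  show ?case
  proof (intro antisym span_minimal subspace_span)
    have "frame_vector xs j \<in> span (set (take (Suc j) xs))"
      unfolding T frame_vector_def sgn_div_norm by (intro span_scale resid_in_span_insert)
    moreover have "frame_vector xs ` {..<j} \<subseteq> span (set (take (Suc j) xs))"
      using IH span_superset[of "frame_vector xs ` {..<j}"]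
        span_mono[of "set (take j xs)" "set (take (Suc j) xs)"] T by blast
    ultimately show "frame_vector xs ` {..<Suc j} \<subseteq> span (set (take (Suc j) xs))"
      unfolding U by simp
  next
    have le: "span (set (take j xs)) \<subseteq> span (frame_vector xs ` {..<Suc j})"
      unfolding IH[symmetric] U by (intro span_mono) auto
    have "?r \<in> span (frame_vector xs ` {..<Suc j})"
      by (subst r) (intro span_scale span_base, simp)
    then have "(xs ! j - ?r) + ?r \<in> span (frame_vector xs ` {..<Suc j})"
      using diff_resid_in_span[of "xs ! j" "take j xs"] le by (intro span_add) auto
    then show "set (take (Suc j) xs) \<subseteq> span (frame_vector xs ` {..<Suc j})"
      unfolding T using le span_superset[of "set (take j xs)"] by auto
  qed
qed

lemma frame_vector_orthonormal:
  assumes "\<And>j. j < length xs \<Longrightarrow> resid (take j xs) (xs ! j) \<noteq> 0"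
    and "i < length xs" and "j < length xs"
  shows "frame_vector xs i \<bullet> frame_vector xs j = (if i = j then 1 else 0)"
proof -
  have *: "frame_vector xs m \<bullet> frame_vector xs j = 0" if "j < m" "m < length xs" for j m
  proof -
    have "frame_vector xs j \<in> span (set (take m xs))"
      using span_frame_vector[OF assms(1), of m] that by (auto intro: span_base)
    then show ?thesis
      unfolding frame_vector_def[of xs m] sgn_div_norm by (simp add: resid_orthogonal_span)
  qed
  have "frame_vector xs i \<bullet> frame_vector xs i = 1"
    using assms(1)[OF assms(2)]
    by (simp add: frame_vector_def sgn_div_norm dot_square_norm power2_eq_square divide_simps)
  then show ?thesis
    using *[of i j] *[of j i] assms(2,3) by (cases i j rule: linorder_cases) (auto simp: inner_commute)
qed

section \<open>Residuals of the columns of a matrix product\<close>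

lemma column_matrix_mult: "column l (A ** B) = A *v column l (B :: real^'n^'n)"
  by (simp add: column_def matrix_matrix_mult_def matrix_vector_mult_def vec_eq_iff)

lemma colres_orthogonal_mult:
  assumes "orthogonal_matrix P"
  shows "colres L k (P ** C) = colres L k C"
proof -
  have ot: "orthogonal_transformation ((*v) P)"
    using assms by (simp add: orthogonal_transformation_matrix)
  have m: "colres L k (P ** C) = norm (resid (map ((*v) P) (map (\<lambda>l. column l C) L)) (P *v column k C))"
    by (simp add: colres_def column_matrix_mult o_def)
  have "resid (map ((*v) P) (map (\<lambda>l. column l C) L)) (P *v column k C)
      = P *v resid (map (\<lambda>l. column l C) L) (column k C)"
    using ot by (intro resid_map) (auto simp: orthogonal_transformation_def)
  then show ?thesis
    unfolding m using ot by (simp only: colres_def orthogonal_transformation_norm)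
qed

lemma distinct_univ_index:
  fixes X :: "'n::finite list"
  assumes "distinct X" "set X = UNIV"
  shows "\<exists>idx. \<forall>c. idx c < length X \<and> X ! idx c = c \<and> (\<forall>j<length X. idx (X ! j) = j)"
proof -
  have "\<forall>c. \<exists>j<length X. X ! j = c" using assms(2) by (metis UNIV_I in_set_conv_nth)
  then obtain idx where idx: "\<And>c. idx c < length X \<and> X ! idx c = c" by metis
  then show ?thesis using assms(1) by (metis nth_eq_iff_index_eq)
qed

text \<open>A QR decomposition of \<open>B\<close> with columns ordered by \<open>X\<close>: the
  columns of \<open>P\<close> are the Gram-Schmidt frame of the columns of \<open>B\<close>, so
  residuals of \<open>A ** B\<close> factor into residuals of \<open>B\<close> and of
  \<open>A ** P\<close>. The matrix \<open>P\<close> is found before \<open>A\<close> is chosen,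
  which allows \<open>A\<close> to be random afterwards. The second ordering \<open>X'\<close> is
  arbitrary, so that later only the length of a list matters.\<close>

lemma colres_transform:
  fixes B :: "real^'n^'n" and X X' :: "'n list"
  assumes X: "distinct X" "set X = UNIV" and X': "distinct X'" "set X' = UNIV"
    and pos: "\<And>j. j < CARD('n) \<Longrightarrow> 0 < colres (take j X) (X ! j) B"
  obtains P where "orthogonal_matrix P"
    and "\<And>A j. j < CARD('n) \<Longrightarrow> colres (take j X) (X ! j) (A ** B)
            = colres (take j X) (X ! j) B * colres (take j X') (X' ! j) (A ** P)"
proof -
  have len: "length X = CARD('n)" "length X' = CARD('n)"
    using X X' by (metis distinct_card)+
  define xs where "xs = map (\<lambda>l. column l B) X"
  have lxs: "length xs = CARD('n)" by (simp add: xs_def len)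
  have tk: "take j xs = map (\<lambda>l. column l B) (take j X)" for j
    by (simp add: xs_def take_map)
  have nz: "resid (take j xs) (xs ! j) \<noteq> 0" if "j < length xs" for j
    using pos[of j] that len lxs unfolding tk by (auto simp: colres_def xs_def)
  obtain idx where idx: "\<And>c. idx c < length X'" "\<And>c. X' ! idx c = c"
      "\<And>j. j < length X' \<Longrightarrow> idx (X' ! j) = j"
    using distinct_univ_index[OF X'] by blast
  \<comment> \<open>The frame vector of index \<open>j\<close> becomes column \<open>X' ! j\<close>
    of \<open>P\<close>, although it was built from column \<open>X ! j\<close> of
    \<open>B\<close>.\<close>
  define P :: "real^'n^'n" where "P = (\<chi> r c. frame_vector xs (idx c) $ r)"
  have cP: "column c P = frame_vector xs (idx c)" for c
    by (simp add: P_def column_def vec_eq_iff)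
  have idxinj: "idx c = idx c' \<longleftrightarrow> c = c'" for c c' using idx(2) by metis
  have "orthogonal_matrix P"
    unfolding orthogonal_matrix_orthonormal_columns cP orthogonal_def norm_eq_1
    using frame_vector_orthonormal[OF nz] idx(1) len lxs idxinj by auto
  moreover have "colres (take j X) (X ! j) (A ** B)
            = colres (take j X) (X ! j) B * colres (take j X') (X' ! j) (A ** P)"
    if j: "j < CARD('n)" for A j
  proof -
    let ?as = "map ((*v) A) (take j xs)" and ?bs = "map (\<lambda>l. column l (A ** P)) (take j X')"
    have im: "set (map (\<lambda>l. column l (A ** P)) (take j X')) = (*v) A ` frame_vector xs ` {..<j}"
    proof -
      have "set (take j X') = (\<lambda>i. X' ! i) ` {..<j}"
        using j len by (auto simp: nth_image[symmetric] lessThan_atLeast0)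
      then have "set (map (\<lambda>l. column l (A ** P)) (take j X'))
          = (\<lambda>i. A *v frame_vector xs (idx (X' ! i))) ` {..<j}"
        by (auto simp: column_matrix_mult cP image_image)
      also have "\<dots> = (\<lambda>i. A *v frame_vector xs i) ` {..<j}"
        using j len by (intro image_cong) (auto simp: idx(3))
      finally show ?thesis by (simp add: image_image)
    qed
    have sp: "span (set ?as) = span (set ?bs)"
      unfolding im using span_frame_vector[OF nz, of j] j lxs
      by (simp add: linear_span_image del: map_map)
    let ?x = "xs ! j" and ?r = "resid (take j xs) (xs ! j)"
    have "A *v (?x - ?r) \<in> span (set ?as)"
      using diff_resid_in_span[of ?x "take j xs"] by (simp add: linear_span_image)
    moreover have r: "?r = norm ?r *\<^sub>R frame_vector xs j"
      using nz[of j] j lxs by (simp add: frame_vector_def sgn_div_norm)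
    \<comment> \<open>Column \<open>X ! j\<close> of \<open>B\<close> is its residual plus a
      combination of the earlier columns; \<open>A\<close> maps that combination into the span that
      is projected away.\<close>
    have Ax: "A *v ?x = A *v (?x - ?r) + norm ?r *\<^sub>R (A *v frame_vector xs j)"
      using r by (metis add.commute diff_add_cancel matrix_vector_mult_scaleR matrix_vector_right_distrib)
    ultimately have "resid ?as (A *v ?x) = norm ?r *\<^sub>R resid ?as (A *v frame_vector xs j)"
      by (subst Ax) (rule resid_add_scale)
    then have "norm (resid ?as (A *v ?x)) = norm ?r * norm (resid ?bs (A *v frame_vector xs j))"
      using resid_span_cong[OF sp] by simp
    moreover have "colres (take j X) (X ! j) (A ** B) = norm (resid ?as (A *v ?x))"
      unfolding tk using j len by (simp add: colres_def column_matrix_mult xs_def o_def)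
    moreover have "norm ?r = colres (take j X) (X ! j) B"
      unfolding tk using j len by (simp add: colres_def xs_def)
    moreover have "colres (take j X') (X' ! j) (A ** P) = norm (resid ?bs (A *v frame_vector xs j))"
      using j len idx(3) by (simp add: colres_def column_matrix_mult[of "X' ! j"] cP)
    ultimately show ?thesis by simp
  qed
  ultimately show thesis by (rule that)
qed

lemma colres_mat_1:
  assumes "distinct L" "k \<notin> set L"
  shows "colres L k (mat 1 :: real^'n^'n) = 1"
proof -
  have c: "column l (mat 1 :: real^'n^'n) = axis l 1" for l
    by (simp add: column_def mat_def axis_def vec_eq_iff)
  have "axis k 1 \<bullet> b = 0" if "b \<in> span (set (map (\<lambda>l. axis l 1 :: real^'n) L))" for b
    using assms
    by (intro orthogonal_to_span[OF that, of "axis k 1", unfolded orthogonal_def])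
      (auto simp: inner_axis_axis)
  then have "resid (map (\<lambda>l. axis l 1 :: real^'n) L) (axis k 1) = axis k 1"
    by (intro resid_unique) (auto simp: span_zero)
  then show ?thesis by (simp add: colres_def c)
qed

text \<open>The QR argument needs an ordering of all indices; here \<open>L\<close> comes first and
  \<open>k\<close> occupies position \<open>length L\<close>.\<close>

lemma extend_distinct:
  fixes L :: "'n::finite list"
  assumes "distinct L" "k \<notin> set L"
  obtains X where "distinct X" "set X = UNIV" "take (length L) X = L" "X ! length L = k" "length L < CARD('n)"
proof -
  obtain R where R: "set R = UNIV - set (L @ [k])" "distinct R"
    using finite_distinct_list[of "UNIV - set (L @ [k])"] by auto
  have "card (set (k # L)) \<le> CARD('n)" by (intro card_mono) auto
  then have "length L < CARD('n)" using assms distinct_card[of "k # L"] by simp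
  then show thesis
    using R assms by (intro that[of "L @ [k] @ R"]) (auto simp: nth_append)
qed

section \<open>Measurability of residuals and matrix products\<close>

lemma borel_measurable_resid:
  fixes f :: "'i \<Rightarrow> 'w \<Rightarrow> 'a::euclidean_space"
  assumes "\<And>i. f i \<in> borel_measurable M" "g \<in> borel_measurable M"
  shows "(\<lambda>w. resid (map (\<lambda>i. f i w) is) (g w)) \<in> borel_measurable M"
  using assms(2)
proof (induction "is" arbitrary: g)
  case (Cons i "is")
  note [measurable] = Cons.IH[OF Cons.prems] Cons.IH[OF assms(1)[of i]]
  show ?case by simp
qed simp

lemma borel_measurable_column [measurable (raw)]:
  assumes "C \<in> borel_measurable M"
  shows "(\<lambda>w. column l (C w :: real^'n^'n)) \<in> borel_measurable M"
proof -
  have "continuous_on UNIV (\<lambda>C :: real^'n^'n. column l C)"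
    unfolding column_def by (intro continuous_intros)
  then have "(\<lambda>C :: real^'n^'n. column l C) \<in> borel_measurable borel"
    by (rule borel_measurable_continuous_onI)
  from measurable_compose[OF assms this] show ?thesis .
qed

lemma borel_measurable_colres [measurable (raw)]:
  assumes "C \<in> borel_measurable M"
  shows "(\<lambda>w. colres L k (C w :: real^'n^'n)) \<in> borel_measurable M"
  unfolding colres_def
  by (intro borel_measurable_norm[THEN measurable_compose[rotated]] borel_measurable_resid
      borel_measurable_column assms)

lemma borel_measurable_matrix_mult [measurable (raw)]:
  assumes "A \<in> borel_measurable M" "B \<in> borel_measurable M"
  shows "(\<lambda>w. (A w :: real^'n^'n) ** (B w :: real^'n^'n)) \<in> borel_measurable M"
proof -
  have "continuous_on UNIV (\<lambda>(A :: real^'n^'n, B :: real^'n^'n). A ** B)"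
    unfolding matrix_matrix_mult_def case_prod_beta by (intro continuous_intros)
  then have "(\<lambda>(A :: real^'n^'n, B :: real^'n^'n). A ** B) \<in> borel_measurable borel"
    by (rule borel_measurable_continuous_onI)
  from measurable_compose[OF borel_measurable_Pair[OF assms] this] show ?thesis by simp
qed

section \<open>The Gaussian law of a matrix\<close>

lemma nn_integral_lborel_translate:
  fixes a :: "'a::euclidean_space"
  assumes [measurable]: "f \<in> borel_measurable borel"
  shows "(\<integral>\<^sup>+x. f (a + x) \<partial>lborel) = (\<integral>\<^sup>+x. f x \<partial>lborel)"
  by (subst (2) lborel_distr_plus[of a, symmetric]) (simp add: nn_integral_distr)

text \<open>Uniqueness of Haar measure: integrate \<open>g (x + f y) * indicator (ball 0 1) (f y)\<close> over
  both variables in either order.\<close>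

lemma nn_integral_lborel_orthogonal:
  fixes f :: "'a::euclidean_space \<Rightarrow> 'a"
  assumes f: "orthogonal_transformation f" and g [measurable]: "g \<in> borel_measurable borel"
  shows "(\<integral>\<^sup>+x. g (f x) \<partial>lborel) = (\<integral>\<^sup>+x. g x \<partial>lborel)"
proof -
  define h :: "'a \<Rightarrow> ennreal" where "h = indicator (ball 0 1)"
  have [measurable]: "h \<in> borel_measurable borel"
    unfolding h_def by (rule borel_measurable_indicator) simp
  let ?c = "emeasure lborel (ball (0::'a) 1)"
  have lf: "linear f" using f by (rule orthogonal_transformation_linear)
  then have [measurable]: "f \<in> borel_measurable borel"
    by (intro borel_measurable_continuous_onI linear_continuous_on linear_conv_bounded_linear[THEN iffD1])
  \<comment> \<open>The volume of the unit ball is the factor by which the two iterated integrals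
    exceed the wanted ones; being positive and finite, it can be cancelled at the end.\<close>
  have c: "?c \<noteq> 0" "?c \<noteq> \<infinity>"
    using emeasure_lborel_ball_finite[of "0::'a" 1] content_ball_pos[of 1 "0::'a"]
    by (auto simp: measure_def)
  have hf: "h (f y) = h y" for y
    using f by (simp add: h_def indicator_def orthogonal_transformation_norm)
  have nh: "(\<integral>\<^sup>+y. h y \<partial>lborel) = ?c" by (simp add: h_def)
  have hm: "(\<integral>\<^sup>+x. h (f y - x) \<partial>lborel) = ?c" for y
  proof -
    have "(\<integral>\<^sup>+x. h (f y - x) \<partial>lborel) = (\<integral>\<^sup>+x. h (- f y + x) \<partial>lborel)"
      by (intro nn_integral_cong) (simp add: h_def indicator_def dist_norm norm_minus_commute)
    then show ?thesis
      by (subst (asm) nn_integral_lborel_translate) (auto simp: nh)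
  qed
  have sub: "(\<integral>\<^sup>+y. g (x + f y) * h (f y) \<partial>lborel) = (\<integral>\<^sup>+y. g (f y) * h (f y - x) \<partial>lborel)" for x
  proof -
    \<comment> \<open>Writing \<open>x = f a\<close> turns the shift by \<open>x\<close> outside
      \<open>f\<close> into a translation of the variable by \<open>a\<close>, under which Lebesgue
      measure is invariant.\<close>
    obtain a where a: "f a = x"
      using orthogonal_transformation_surj[OF f] by (metis surjD)
    have "g (x + f y) * h (f y) = g (f (a + y)) * h (f (a + y) - x)" for y
      using a by (simp add: linear_add[OF lf])
    then show ?thesis
      using nn_integral_lborel_translate[of "\<lambda>y. g (f y) * h (f y - x)" a] by simp
  qed
  have "(\<integral>\<^sup>+x. g x \<partial>lborel) * ?c = (\<integral>\<^sup>+y. (\<integral>\<^sup>+x. g x \<partial>lborel) * h (f y) \<partial>lborel)"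
    by (simp add: hf nn_integral_cmult nh)
  also have "\<dots> = (\<integral>\<^sup>+y. (\<integral>\<^sup>+x. g (f y + x) * h (f y) \<partial>lborel) \<partial>lborel)"
    by (simp add: nn_integral_multc nn_integral_lborel_translate)
  also have "\<dots> = (\<integral>\<^sup>+x. (\<integral>\<^sup>+y. g (x + f y) * h (f y) \<partial>lborel) \<partial>lborel)"
    by (subst lborel_pair.Fubini') (auto simp: add.commute)
  also have "\<dots> = (\<integral>\<^sup>+x. (\<integral>\<^sup>+y. g (f y) * h (f y - x) \<partial>lborel) \<partial>lborel)"
    by (simp add: sub)
  also have "\<dots> = (\<integral>\<^sup>+y. (\<integral>\<^sup>+x. g (f y) * h (f y - x) \<partial>lborel) \<partial>lborel)"
    by (subst lborel_pair.Fubini') auto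
  also have "\<dots> = (\<integral>\<^sup>+y. g (f y) * ?c \<partial>lborel)"
    by (simp add: nn_integral_cmult hm)
  also have "\<dots> = (\<integral>\<^sup>+y. g (f y) \<partial>lborel) * ?c"
    by (rule nn_integral_multc) simp
  finally show ?thesis
    using c by (metis ennreal_mult_cancel_left mult.commute infinity_ennreal_def)
qed

section \<open>The density of the Gaussian matrix law\<close>

definition std_normal :: "real measure" where
  "std_normal = density lborel std_normal_density"

lemma prob_space_std_normal: "prob_space std_normal"
  unfolding std_normal_def by (rule prob_space_normal_density) simp

lemma sets_std_normal [measurable_cong, simp]: "sets std_normal = sets borel"
  and space_std_normal [simp]: "space std_normal = UNIV"
  by (simp_all add: std_normal_def)

definition entries_law :: "(('n \<times> 'n) \<Rightarrow> real) measure" where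
  "entries_law = (\<Pi>\<^sub>M p\<in>UNIV. std_normal)"

definition matrix_of :: "(('n \<times> 'n) \<Rightarrow> real) \<Rightarrow> real^'n^'n" where
  "matrix_of x = (\<chi> i j. x (i, j))"

lemma sets_entries_law [measurable_cong]: "sets entries_law = sets (\<Pi>\<^sub>M p\<in>(UNIV :: ('n \<times> 'n) set). (borel :: real measure))"
  unfolding entries_law_def by (rule sets_PiM_cong) auto

lemma borel_measurable_vec_lambda [measurable (raw)]:
  fixes f :: "'i::finite \<Rightarrow> 'w \<Rightarrow> 'a::euclidean_space"
  assumes "\<And>i. f i \<in> borel_measurable M"
  shows "(\<lambda>w. \<chi> i. f i w) \<in> borel_measurable M"
proof (rule borel_measurable_euclidean_space[THEN iffD2], rule ballI)
  fix b :: "'a^'i" assume "b \<in> Basis"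
  then obtain i u where "b = axis i u" by (auto simp: Basis_vec_def)
  with assms show "(\<lambda>w. (\<chi> i. f i w) \<bullet> b) \<in> borel_measurable M"
    by (simp add: inner_axis)
qed

lemma borel_measurable_entry [measurable (raw)]:
  assumes [measurable]: "C \<in> borel_measurable M"
  shows "(\<lambda>w. (C w :: real^'n^'n) $ i $ j) \<in> borel_measurable M"
proof -
  have "(\<lambda>C :: real^'n^'n. C $ i $ j) \<in> borel_measurable borel"
    by (intro borel_measurable_continuous_onI continuous_intros)
  from measurable_compose[OF assms this] show ?thesis .
qed

lemma measurable_matrix_of [measurable]: "matrix_of \<in> borel_measurable (entries_law :: ('n::finite \<times> 'n \<Rightarrow> real) measure)"
  unfolding matrix_of_def by measurable

lemma std_normal_matrix_eq: "std_normal_matrix = distr entries_law borel matrix_of"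
  unfolding std_normal_matrix_def entries_law_def matrix_of_def std_normal_def ..

lemma prod_Basis_matrix:
  fixes h :: "real^'n^'n \<Rightarrow> 'b::comm_monoid_mult"
  shows "(\<Prod>b\<in>Basis. h b) = (\<Prod>p\<in>UNIV. h (axis (fst p) (axis (snd p) 1)))"
proof -
  have "axis i (axis j 1) \<in> range (\<lambda>p. axis (fst p) (axis (snd p) 1) :: real^'n^'n)" for i j
    using rangeI[of "\<lambda>p. axis (fst p) (axis (snd p) 1)" "(i, j)"] by simp
  then have "bij_betw (\<lambda>p. axis (fst p) (axis (snd p) 1) :: real^'n^'n) UNIV Basis"
    by (auto simp: bij_betw_def inj_on_def axis_eq_axis Basis_vec_def)
  then show ?thesis by (rule prod.reindex_bij_betw[symmetric])
qed

text \<open>The law is defined as a product over entries, whereas rotation invariance needs a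
  density with respect to Lebesgue measure on the Euclidean space of matrices. The two are matched
  on rectangles: the standard basis is indexed by pairs of indices, so the Lebesgue integral splits
  into one-dimensional factors.\<close>

lemma distr_density_entries:
  "distr (density lborel (\<lambda>C :: real^'n^'n. ennreal (\<Prod>p\<in>UNIV. std_normal_density (C $ fst p $ snd p))))
     (\<Pi>\<^sub>M p\<in>UNIV. std_normal) (\<lambda>C p. C $ fst p $ snd p) = entries_law"
  (is "distr (density lborel ?g) ?P ?T = _")
proof -
  interpret product_sigma_finite "\<lambda>_ :: 'n \<times> 'n. std_normal"
    by (intro product_sigma_finite.intro prob_space_imp_sigma_finite prob_space_std_normal)
  have T [measurable]: "?T \<in> measurable borel ?P"
    by (rule measurable_PiM_single')
      (auto simp: measurable_cong_sets[OF refl sets_std_normal]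
        intro!: borel_measurable_continuous_onI continuous_intros)
  let ?idx = "inv (\<lambda>p. axis (fst p) (axis (snd p) 1) :: real^'n^'n)"
  have inj: "inj (\<lambda>p. axis (fst p) (axis (snd p) 1) :: real^'n^'n)"
    by (auto simp: inj_on_def axis_eq_axis)
  show ?thesis
    unfolding entries_law_def
  proof (rule PiM_eqI)
    fix A :: "'n \<times> 'n \<Rightarrow> real set"
    assume A: "\<And>p. p \<in> UNIV \<Longrightarrow> A p \<in> sets std_normal"
    then have [measurable]: "\<And>p. A p \<in> sets borel" by simp
    have meas: "Pi\<^sub>E UNIV A \<in> sets ?P" using A by (intro sets_PiM_I_finite) auto
    have [measurable]: "?g \<in> borel_measurable borel" by measurable
    have "emeasure (distr (density lborel ?g) ?P ?T) (Pi\<^sub>E UNIV A)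
        = (\<integral>\<^sup>+C. ?g C * indicator (?T -` Pi\<^sub>E UNIV A) C \<partial>lborel)"
      using meas measurable_sets[OF T meas] by (subst emeasure_distr) (auto simp: emeasure_density)
    also have "\<dots> = (\<integral>\<^sup>+C. (\<Prod>b\<in>Basis. ennreal (std_normal_density (C \<bullet> b)) * indicator (A (?idx b)) (C \<bullet> b)) \<partial>lborel)"
    proof (rule nn_integral_cong)
      fix C :: "real^'n^'n"
      have "indicator (?T -` Pi\<^sub>E UNIV A) C = (\<Prod>p\<in>UNIV. indicator (A p) (C $ fst p $ snd p) :: ennreal)"
        by (auto simp: indicator_def PiE_def Pi_def split: if_splits intro!: prod.neutral prod_zero[symmetric])
      then show "?g C * indicator (?T -` Pi\<^sub>E UNIV A) C
          = (\<Prod>b\<in>Basis. ennreal (std_normal_density (C \<bullet> b)) * indicator (A (?idx b)) (C \<bullet> b))"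
        unfolding prod_Basis_matrix by (simp add: prod.distrib prod_ennreal inner_axis inv_f_f[OF inj])
    qed
    also have "\<dots> = (\<Prod>b\<in>Basis. (\<integral>\<^sup>+x. ennreal (std_normal_density x) * indicator (A (?idx b)) x \<partial>lborel))"
      by (rule nn_integral_lborel_prod) auto
    also have "\<dots> = (\<Prod>p\<in>UNIV. emeasure std_normal (A p))"
      unfolding prod_Basis_matrix
      by (simp add: inv_f_f[OF inj] std_normal_def emeasure_density)
    finally show "emeasure (distr (density lborel ?g) ?P ?T) (Pi\<^sub>E UNIV A)
        = (\<Prod>p\<in>UNIV. emeasure std_normal (A p))" .
  qed (auto)
qed

text \<open>The density depends on the entries only through the Frobenius norm, which is the source
  of the orthogonal invariance.\<close>

lemma prod_std_normal_density:
  fixes C :: "real^'n^'n"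
  shows "(\<Prod>p\<in>UNIV. std_normal_density (C $ fst p $ snd p))
    = (1 / sqrt (2 * pi)) ^ (CARD('n) * CARD('n)) * exp (- (norm C)\<^sup>2 / 2)"
proof -
  have "(norm C)\<^sup>2 = (\<Sum>i\<in>UNIV. \<Sum>j\<in>UNIV. (C $ i $ j)\<^sup>2)"
    by (simp only: power2_norm_eq_inner) (simp add: inner_vec_def power2_eq_square)
  also have "\<dots> = (\<Sum>p\<in>UNIV. (C $ fst p $ snd p)\<^sup>2)"
    by (simp add: sum.cartesian_product UNIV_Times_UNIV[symmetric] case_prod_beta del: UNIV_Times_UNIV)
  finally have n: "(norm C)\<^sup>2 = (\<Sum>p\<in>UNIV. (C $ fst p $ snd p)\<^sup>2)" .
  show ?thesis
    unfolding n std_normal_density_def prod.distrib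
    by (simp add: exp_sum[symmetric] sum_negf sum_divide_distrib[symmetric])
qed

lemma std_normal_matrix_density:
  "std_normal_matrix = density lborel (\<lambda>C :: real^'n^'n.
     ennreal ((1 / sqrt (2 * pi)) ^ (CARD('n) * CARD('n)) * exp (- (norm C)\<^sup>2 / 2)))" (is "_ = ?D")
proof -
  have T [measurable]: "(\<lambda>C p. C $ fst p $ snd p) \<in> measurable ?D (\<Pi>\<^sub>M p\<in>UNIV. std_normal)"
    by (rule measurable_PiM_single')
      (auto simp: measurable_cong_sets[OF refl sets_std_normal]
        intro!: borel_measurable_continuous_onI continuous_intros)
  have S [measurable]: "matrix_of \<in> measurable (\<Pi>\<^sub>M p\<in>(UNIV :: ('n \<times> 'n) set). std_normal) borel"
    using measurable_matrix_of by (simp add: entries_law_def)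
  have "std_normal_matrix = distr (distr ?D (\<Pi>\<^sub>M p\<in>UNIV. std_normal) (\<lambda>C p. C $ fst p $ snd p)) borel matrix_of"
    using distr_density_entries[where 'n = 'n] by (simp add: std_normal_matrix_eq prod_std_normal_density)
  also have "\<dots> = distr ?D borel (\<lambda>C. C)"
    by (subst distr_distr[OF S T]) (simp add: matrix_of_def o_def)
  also have "\<dots> = ?D" by (rule distr_id2) simp
  finally show ?thesis .
qed

lemma prob_space_entries_law: "prob_space (entries_law :: ('n::finite \<times> 'n \<Rightarrow> real) measure)"
  unfolding entries_law_def by (intro prob_space_PiM prob_space_std_normal)

lemma prob_space_std_normal_matrix: "prob_space (std_normal_matrix :: (real^'n^'n) measure)"
  unfolding std_normal_matrix_eq
  by (intro prob_space.prob_space_distr prob_space_entries_law measurable_matrix_of)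

lemma sets_std_normal_matrix [measurable_cong, simp]: "sets std_normal_matrix = sets borel"
  and space_std_normal_matrix [simp]: "space std_normal_matrix = UNIV"
  by (simp_all add: std_normal_matrix_def)

lemma nn_integral_std_normal_matrix_orthogonal:
  fixes f :: "real^'n^'n \<Rightarrow> real^'n^'n"
  assumes f: "orthogonal_transformation f" and [measurable]: "g \<in> borel_measurable borel"
  shows "(\<integral>\<^sup>+C. g (f C) \<partial>std_normal_matrix) = (\<integral>\<^sup>+C. g C \<partial>std_normal_matrix)"
proof -
  have [measurable]: "f \<in> borel_measurable borel"
    using orthogonal_transformation_linear[OF f]
    by (intro borel_measurable_continuous_onI linear_continuous_on linear_conv_bounded_linear[THEN iffD1])
  let ?d = "\<lambda>C :: real^'n^'n. ennreal ((1 / sqrt (2 * pi)) ^ (CARD('n) * CARD('n)) * exp (- (norm C)\<^sup>2 / 2))"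
  have "(\<integral>\<^sup>+C. g (f C) \<partial>std_normal_matrix) = (\<integral>\<^sup>+C. ?d (f C) * g (f C) \<partial>lborel)"
    using f by (simp add: std_normal_matrix_density nn_integral_density orthogonal_transformation_norm)
  also have "\<dots> = (\<integral>\<^sup>+C. ?d C * g C \<partial>lborel)"
    by (rule nn_integral_lborel_orthogonal[OF f]) simp
  finally show ?thesis
    by (simp add: std_normal_matrix_density nn_integral_density)
qed

lemma norm_matrix_rows: "norm (C :: real^'n^'n) = sqrt (\<Sum>i\<in>UNIV. (norm (row i C))\<^sup>2)"
  by (simp add: norm_vec_def L2_set_def row_def)

lemma norm_matrix_transpose: "norm (transpose C) = norm (C :: real^'n^'n)"
proof -
  have "transpose C \<bullet> transpose C = C \<bullet> C"
    unfolding inner_vec_def transpose_def by (simp, subst sum.swap) simp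
  then show ?thesis by (simp add: norm_eq_sqrt_inner)
qed

lemma matrix_mult_add_right: "((A :: real^'n^'n) + B) ** C = A ** C + B ** C"
  by (vector matrix_matrix_mult_def sum.distrib[symmetric] field_simps)

text \<open>Right multiplication by \<open>P\<close> applies the orthogonal matrix
  \<open>transpose P\<close> to every row separately, so the sum of squared row norms is
  preserved.\<close>

lemma orthogonal_transformation_mult_right:
  assumes "orthogonal_matrix (P :: real^'n^'n)"
  shows "orthogonal_transformation (\<lambda>C :: real^'n^'n. C ** P)"
proof -
  have ot: "orthogonal_transformation ((*v) (transpose P))"
    using assms by (simp add: orthogonal_transformation_matrix)
  have r: "row i (C ** P) = transpose P *v row i C" for i and C :: "real^'n^'n"
    by (simp add: row_def matrix_matrix_mult_def matrix_vector_mult_def transpose_def vec_eq_iff mult.commute)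
  have "norm (C ** P) = norm C" for C :: "real^'n^'n"
    unfolding norm_matrix_rows r orthogonal_transformation_norm[OF ot] ..
  moreover have "linear (\<lambda>C :: real^'n^'n. C ** P)"
    by (intro linearI) (simp_all add: matrix_mult_add_right scalar_matrix_assoc)
  ultimately show ?thesis by (simp add: orthogonal_transformation)
qed

lemma orthogonal_transformation_mult_left:
  assumes "orthogonal_matrix (P :: real^'n^'n)"
  shows "orthogonal_transformation (\<lambda>C :: real^'n^'n. P ** C)"
proof -
  have ot: "orthogonal_transformation (\<lambda>C :: real^'n^'n. C ** transpose P)"
    using assms by (intro orthogonal_transformation_mult_right) simp
  have "norm (P ** C) = norm C" for C :: "real^'n^'n"
    using orthogonal_transformation_norm[OF ot, of "transpose C"]
    by (metis matrix_transpose_mul norm_matrix_transpose)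
  moreover have "linear (\<lambda>C :: real^'n^'n. P ** C)"
    by (intro linearI) (simp_all add: matrix_add_ldistrib matrix_scalar_ac scalar_matrix_assoc)
  ultimately show ?thesis by (simp add: orthogonal_transformation)
qed

text \<open>Take the frame \<open>P\<close> of \<open>B\<close> and rotate the noise to
  \<open>G' = transpose (Q ** P) ** (G ** P)\<close>, which has the law of \<open>G\<close>. Left
  multiplication by an orthogonal matrix does not change residuals, and it turns
  \<open>(Q + e *\<^sub>R G) ** P\<close> into \<open>mat 1 + e *\<^sub>R G'\<close>. Thus neither
  \<open>Q\<close> nor the direction of the columns of \<open>B\<close> survives, and the reference
  pair \<open>L'\<close>, \<open>k'\<close> may be any one of the same length.\<close>

lemma colres_step_law:
  fixes B Q :: "real^'n^'n" and L L' :: "'n list"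
  assumes L: "distinct L" "k \<notin> set L" and L': "distinct L'" "k' \<notin> set L'" "length L = length L'"
    and Q: "orthogonal_matrix Q"
    and pos: "\<And>(L :: 'n list) k. distinct L \<Longrightarrow> k \<notin> set L \<Longrightarrow> 0 < colres L k B"
    and g [measurable]: "g \<in> borel_measurable borel"
  shows "(\<integral>\<^sup>+G. g (colres L k ((Q + e *\<^sub>R G) ** B)) \<partial>std_normal_matrix)
       = (\<integral>\<^sup>+G. g (colres L k B * colres L' k' (mat 1 + e *\<^sub>R G)) \<partial>std_normal_matrix)"
proof -
  obtain X where X: "distinct X" "set X = UNIV" "take (length L) X = L" "X ! length L = k"
      and len: "length L < CARD('n)"
    using extend_distinct[OF L] by metis
  obtain X' where X': "distinct X'" "set X' = UNIV" "take (length L') X' = L'" "X' ! length L' = k'"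
    using extend_distinct[OF L'(1,2)] by metis
  have lX: "length X = CARD('n)" using X by (metis distinct_card)
  have posX: "0 < colres (take j X) (X ! j) B" if "j < CARD('n)" for j
    using that X lX by (intro pos) (auto simp: distinct_conv_nth set_conv_nth)
  obtain P where P: "orthogonal_matrix P"
    and tr: "\<And>A. colres L k (A ** B) = colres L k B * colres L' k' (A ** P)"
    using colres_transform[OF X(1,2) X'(1,2) posX] len X X' L'(3) by metis
  let ?f = "\<lambda>G. transpose (Q ** P) ** (G ** P)"
  have QP: "orthogonal_matrix (transpose (Q ** P))"
    using P Q by (simp add: orthogonal_matrix_mul)
  have f: "orthogonal_transformation ?f"
    using orthogonal_transformation_compose[OF orthogonal_transformation_mult_left[OF QP] orthogonal_transformation_mult_right[OF P]]
    by (simp add: o_def)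
  have eq: "colres L k ((Q + e *\<^sub>R G) ** B) = colres L k B * colres L' k' (mat 1 + e *\<^sub>R ?f G)" for G
  proof -
    have "transpose (Q ** P) ** ((Q + e *\<^sub>R G) ** P) = mat 1 + e *\<^sub>R ?f G"
      using QP by (simp add: matrix_mult_add_right matrix_add_ldistrib matrix_scalar_ac scalar_matrix_assoc[symmetric]
          orthogonal_matrix_def)
    then show ?thesis
      using tr colres_orthogonal_mult[OF QP] by metis
  qed
  show ?thesis
    unfolding eq by (rule nn_integral_std_normal_matrix_orthogonal[OF f, of "\<lambda>G. g (colres L k B * colres L' k' (mat 1 + e *\<^sub>R G))"]) measurable
qed

section \<open>Singular values and column residuals\<close>

text \<open>The maximiser \<open>u\<close> of the quadratic form on the unit sphere of
  \<open>V\<close> is an eigenvector: its defect \<open>r = S *v u - t *\<^sub>R u\<close> lies in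
  \<open>V\<close> and is orthogonal to \<open>u\<close>, and moving from \<open>u\<close> in the
  direction \<open>r\<close> would increase the form to first order unless
  \<open>r = 0\<close>.\<close>

lemma symmetric_eigenvector_exists:
  fixes S :: "real^'n^'n"
  assumes sym: "transpose S = S" and V: "subspace V" and inv: "\<And>v. v \<in> V \<Longrightarrow> S *v v \<in> V"
    and ne: "w \<in> V" "w \<noteq> 0"
  obtains u t where "u \<in> V" "norm u = 1" "S *v u = t *\<^sub>R u"
proof -
  have self: "x \<bullet> (S *v y) = (S *v x) \<bullet> y" for x y
    using dot_lmul_matrix[of x S y] sym by (metis transpose_matrix_vector)
  let ?q = "\<lambda>x. x \<bullet> (S *v x)"
  have "compact (V \<inter> sphere 0 1)"
    by (intro closed_Int_compact closed_subspace V compact_sphere)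
  moreover have "sgn w \<in> V \<inter> sphere 0 1"
    using ne V by (simp add: sgn_div_norm subspace_scale)
  moreover have "continuous_on (V \<inter> sphere 0 1) ?q"
    by (intro continuous_intros matrix_vector_mult_linear_continuous_on)
  ultimately obtain u where u: "u \<in> V" "norm u = 1" and max: "\<And>x. x \<in> V \<Longrightarrow> norm x = 1 \<Longrightarrow> ?q x \<le> ?q u"
    using continuous_attains_sup[of "V \<inter> sphere 0 1" ?q] by fastforce
  define t where "t = ?q u"
  have le: "?q x \<le> t * (x \<bullet> x)" if x: "x \<in> V" for x
  proof (cases "x = 0")
    case False
    have "?q (sgn x) \<le> t"
      unfolding t_def using x V False by (intro max) (simp_all add: sgn_div_norm subspace_scale)
    moreover have "?q (sgn x) = ?q x / (x \<bullet> x)"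
      by (simp add: sgn_div_norm matrix_vector_mult_scaleR dot_square_norm power2_eq_square divide_simps)
    ultimately show ?thesis
      using False by (simp add: divide_simps split: if_splits)
  qed simp
  define r where "r = S *v u - t *\<^sub>R u"
  have rV: "r \<in> V" unfolding r_def using u inv V by (intro subspace_diff subspace_scale)
  have uu: "u \<bullet> u = 1" using u by (simp add: dot_square_norm)
  have ur: "u \<bullet> r = 0"
    by (simp add: r_def inner_diff_right t_def uu)
  have ru: "r \<bullet> u = 0" using ur by (simp add: inner_commute)
  have Su: "S *v u = r + t *\<^sub>R u" by (simp add: r_def)
  have rr: "r \<bullet> (S *v u) = r \<bullet> r"
    unfolding Su by (simp add: inner_add_right ru)
  let ?c = "t * (r \<bullet> r) - ?q r" and ?b = "r \<bullet> r"
  have c: "0 \<le> ?c" using le[OF rV] by simp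
  have quad: "2 * s * ?b \<le> s\<^sup>2 * ?c" for s
  proof -
    have "?q (u + s *\<^sub>R r) = t + 2 * s * ?b + s\<^sup>2 * ?q r"
      using rr self[of u r]
      by (simp add: matrix_vector_right_distrib matrix_vector_mult_scaleR inner_add_left inner_add_right
          t_def[symmetric] power2_eq_square algebra_simps inner_commute)
    moreover have "(u + s *\<^sub>R r) \<bullet> (u + s *\<^sub>R r) = 1 + s\<^sup>2 * ?b"
      by (simp add: inner_add_left inner_add_right power2_eq_square uu ru ur del: norm_eq_1)
    moreover have "u + s *\<^sub>R r \<in> V" using u rV V by (intro subspace_add subspace_scale)
    ultimately show ?thesis using le[of "u + s *\<^sub>R r"] by (simp add: algebra_simps)
  qed
  have "?b = 0"
  proof (rule ccontr)
    assume "?b \<noteq> 0"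
    then have b: "0 < ?b" by simp
    \<comment> \<open>A value of \<open>s\<close> small enough that the quadratic term of
      \<open>quad\<close> cannot compensate the linear one; adding 1 keeps the denominator positive
      when \<open>?c\<close> vanishes.\<close>
    define y where "y = ?b / (?c + 1)"
    have y: "0 < y" "y * (?c + 1) = ?b" using b c by (auto simp: y_def)
    have "2 * y * ?b \<le> y * (y * ?c)" using quad[of y] by (simp add: power2_eq_square mult.assoc)
    also have "y * ?c = ?b - y" using y(2) by (simp add: algebra_simps)
    also have "y * (?b - y) \<le> y * ?b" using y(1) by (intro mult_left_mono) auto
    finally show False using mult_pos_pos[OF y(1) b] by simp
  qed
  then have "S *v u = t *\<^sub>R u" by (simp add: r_def)
  with u show thesis by (rule that)
qed

text \<open>The orthogonal complement of the eigenvectors found so far is invariant because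
  \<open>S\<close> is symmetric, and it is nonzero as long as fewer than \<open>CARD('n)\<close> of
  them are present.\<close>

lemma symmetric_orthonormal_eigenvectors:
  fixes S :: "real^'n^'n"
  assumes sym: "transpose S = S" and "m \<le> CARD('n)"
  shows "\<exists>v t. (\<forall>i<m. S *v v i = t i *\<^sub>R v i) \<and> (\<forall>i<m. \<forall>j<m. v i \<bullet> v j = (if i = j then 1 else 0))"
  using assms(2)
proof (induction m)
  case (Suc m)
  then obtain v t where ev: "\<And>i. i < m \<Longrightarrow> S *v v i = t i *\<^sub>R v i"
    and on: "\<And>i j. i < m \<Longrightarrow> j < m \<Longrightarrow> v i \<bullet> v j = (if i = j then 1 else 0)"
    by auto
  define V where "V = {x. \<forall>i<m. v i \<bullet> x = 0}"
  have V: "subspace V" unfolding V_def subspace_def by (auto simp: inner_add_right)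
  have self: "x \<bullet> (S *v y) = (S *v x) \<bullet> y" for x y
    using dot_lmul_matrix[of x S y] sym by (metis transpose_matrix_vector)
  have inv: "S *v x \<in> V" if "x \<in> V" for x
    using that by (simp add: V_def self ev)
  have "dim (v ` {..<m}) \<le> card (v ` {..<m})" by (rule dim_le_card') simp
  also have "\<dots> \<le> m" using card_image_le[of "{..<m}" v] by simp
  finally have "dim (v ` {..<m}) < DIM(real^'n)" using Suc.prems by simp
  then obtain w where w: "w \<noteq> 0" "\<And>y. y \<in> span (v ` {..<m}) \<Longrightarrow> orthogonal w y"
    using orthogonal_to_subspace_exists by metis
  have "orthogonal w (v i)" if "i < m" for i
    using that by (intro w(2) span_base) auto
  then have "w \<in> V" by (simp add: V_def orthogonal_def inner_commute)
  then obtain u s where u: "u \<in> V" "norm u = 1" "S *v u = s *\<^sub>R u"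
    using symmetric_eigenvector_exists[OF sym V inv _ w(1)] by blast
  have uu: "u \<bullet> u = 1" using u(2) by (simp add: dot_square_norm)
  have uv: "v i \<bullet> u = 0" "u \<bullet> v i = 0" if "i < m" for i
    using u(1) that by (auto simp: V_def inner_commute)
  show ?case
    by (rule exI[of _ "v(m := u)"], rule exI[of _ "t(m := s)"])
      (auto simp: less_Suc_eq ev on u(3) uu uv)
qed simp

lemma orthonormal_span_facts:
  assumes on: "\<And>i j. i < d \<Longrightarrow> j < d \<Longrightarrow> v i \<bullet> v j = (if i = j then 1 else (0::real))"
    and I: "I \<subseteq> {..<d}"
  shows "dim (span (v ` I)) = card I"
    and "x \<in> span (v ` I) \<Longrightarrow> i < d \<Longrightarrow> i \<notin> I \<Longrightarrow> x \<bullet> (v i :: 'a::euclidean_space) = 0"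
proof -
  have inj: "inj_on v I"
  proof (rule inj_onI)
    fix i j assume "i \<in> I" "j \<in> I" "v i = v j"
    then show "i = j"
      using on[of i i] on[of i j] I by (auto simp: subset_iff split: if_splits)
  qed
  have "independent (v ` I)"
  proof (rule pairwise_orthogonal_independent)
    show "pairwise orthogonal (v ` I)"
      using I by (fastforce simp: pairwise_def orthogonal_def on subset_iff)
    show "0 \<notin> v ` I"
      using on I by (metis imageE inner_zero_left lessThan_iff subsetD zero_neq_one)
  qed
  then show "dim (span (v ` I)) = card I"
    using inj by (simp add: dim_eq_card_independent card_image)
  show "x \<bullet> v i = 0" if "x \<in> span (v ` I)" "i < d" "i \<notin> I"
    using orthogonal_to_span[OF that(1), of "v i"] that I on
    by (fastforce simp: orthogonal_def inner_commute)
qed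

lemma sum_singleton_mset_const: "finite A \<Longrightarrow> (\<Sum>i\<in>A. {#c#}) = replicate_mset (card A) c"
  by (induction rule: finite_induct) auto

text \<open>Bridge from the multiset of eigenspace dimensions to an orthonormal eigenbasis of
  \<open>transpose B ** B\<close>. Each eigenspace is spanned by the basis vectors with that
  eigenvalue, so its dimension counts their indices, and every norm in the min-max arguments becomes
  a weighted sum of squares.\<close>

lemma singular_values_basis:
  fixes B :: "real^'n^'n"
  obtains v t where "\<And>i j. i < CARD('n) \<Longrightarrow> j < CARD('n) \<Longrightarrow> v i \<bullet> v j = (if i = j then 1 else 0)"
    and "\<And>i. i < CARD('n) \<Longrightarrow> 0 \<le> t i"
    and "\<And>x. (norm (B *v x))\<^sup>2 = (\<Sum>i<CARD('n). t i * (x \<bullet> v i)\<^sup>2)"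
    and "\<And>x. (norm x)\<^sup>2 = (\<Sum>i<CARD('n). (x \<bullet> v i)\<^sup>2)"
    and "singular_values B = (\<Sum>i<CARD('n). {#sqrt (t i)#})"
proof -
  let ?d = "CARD('n)"
  define S where "S = transpose B ** B"
  have sym: "transpose S = S" by (simp add: S_def matrix_transpose_mul)
  obtain v t where ev: "\<And>i. i < ?d \<Longrightarrow> S *v v i = t i *\<^sub>R v i"
    and on: "\<And>i j. i < ?d \<Longrightarrow> j < ?d \<Longrightarrow> v i \<bullet> v j = (if i = j then 1 else 0)"
    using symmetric_orthonormal_eigenvectors[OF sym order_refl] by blast
  have BS: "(B *v x) \<bullet> (B *v y) = x \<bullet> (S *v y)" for x y
    unfolding S_def by (metis dot_lmul_matrix matrix_vector_mul_assoc transpose_matrix_vector transpose_transpose)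
  have self: "x \<bullet> (S *v y) = (S *v x) \<bullet> y" for x y
    using BS[of x y] BS[of y x] by (simp add: inner_commute)
  have dimI: "dim (span (v ` I)) = card I" if "I \<subseteq> {..<?d}" for I
    using orthonormal_span_facts(1)[OF on that] .
  have full: "span (v ` {..<?d}) = UNIV"
    using dimI[of "{..<?d}"] by (simp add: dim_eq_full[symmetric])
  have expand: "x = (\<Sum>i<?d. (x \<bullet> v i) *\<^sub>R v i)" for x
  proof -
    let ?r = "x - (\<Sum>i<?d. (x \<bullet> v i) *\<^sub>R v i)"
    have "v j \<bullet> ?r = 0" if "j < ?d" for j
    proof -
      have "v j \<bullet> ?r = x \<bullet> v j - (\<Sum>i<?d. (x \<bullet> v i) * (if i = j then 1 else 0))"
        using on that by (simp add: inner_diff_right inner_sum_right inner_commute)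
      then show ?thesis using that by (simp add: if_distrib[of "(*) _"] cong: if_cong)
    qed
    then have "orthogonal ?r y" if "y \<in> v ` {..<?d}" for y
      using that by (auto simp: orthogonal_def inner_commute)
    then have "orthogonal ?r ?r"
      using orthogonal_to_span[of ?r "v ` {..<?d}" ?r] full by auto
    then show ?thesis by (simp add: orthogonal_def)
  qed
  have parseval: "x \<bullet> y = (\<Sum>i<?d. (x \<bullet> v i) * (y \<bullet> v i))" for x y
    by (subst expand[of y]) (simp add: inner_sum_right mult.commute)
  have n: "(norm x)\<^sup>2 = (\<Sum>i<?d. (x \<bullet> v i)\<^sup>2)" for x
    unfolding power2_norm_eq_inner by (subst parseval) (simp add: power2_eq_square)
  have nB: "(norm (B *v x))\<^sup>2 = (\<Sum>i<?d. t i * (x \<bullet> v i)\<^sup>2)" for x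
  proof -
    have "(norm (B *v x))\<^sup>2 = x \<bullet> (S *v x)" by (simp add: power2_norm_eq_inner BS)
    also have "\<dots> = (\<Sum>i<?d. (x \<bullet> v i) * (x \<bullet> (S *v v i)))"
      by (subst parseval) (simp add: self)
    finally show ?thesis by (simp add: ev power2_eq_square mult_ac)
  qed
  have tpos: "0 \<le> t i" if "i < ?d" for i
  proof -
    have "(norm (B *v v i))\<^sup>2 = t i" using that by (simp add: power2_norm_eq_inner BS ev on)
    then show ?thesis by (metis zero_le_power2)
  qed
  have es: "eigenspace S \<tau> = span (v ` {i\<in>{..<?d}. t i = \<tau>})" for \<tau>
  proof (intro antisym span_minimal subsetI)
    fix x assume "x \<in> eigenspace S \<tau>"
    then have x: "S *v x = \<tau> *\<^sub>R x" by (simp add: eigenspace_def)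
    have "x \<bullet> v i = 0" if "i < ?d" "t i \<noteq> \<tau>" for i
      using self[of x "v i"] ev[OF that(1)] that(2) by (simp add: x)
    then have "(x \<bullet> v i) *\<^sub>R v i \<in> span (v ` {i\<in>{..<?d}. t i = \<tau>})" if "i < ?d" for i
      using that by (cases "t i = \<tau>") (auto intro: span_scale span_base span_zero)
    then show "x \<in> span (v ` {i\<in>{..<?d}. t i = \<tau>})"
      by (subst expand) (auto intro!: span_sum)
  next
    show "subspace (eigenspace S \<tau>)"
      by (auto simp: subspace_def eigenspace_def matrix_vector_right_distrib matrix_vector_mult_scaleR scaleR_add_right)
  qed (auto simp: eigenspace_def ev)
  have T: "{\<tau>. eigenspace S \<tau> \<noteq> {0}} = t ` {..<?d}"
  proof -
    have "eigenspace S \<tau> \<noteq> {0} \<longleftrightarrow> dim (eigenspace S \<tau>) \<noteq> 0" for \<tau>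
      unfolding es dim_eq_0 using span_zero[of "v ` {i\<in>{..<?d}. t i = \<tau>}"] by blast
    moreover have "dim (eigenspace S \<tau>) = card {i\<in>{..<?d}. t i = \<tau>}" for \<tau>
      unfolding es by (rule dimI) auto
    ultimately show ?thesis by (auto simp: card_eq_0_iff)
  qed
  have "singular_values B = (\<Sum>\<tau>\<in>t ` {..<?d}. \<Sum>i\<in>{i\<in>{..<?d}. t i = \<tau>}. {#sqrt (t i)#})"
    unfolding singular_values_def S_def[symmetric] T unfolding es
    by (intro sum.cong refl) (subst dimI, auto simp: sum_singleton_mset_const)
  also have "\<dots> = (\<Sum>i<?d. {#sqrt (t i)#})"
    by (rule sum.image_gen[symmetric]) simp
  finally show thesis using that on tpos nB n by blast
qed

lemma filter_sum_singletons:
  "finite I \<Longrightarrow> size (filter_mset P (\<Sum>i\<in>I. {#f i#})) = card {i\<in>I. P (f i)}"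
proof (induction rule: finite_induct)
  case (insert x I)
  then have "{i \<in> insert x I. P (f i)} = (if P (f x) then insert x {i\<in>I. P (f i)} else {i\<in>I. P (f i)})"
    by auto
  with insert show ?case by simp
qed simp

lemma length_filter_sum_singletons:
  assumes "mset xs = (\<Sum>i\<in>I. {#f i#})" "finite I"
  shows "length (filter P xs) = card {i\<in>I. P (f i)}"
  using filter_sum_singletons[OF assms(2), of P f] by (simp flip: assms(1) mset_filter)

text \<open>Converts a statement about an entry of a descending list into a count of entries beyond
  a threshold; positions start at 0, hence \<open>Suc j\<close>.\<close>

lemma length_filter_desc_ge:
  assumes "sorted (rev xs)" "j < length xs" "c < (xs ! j :: real)"
  shows "Suc j \<le> length (filter (\<lambda>x. c < x) xs)"
proof -
  have "c < x" if "x \<in> set (take (Suc j) xs)" for x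
  proof -
    obtain i where "i < length (take (Suc j) xs)" "take (Suc j) xs ! i = x"
      using \<open>x \<in> _\<close> by (auto simp only: in_set_conv_nth)
    then have "i \<le> j" "x = xs ! i" by auto
    then show ?thesis
      using assms sorted_rev_nth_mono[of xs i j] by fastforce
  qed
  then have "filter (\<lambda>x. c < x) (take (Suc j) xs) = take (Suc j) xs" by simp
  then have "Suc j = length (filter (\<lambda>x. c < x) (take (Suc j) xs))" using assms(2) by simp
  also have "\<dots> \<le> length (filter (\<lambda>x. c < x) (take (Suc j) xs @ drop (Suc j) xs))"
    unfolding filter_append length_append by simp
  finally show ?thesis by simp
qed

lemma length_filter_desc_less:
  assumes "sorted (rev xs)" "j < length xs" "xs ! j < (c :: real)"
  shows "length xs - j \<le> length (filter (\<lambda>x. x < c) xs)"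
proof -
  have "x < c" if "x \<in> set (drop j xs)" for x
  proof -
    obtain i where "i < length (drop j xs)" "drop j xs ! i = x"
      using \<open>x \<in> _\<close> by (auto simp only: in_set_conv_nth)
    then have "j \<le> j + i" "j + i < length xs" "x = xs ! (j + i)" by auto
    then show ?thesis
      using assms sorted_rev_nth_mono[of xs j "j + i"] by fastforce
  qed
  then have "filter (\<lambda>x. x < c) (drop j xs) = drop j xs" by simp
  then have "length xs - j = length (filter (\<lambda>x. x < c) (drop j xs))" by simp
  also have "\<dots> \<le> length (filter (\<lambda>x. x < c) (take j xs @ drop j xs))"
    unfolding filter_append length_append by simp
  finally show ?thesis by simp
qed

section \<open>Min-max bounds for singular values\<close>

lemma subspace_Int_nonzero:
  fixes U E :: "('a::euclidean_space) set"
  assumes "subspace U" "subspace E" "DIM('a) < dim U + dim E"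
  obtains x where "x \<in> U" "x \<in> E" "x \<noteq> 0"
proof -
  have "dim {x + y |x y. x \<in> U \<and> y \<in> E} \<le> DIM('a)" by (rule dim_subset_UNIV)
  then have "dim (U \<inter> E) \<noteq> 0" using dim_sums_Int[OF assms(1,2)] assms(3) by linarith
  then have "\<not> U \<inter> E \<subseteq> {0}" by (simp add: dim_eq_0)
  then show thesis using that by blast
qed

text \<open>The upper half of the Courant-Fischer principle. If the singular value exceeded
  \<open>c\<close>, at least \<open>j\<close> eigenvectors would have singular value above
  \<open>c\<close>; their span meets \<open>U\<close> in a nonzero vector by dimension count, and
  that vector is stretched by more than \<open>c\<close>.\<close>

lemma singular_value_le:
  fixes B :: "real^'n^'n"
  assumes j: "1 \<le> j" "j \<le> CARD('n)" and U: "subspace U" "CARD('n) < dim U + j"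
    and le: "\<And>u. u \<in> U \<Longrightarrow> norm (B *v u) \<le> c * norm u"
  shows "singular_value j B \<le> c"
proof (rule ccontr)
  assume "\<not> singular_value j B \<le> c"
  obtain v t where on: "\<And>i j. i < CARD('n) \<Longrightarrow> j < CARD('n) \<Longrightarrow> v i \<bullet> v j = (if i = j then 1 else 0)"
    and t: "\<And>i. i < CARD('n) \<Longrightarrow> 0 \<le> t i"
    and nB: "\<And>x. (norm (B *v x))\<^sup>2 = (\<Sum>i<CARD('n). t i * (x \<bullet> v i)\<^sup>2)"
    and n: "\<And>x. (norm x)\<^sup>2 = (\<Sum>i<CARD('n). (x \<bullet> v i)\<^sup>2)"
    and sv: "singular_values B = (\<Sum>i<CARD('n). {#sqrt (t i)#})"
    by (rule singular_values_basis[of B]) blast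
  define xs where "xs = rev (sorted_list_of_multiset (singular_values B))"
  have ms: "mset xs = singular_values B" by (simp add: xs_def)
  have len: "length xs = CARD('n)"
    using length_filter_sum_singletons[of xs "\<lambda>i. sqrt (t i)" "{..<CARD('n)}" "\<lambda>_. True"]
    by (simp add: ms sv)
  define I where "I = {i\<in>{..<CARD('n)}. c < sqrt (t i)}"
  have "Suc (j - 1) \<le> length (filter (\<lambda>x. c < x) xs)"
    using \<open>\<not> singular_value j B \<le> c\<close> j len
    by (intro length_filter_desc_ge) (auto simp: xs_def singular_value_def)
  also have "\<dots> = card I"
    unfolding I_def by (rule length_filter_sum_singletons) (simp_all add: ms sv)
  finally have "j \<le> card I" using j by simp
  moreover have dI: "dim (span (v ` I)) = card I"
    by (rule orthonormal_span_facts(1)[where d = "CARD('n)"]) (auto simp: on I_def)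
  ultimately obtain x where x: "x \<in> U" "x \<in> span (v ` I)" "x \<noteq> 0"
    using subspace_Int_nonzero[OF U(1) subspace_span[of "v ` I"]] U(2) by force
  \<comment> \<open>The nonzero vector \<open>x\<close> of \<open>U\<close> forces this sign, and it
    is what makes squaring the bound legitimate.\<close>
  have c: "0 \<le> c"
    using le[OF x(1)] x(3) by (metis norm_ge_zero order_trans zero_le_mult_iff zero_less_norm_iff not_le)
  have z: "x \<bullet> v i = 0" if "i < CARD('n)" "i \<notin> I" for i
    using x(2) that by (intro orthonormal_span_facts(2)[where d = "CARD('n)" and I = I]) (auto simp: on I_def)
  have tI: "c\<^sup>2 < t i" if "i \<in> I" for i
    using that c t power_strict_mono[of c "sqrt (t i)" 2] by (auto simp: I_def)
  have "(norm (B *v x))\<^sup>2 \<le> c\<^sup>2 * (norm x)\<^sup>2"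
    using power_mono[OF le[OF x(1)], of 2] by (simp add: power_mult_distrib)
  then have "(\<Sum>i<CARD('n). (t i - c\<^sup>2) * (x \<bullet> v i)\<^sup>2) \<le> 0"
    unfolding nB unfolding n by (simp add: sum_distrib_left left_diff_distrib sum_subtractf)
  moreover have nn: "0 \<le> (t i - c\<^sup>2) * (x \<bullet> v i)\<^sup>2" if "i \<in> {..<CARD('n)}" for i
    using tI[of i] z[of i] that by (cases "i \<in> I") auto
  ultimately have "\<forall>i\<in>{..<CARD('n)}. (t i - c\<^sup>2) * (x \<bullet> v i)\<^sup>2 = 0"
    by (subst sum_nonneg_eq_0_iff[symmetric]) (auto intro!: antisym sum_nonneg)
  then have "x \<bullet> v i = 0" if "i < CARD('n)" for i
    using that z[of i] tI[of i] by (cases "i \<in> I") (auto dest!: bspec[of _ _ i])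
  then have "(norm x)\<^sup>2 = 0" by (simp add: n)
  with x(3) show False by simp
qed

text \<open>The dual half: a singular value below \<open>c\<close> leaves at least
  \<open>CARD('n) - (j - 1)\<close> eigenvectors below \<open>c\<close>, too many for their span to
  avoid \<open>U\<close>.\<close>

lemma singular_value_ge:
  fixes B :: "real^'n^'n"
  assumes j: "1 \<le> j" "j \<le> CARD('n)" and U: "subspace U" "j \<le> dim U" and c: "0 \<le> c"
    and ge: "\<And>u. u \<in> U \<Longrightarrow> c * norm u \<le> norm (B *v u)"
  shows "c \<le> singular_value j B"
proof (rule ccontr)
  assume "\<not> c \<le> singular_value j B"
  obtain v t where on: "\<And>i j. i < CARD('n) \<Longrightarrow> j < CARD('n) \<Longrightarrow> v i \<bullet> v j = (if i = j then 1 else 0)"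
    and t: "\<And>i. i < CARD('n) \<Longrightarrow> 0 \<le> t i"
    and nB: "\<And>x. (norm (B *v x))\<^sup>2 = (\<Sum>i<CARD('n). t i * (x \<bullet> v i)\<^sup>2)"
    and n: "\<And>x. (norm x)\<^sup>2 = (\<Sum>i<CARD('n). (x \<bullet> v i)\<^sup>2)"
    and sv: "singular_values B = (\<Sum>i<CARD('n). {#sqrt (t i)#})"
    by (rule singular_values_basis[of B]) blast
  define xs where "xs = rev (sorted_list_of_multiset (singular_values B))"
  have ms: "mset xs = singular_values B" by (simp add: xs_def)
  have len: "length xs = CARD('n)"
    using length_filter_sum_singletons[of xs "\<lambda>i. sqrt (t i)" "{..<CARD('n)}" "\<lambda>_. True"]
    by (simp add: ms sv)
  define I where "I = {i\<in>{..<CARD('n)}. sqrt (t i) < c}"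
  have "CARD('n) - (j - 1) \<le> length (filter (\<lambda>x. x < c) xs)"
    unfolding len[symmetric] using \<open>\<not> c \<le> singular_value j B\<close> j len
    by (intro length_filter_desc_less) (auto simp: xs_def singular_value_def)
  also have "\<dots> = card I"
    unfolding I_def by (rule length_filter_sum_singletons) (simp_all add: ms sv)
  finally have "CARD('n) < dim U + card I" using j U by simp
  moreover have dI: "dim (span (v ` I)) = card I"
    by (rule orthonormal_span_facts(1)[where d = "CARD('n)"]) (auto simp: on I_def)
  ultimately obtain x where x: "x \<in> U" "x \<in> span (v ` I)" "x \<noteq> 0"
    using subspace_Int_nonzero[OF U(1) subspace_span[of "v ` I"]] U(2) by force
  have z: "x \<bullet> v i = 0" if "i < CARD('n)" "i \<notin> I" for i
    using x(2) that by (intro orthonormal_span_facts(2)[where d = "CARD('n)" and I = I]) (auto simp: on I_def)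
  have tI: "t i < c\<^sup>2" if "i \<in> I" for i
    using that t power_strict_mono[of "sqrt (t i)" c 2] by (auto simp: I_def)
  have "c\<^sup>2 * (norm x)\<^sup>2 \<le> (norm (B *v x))\<^sup>2"
    using power_mono[OF ge[OF x(1)], of 2] c by (simp add: power_mult_distrib)
  then have "(\<Sum>i<CARD('n). (c\<^sup>2 - t i) * (x \<bullet> v i)\<^sup>2) \<le> 0"
    unfolding nB unfolding n by (simp add: sum_distrib_left left_diff_distrib sum_subtractf)
  moreover have nn: "0 \<le> (c\<^sup>2 - t i) * (x \<bullet> v i)\<^sup>2" if "i \<in> {..<CARD('n)}" for i
    using tI[of i] z[of i] that by (cases "i \<in> I") auto
  ultimately have "\<forall>i\<in>{..<CARD('n)}. (c\<^sup>2 - t i) * (x \<bullet> v i)\<^sup>2 = 0"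
    by (subst sum_nonneg_eq_0_iff[symmetric]) (auto intro!: antisym sum_nonneg)
  then have "x \<bullet> v i = 0" if "i < CARD('n)" for i
    using that z[of i] tI[of i] by (cases "i \<in> I") (auto dest!: bspec[of _ _ i])
  then have "(norm x)\<^sup>2 = 0" by (simp add: n)
  with x(3) show False by simp
qed

section \<open>Comparison of singular values with column residuals\<close>

lemma matrix_vector_mult_basis_sum:
  "B *v u = (\<Sum>k\<in>UNIV. u $ k *\<^sub>R column k (B :: real^'n^'n))"
  by (simp add: matrix_mult_sum scalar_mult_eq_scaleR)

text \<open>The test space consists of all \<open>u\<close> whose image \<open>B *v u\<close> is
  orthogonal to the columns in \<open>L\<close>; its codimension is at most \<open>length L\<close>.
  Expanding one factor of the squared norm of \<open>B *v u\<close> in the columns of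
  \<open>B\<close>, the columns in \<open>L\<close> drop out and every other column contributes only
  through its residual.\<close>

lemma singular_value_le_colres:
  fixes B :: "real^'n^'n"
  assumes L: "distinct L" "length L < CARD('n)"
    and le: "\<And>k. k \<notin> set L \<Longrightarrow> colres L k B \<le> c" and c: "0 \<le> c"
  shows "singular_value (Suc (length L)) B \<le> real CARD('n) * c"
proof -
  let ?W = "span ((\<lambda>l. transpose B *v column l B) ` set L)"
  let ?U = "{v \<in> UNIV. \<forall>y\<in>?W. orthogonal y v}"
  have "dim ?U + dim ?W = CARD('n)"
    using dim_subspace_orthogonal_to_vectors[of ?W UNIV] by simp
  moreover have "dim ?W \<le> length L"
    using dim_le_card'[of "(\<lambda>l. transpose B *v column l B) ` set L"]
      card_image_le[of "set L" "\<lambda>l. transpose B *v column l B"] distinct_card[OF L(1)]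
    by simp
  ultimately have dim: "CARD('n) < dim ?U + Suc (length L)" by simp
  have U: "subspace ?U"
    by (auto simp: subspace_def orthogonal_def inner_add_right)
  have "norm (B *v u) \<le> (real CARD('n) * c) * norm u" if "u \<in> ?U" for u
  proof -
    let ?y = "B *v u"
    have orth: "?y \<bullet> column l B = 0" if "l \<in> set L" for l
    proof -
      have "orthogonal (transpose B *v column l B) u"
        using \<open>u \<in> ?U\<close> that by (auto intro: span_base)
      then have "column l B \<bullet> ?y = 0"
        by (metis dot_lmul_matrix orthogonal_def transpose_matrix_vector)
      then show ?thesis by (simp add: inner_commute)
    qed
    have z: "?y \<bullet> b = 0" if "b \<in> span (set (map (\<lambda>l. column l B) L))" for b
      using orthogonal_to_span[OF that, of ?y] orth by (auto simp: orthogonal_def)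
    have bd: "u $ k * (?y \<bullet> column k B) \<le> norm u * (norm ?y * c)" for k
    proof (cases "k \<in> set L")
      case True
      then show ?thesis using orth c by simp
    next
      case False
      let ?r = "resid (map (\<lambda>l. column l B) L) (column k B)"
      have "?y \<bullet> column k B = ?y \<bullet> ?r"
        using z[OF diff_resid_in_span[of "column k B" "map (\<lambda>l. column l B) L"]]
        by (simp add: inner_diff_right)
      also have "\<bar>\<dots>\<bar> \<le> norm ?y * norm ?r" by (rule Cauchy_Schwarz_ineq2)
      also have "\<dots> \<le> norm ?y * c"
        using le[OF False] by (intro mult_left_mono) (auto simp: colres_def)
      finally have "\<bar>u $ k\<bar> * \<bar>?y \<bullet> column k B\<bar> \<le> norm u * (norm ?y * c)"
        using component_le_norm_cart[of u k] by (intro mult_mono) auto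
      then show ?thesis by (metis abs_ge_self abs_mult order_trans)
    qed
    have "norm ?y * norm ?y = ?y \<bullet> (\<Sum>k\<in>UNIV. u $ k *\<^sub>R column k B)"
      using matrix_vector_mult_basis_sum[of B u] by (metis norm_eq_square power2_eq_square dot_square_norm)
    also have "\<dots> = (\<Sum>k\<in>UNIV. u $ k * (?y \<bullet> column k B))" by (simp add: inner_sum_right)
    also have "\<dots> \<le> (\<Sum>k\<in>(UNIV :: 'n set). norm u * (norm ?y * c))" by (intro sum_mono bd)
    also have "\<dots> = norm ?y * (real CARD('n) * c * norm u)" by simp
    finally show ?thesis
      using c by (cases "?y = 0") (auto simp: mult_le_cancel_left)
  qed
  then show ?thesis
    using L(2) by (intro singular_value_le[OF _ _ U dim]) auto
qed

text \<open>The test space is spanned by the coordinate vectors indexed by \<open>L\<close>. There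
  \<open>B *v u\<close> is a combination of the columns in \<open>L\<close>, and each coefficient is
  controlled by the distance of its column from the span of the others. Here \<open>L\<close> has
  length \<open>j\<close> and the residuals are taken along lists of length
  \<open>j - 1\<close>.\<close>

lemma singular_value_ge_colres:
  fixes B :: "real^'n^'n"
  assumes L: "distinct L" "L \<noteq> []"
    and ge: "\<And>l. l \<in> set L \<Longrightarrow> c \<le> colres (remove1 l L) l B" and c: "0 \<le> c"
  shows "c / real CARD('n) \<le> singular_value (length L) B"
proof -
  let ?U = "span ((\<lambda>l. axis l 1 :: real^'n) ` set L)"
  have inj: "inj_on (\<lambda>l. axis l 1 :: real^'n) (set L)" by (auto simp: inj_on_def axis_eq_axis)
  have ind: "independent ((\<lambda>l. axis l 1 :: real^'n) ` set L)"
    by (rule independent_mono[OF independent_Basis]) (auto simp: Basis_vec_def)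
  have dim: "dim ?U = length L"
    using ind inj L(1) by (simp add: dim_eq_card_independent card_image distinct_card)
  have lenL: "length L \<le> CARD('n)"
    using L(1) by (metis card_mono distinct_card finite subset_UNIV)
  have "c / real CARD('n) * norm u \<le> norm (B *v u)" if "u \<in> ?U" for u
  proof -
    have z: "u $ k = 0" if "k \<notin> set L" for k
    proof -
      have "orthogonal (axis k 1) u"
        by (rule orthogonal_to_span[OF \<open>u \<in> ?U\<close>]) (use that in \<open>auto simp: orthogonal_def inner_axis_axis\<close>)
      then show ?thesis by (simp add: orthogonal_def inner_axis')
    qed
    have Bu: "B *v u = (\<Sum>l\<in>set L. u $ l *\<^sub>R column l B)"
      unfolding matrix_vector_mult_basis_sum by (rule sum.mono_neutral_right) (auto simp: z)
    have bd: "c * \<bar>u $ k\<bar> \<le> norm (B *v u)" for k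
    proof (cases "k \<in> set L")
      case True
      have "\<bar>u $ k\<bar> * c \<le> \<bar>u $ k\<bar> * colres (remove1 k L) k B"
        using ge[OF True] by (rule mult_left_mono) simp
      also have "\<dots> \<le> norm (B *v u)"
        unfolding Bu colres_def by (rule norm_resid_le_coeff[OF L(1) True])
      finally show ?thesis by (simp add: mult.commute)
    qed (simp add: z)
    have "c * norm u \<le> c * (\<Sum>k\<in>UNIV. \<bar>u $ k\<bar>)"
      using norm_le_l1_cart[of u] c by (intro mult_left_mono) auto
    also have "\<dots> \<le> (\<Sum>k\<in>(UNIV :: 'n set). norm (B *v u))"
      unfolding sum_distrib_left by (intro sum_mono bd)
    finally show ?thesis by (simp add: field_simps)
  qed
  then show ?thesis
    using L lenL c dim by (intro singular_value_ge[of _ ?U]) (auto simp: Suc_le_eq)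
qed

section \<open>A law of large numbers from exponential moments\<close>

lemma exp_le_quadratic: "exp y \<le> 1 + y + y\<^sup>2 * exp \<bar>y\<bar>" for y :: real
proof -
  obtain s where s: "\<bar>s\<bar> \<le> \<bar>y\<bar>" "exp y = (\<Sum>m<2. y ^ m / fact m) + exp s / fact 2 * y ^ 2"
    using Maclaurin_exp_le[of y 2] by blast
  have "exp s \<le> exp \<bar>y\<bar>" using s(1) by simp
  then have "exp s / fact 2 \<le> exp \<bar>y\<bar>" using exp_gt_zero[of s] unfolding fact_2 by linarith
  then have "exp s / fact 2 * y\<^sup>2 \<le> exp \<bar>y\<bar> * y\<^sup>2" by (rule mult_right_mono) simp
  then show ?thesis using s(2) by (simp add: numeral_2_eq_2 mult.commute)
qed

text \<open>Half of the available exponent pays for the factor \<open>x\<^sup>2\<close>, the other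
  half for \<open>exp \<bar>t * x\<bar>\<close>. The constant comes from
  \<open>u\<^sup>2 / 2 \<le> exp u\<close> at \<open>u = s * \<bar>x\<bar> / 2\<close>, that is,
  \<open>x\<^sup>2 \<le> 8 / s\<^sup>2 * exp u\<close>.\<close>

lemma exp_moment_pointwise:
  fixes x :: real
  assumes "0 < s" "0 \<le> t" "t \<le> s / 2"
  shows "exp (t * x) \<le> 1 + t * x + t\<^sup>2 * (8 / s\<^sup>2 * exp (s * \<bar>x\<bar>))"
proof -
  let ?u = "s * \<bar>x\<bar> / 2"
  have "?u\<^sup>2 / 2 \<le> exp ?u"
  proof -
    have "0 \<le> ?u" using assms by simp
    with exp_lower_Taylor_quadratic[OF this] show ?thesis by linarith
  qed
  then have "x\<^sup>2 \<le> 8 / s\<^sup>2 * exp ?u"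
    using assms by (simp add: power_divide power_mult_distrib field_simps)
  moreover have "exp \<bar>t * x\<bar> \<le> exp ?u"
    using mult_right_mono[OF assms(3), of "\<bar>x\<bar>"] assms by (simp add: abs_mult)
  ultimately have "x\<^sup>2 * exp \<bar>t * x\<bar> \<le> (8 / s\<^sup>2 * exp ?u) * exp ?u"
    by (intro mult_mono) auto
  also have "\<dots> = 8 / s\<^sup>2 * exp (s * \<bar>x\<bar>)" by (simp add: exp_add[symmetric])
  finally have "t\<^sup>2 * (x\<^sup>2 * exp \<bar>t * x\<bar>) \<le> t\<^sup>2 * (8 / s\<^sup>2 * exp (s * \<bar>x\<bar>))"
    by (intro mult_left_mono) auto
  then show ?thesis
    using exp_le_quadratic[of "t * x"] by (simp add: power_mult_distrib mult.assoc)
qed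

lemma exp_moment_le:
  fixes X :: "'a \<Rightarrow> real"
  assumes "prob_space M" and X [measurable]: "X \<in> borel_measurable M"
    and int: "integrable M (\<lambda>w. exp (s * \<bar>X w\<bar>))" and s: "0 < s" and \<delta>: "0 < \<delta>"
  obtains t where "0 < t" "(\<integral>\<^sup>+w. exp (t * X w) \<partial>M) \<le> exp (t * ((\<integral>w. X w \<partial>M) + \<delta>))"
proof -
  interpret prob_space M by fact
  define K where "K = (\<integral>w. 8 / s\<^sup>2 * exp (s * \<bar>X w\<bar>) \<partial>M)"
  have K: "0 \<le> K" unfolding K_def by (rule integral_nonneg_AE) simp
  \<comment> \<open>The first bound admits the pointwise estimate; the second makes the quadratic
    term at most \<open>t * \<delta>\<close>, with 1 added because \<open>K\<close> is only known to
    be nonnegative.\<close>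
  define t where "t = min (s / 2) (\<delta> / (K + 1))"
  have t: "0 < t" "t \<le> s / 2" using s \<delta> K unfolding t_def by (simp, intro min.cobounded1)
  have "t \<le> \<delta> / (K + 1)" unfolding t_def by (rule min.cobounded2)
  then have "t * (K + 1) \<le> \<delta>" using K by (simp add: pos_le_divide_eq)
  then have tK: "t * K \<le> \<delta>" using t by (simp add: algebra_simps)
  have abs_le: "\<bar>x\<bar> \<le> 1 / s * exp (s * \<bar>x\<bar>)" for x :: real
  proof -
    have "s * \<bar>x\<bar> \<le> exp (s * \<bar>x\<bar>)" using exp_ge_add_one_self[of "s * \<bar>x\<bar>"] by linarith
    then show ?thesis using s by (simp add: field_simps)
  qed
  have iX: "integrable M X"
    by (rule Bochner_Integration.integrable_bound[where f = "\<lambda>w. 1 / s * exp (s * \<bar>X w\<bar>)"])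
      (use abs_le s in \<open>auto intro!: int\<close>)
  let ?b = "\<lambda>w. 1 + t * X w + t\<^sup>2 * (8 / s\<^sup>2 * exp (s * \<bar>X w\<bar>))"
  have ib: "integrable M ?b"
    by (intro Bochner_Integration.integrable_add integrable_mult_right int iX) simp
  have pw: "exp (t * X w) \<le> ?b w" for w
    using exp_moment_pointwise[OF s _ t(2)] t by simp
  have "(\<integral>\<^sup>+w. exp (t * X w) \<partial>M) \<le> (\<integral>\<^sup>+w. ?b w \<partial>M)"
    by (intro nn_integral_mono ennreal_leI pw)
  also have "\<dots> = ennreal (\<integral>w. ?b w \<partial>M)"
    by (rule nn_integral_eq_integral[OF ib]) (use pw order_trans[OF exp_ge_zero] in \<open>auto intro!: AE_I2\<close>)
  also have "(\<integral>w. ?b w \<partial>M) = 1 + t * (\<integral>w. X w \<partial>M) + t\<^sup>2 * K"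
    unfolding K_def using int iX by (simp add: prob_space)
  also have "\<dots> \<le> 1 + t * ((\<integral>w. X w \<partial>M) + \<delta>)"
    using mult_left_mono[OF tK, of t] t by (simp add: power2_eq_square algebra_simps)
  also have "\<dots> \<le> exp (t * ((\<integral>w. X w \<partial>M) + \<delta>))"
    by (rule exp_ge_add_one_self)
  finally show thesis using t(1) that by (simp add: ennreal_leI)
qed

text \<open>Chernoff's bound followed by Borel-Cantelli. The process enters only through its
  exponential moments at each single time, so \<open>Z n\<close> need not be presented as a sum of
  independent variables, and \<open>X\<close> may live on another probability space.\<close>

lemma AE_eventually_le_mean:
  fixes Z :: "nat \<Rightarrow> 'a \<Rightarrow> real" and X :: "'b \<Rightarrow> real"
  assumes M: "prob_space M" and P: "prob_space P"
    and Z [measurable]: "\<And>n. Z n \<in> borel_measurable M" and X: "X \<in> borel_measurable P"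
    and int: "integrable P (\<lambda>y. exp (s * \<bar>X y\<bar>))" and s: "0 < s" and \<delta>: "0 < \<delta>"
    and mgf: "\<And>n t. (\<integral>\<^sup>+w. exp (t * Z n w) \<partial>M) = (\<integral>\<^sup>+y. exp (t * X y) \<partial>P) ^ n"
  shows "AE w in M. \<forall>\<^sub>F n in sequentially. Z n w \<le> real n * ((\<integral>y. X y \<partial>P) + \<delta>)"
proof -
  interpret prob_space M by fact
  define m where "m = (\<integral>y. X y \<partial>P)"
  \<comment> \<open>Half of \<open>\<delta>\<close> is spent on the moment generating function; the
    other half gives the geometric rate \<open>exp (- t * \<delta> / 2)\<close>.\<close>
  obtain t where t: "0 < t" "(\<integral>\<^sup>+y. exp (t * X y) \<partial>P) \<le> exp (t * (m + \<delta> / 2))"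
    using exp_moment_le[OF P X int s, of "\<delta> / 2"] \<delta> unfolding m_def by auto
  define A where "A n = {w \<in> space M. real n * (m + \<delta>) < Z n w}" for n
  have [measurable]: "A n \<in> sets M" for n unfolding A_def by measurable
  have bound: "emeasure M (A n) \<le> ennreal (exp (- t * \<delta> / 2) ^ n)" for n
  proof -
    have "emeasure M (A n) = (\<integral>\<^sup>+w. indicator (A n) w \<partial>M)" by simp
    also have "\<dots> \<le> (\<integral>\<^sup>+w. ennreal (exp (- t * (real n * (m + \<delta>)))) * ennreal (exp (t * Z n w)) \<partial>M)"
    proof (rule nn_integral_mono)
      fix w
      show "indicator (A n) w \<le> ennreal (exp (- t * (real n * (m + \<delta>)))) * ennreal (exp (t * Z n w))"
      proof (cases "w \<in> A n")
        case True
        then have "0 \<le> t * (Z n w - real n * (m + \<delta>))"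
          using t by (intro mult_nonneg_nonneg) (auto simp: A_def)
        then have "1 \<le> exp (t * (Z n w - real n * (m + \<delta>)))" by simp
        also have "t * (Z n w - real n * (m + \<delta>)) = - t * (real n * (m + \<delta>)) + t * Z n w"
          by (simp add: right_diff_distrib)
        finally show ?thesis
          using True unfolding exp_add by (simp add: ennreal_mult'[symmetric])
      qed simp
    qed
    also have "\<dots> = ennreal (exp (- t * (real n * (m + \<delta>)))) * (\<integral>\<^sup>+y. exp (t * X y) \<partial>P) ^ n"
      by (simp add: nn_integral_cmult mgf)
    also have "\<dots> \<le> ennreal (exp (- t * (real n * (m + \<delta>)))) * ennreal (exp (t * (m + \<delta> / 2))) ^ n"
      using t by (intro mult_left_mono power_mono) auto
    also have "\<dots> = ennreal (exp (- t * \<delta> / 2) ^ n)"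
    proof -
      have "- t * (real n * (m + \<delta>)) + real n * (t * (m + \<delta> / 2)) = real n * (- t * \<delta> / 2)"
        by (simp add: algebra_simps)
      then have "exp (- t * (real n * (m + \<delta>))) * exp (t * (m + \<delta> / 2)) ^ n = exp (- t * \<delta> / 2) ^ n"
        unfolding exp_of_nat_mult[symmetric] exp_add[symmetric] by (rule arg_cong)
      then show ?thesis
        by (simp add: ennreal_power ennreal_mult'[symmetric] del: mult_minus_left)
    qed
    finally show ?thesis .
  qed
  have "norm (measure M (A n)) \<le> exp (- t * \<delta> / 2) ^ n" for n
    using bound[of n] by (simp add: emeasure_eq_measure)
  then have "summable (\<lambda>n. measure M (A n))"
    using t \<delta> by (intro summable_comparison_test'[OF summable_geometric, of "exp (- t * \<delta> / 2)"]) auto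
  then have "AE w in M. \<forall>\<^sub>F n in sequentially. w \<in> space M - A n"
    by (intro borel_cantelli_AE1) (auto simp: less_top[symmetric])
  then show ?thesis
    by (rule AE_mp) (auto simp: A_def m_def not_less elim!: eventually_mono intro!: AE_I2)
qed

text \<open>The moment identity holds for every real \<open>t\<close>, so it passes from
  \<open>Z\<close>, \<open>X\<close> to their negatives, and the one-sided estimate applies
  twice.\<close>

lemma AE_eventually_near_mean:
  fixes Z :: "nat \<Rightarrow> 'a \<Rightarrow> real" and X :: "'b \<Rightarrow> real"
  assumes M: "prob_space M" and P: "prob_space P"
    and Z [measurable]: "\<And>n. Z n \<in> borel_measurable M" and X [measurable]: "X \<in> borel_measurable P"
    and int: "integrable P (\<lambda>y. exp (s * \<bar>X y\<bar>))" and s: "0 < s" and \<delta>: "0 < \<delta>"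
    and mgf: "\<And>n t. (\<integral>\<^sup>+w. exp (t * Z n w) \<partial>M) = (\<integral>\<^sup>+y. exp (t * X y) \<partial>P) ^ n"
  shows "AE w in M. \<forall>\<^sub>F n in sequentially. \<bar>Z n w - real n * (\<integral>y. X y \<partial>P)\<bar> \<le> real n * \<delta>"
proof -
  have mgf': "(\<integral>\<^sup>+w. exp (t * - Z n w) \<partial>M) = (\<integral>\<^sup>+y. exp (t * - X y) \<partial>P) ^ n" for n t
    using mgf[of "- t" n] by simp
  have "AE w in M. \<forall>\<^sub>F n in sequentially. Z n w \<le> real n * ((\<integral>y. X y \<partial>P) + \<delta>)"
    by (rule AE_eventually_le_mean[OF M P Z X int s \<delta> mgf])
  moreover have "AE w in M. \<forall>\<^sub>F n in sequentially. - Z n w \<le> real n * ((\<integral>y. - X y \<partial>P) + \<delta>)"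
    by (rule AE_eventually_le_mean[OF M P _ _ _ s \<delta> mgf']) (use int in auto)
  ultimately show ?thesis
    by eventually_elim (auto elim: eventually_elim2 simp: algebra_simps abs_le_iff)
qed

section \<open>The Markov structure of the column residuals\<close>

lemma has_conditional_law_nn_integral:
  fixes X :: "'w \<Rightarrow> 'b::topological_space"
  assumes "prob_space M" and sub: "subalgebra M F"
    and law: "has_conditional_law M F X \<nu>" and \<nu>: "prob_space \<nu>" and sets_\<nu>: "sets \<nu> = sets borel"
    and Z: "Z \<in> measurable F K" and X [measurable]: "X \<in> measurable M borel"
    and \<phi>: "\<phi> \<in> borel_measurable (K \<Otimes>\<^sub>M borel)"
  shows "(\<integral>\<^sup>+w. \<phi> (Z w, X w) \<partial>M) = (\<integral>\<^sup>+w. (\<integral>\<^sup>+x. \<phi> (Z w, x) \<partial>\<nu>) \<partial>M)"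
proof -
  interpret prob_space M by fact
  interpret \<nu>: prob_space \<nu> by fact
  have "finite_measure_subalgebra M F"
    using sub finite_measure_axioms
    by (simp add: finite_measure_subalgebra_def finite_measure_subalgebra_axioms_def)
  then interpret sigma_finite_subalgebra M F
    by (rule finite_measure_subalgebra_is_sigma_finite)
  have ZM [measurable]: "Z \<in> measurable M K"
    using Z sub by (rule measurable_from_subalg[rotated])
  interpret D: prob_space "distr M K Z" by (rule prob_space_distr) simp
  have "distr M K Z \<Otimes>\<^sub>M \<nu> = distr M (K \<Otimes>\<^sub>M borel) (\<lambda>w. (Z w, X w))"
  proof (rule pair_measure_eqI)
    show "sets (distr M K Z \<Otimes>\<^sub>M \<nu>) = sets (distr M (K \<Otimes>\<^sub>M borel) (\<lambda>w. (Z w, X w)))"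
      by (simp add: sets_\<nu> cong: sets_pair_measure_cong)
    fix A B assume A: "A \<in> sets (distr M K Z)" and B: "B \<in> sets \<nu>"
    then have A': "A \<in> sets K" and B' [measurable]: "B \<in> sets borel" by (simp_all add: sets_\<nu>)
    let ?A = "Z -` A \<inter> space M" and ?f = "\<lambda>w. indicator B (X w) :: real"
    have AF: "?A \<in> sets F"
      using measurable_sets[OF Z A'] sub by (simp add: subalgebra_def)
    then have [measurable]: "?A \<in> sets M" using sub by (auto simp: subalgebra_def)
    have int: "integrable M ?f"
      by (rule integrable_const_bound[where B = 1]) (auto simp: indicator_def)
    have "measure M (?A \<inter> (X -` B \<inter> space M)) = (\<integral>w\<in>?A. ?f w \<partial>M)"
    proof -
      have "(\<integral>w\<in>?A. ?f w \<partial>M) = (\<integral>w. indicator (?A \<inter> (X -` B \<inter> space M)) w \<partial>M)"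
        unfolding set_lebesgue_integral_def
        by (intro Bochner_Integration.integral_cong) (auto simp: indicator_def)
      then show ?thesis by (simp add: Int_ac)
    qed
    also have "\<dots> = (\<integral>w\<in>?A. real_cond_exp M F ?f w \<partial>M)"
      by (rule real_cond_exp_intA[OF int AF])
    also have "\<dots> = (\<integral>w\<in>?A. measure \<nu> B \<partial>M)"
      unfolding set_lebesgue_integral_def
      using law B' by (intro integral_cong_AE) (auto simp: has_conditional_law_def elim!: eventually_mono)
    also have "\<dots> = measure M ?A * measure \<nu> B"
      by (simp add: set_lebesgue_integral_def Int_absorb2 sets.sets_into_space mult.commute)
    finally have "measure M (?A \<inter> (X -` B \<inter> space M)) = measure M ?A * measure \<nu> B" .
    moreover have "emeasure (distr M (K \<Otimes>\<^sub>M borel) (\<lambda>w. (Z w, X w))) (A \<times> B)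
        = emeasure M (?A \<inter> (X -` B \<inter> space M))"
      using A' B' by (subst emeasure_distr) (auto intro!: arg_cong[where f = "emeasure M"])
    moreover have "emeasure (distr M K Z) A = emeasure M ?A"
      using A' by (simp add: emeasure_distr)
    ultimately show "emeasure (distr M K Z) A * emeasure \<nu> B
        = emeasure (distr M (K \<Otimes>\<^sub>M borel) (\<lambda>w. (Z w, X w))) (A \<times> B)"
      by (simp add: emeasure_eq_measure \<nu>.emeasure_eq_measure ennreal_mult')
  qed unfold_locales
  note eq = this[symmetric]
  have \<phi>': "\<phi> \<in> borel_measurable (distr M K Z \<Otimes>\<^sub>M \<nu>)"
    using \<phi> by (simp add: sets_\<nu> cong: measurable_cong_sets sets_pair_measure_cong)
  have "(\<integral>\<^sup>+w. \<phi> (Z w, X w) \<partial>M) = integral\<^sup>N (distr M (K \<Otimes>\<^sub>M borel) (\<lambda>w. (Z w, X w))) \<phi>"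
    using \<phi> by (simp add: nn_integral_distr)
  also have "\<dots> = (\<integral>\<^sup>+z. (\<integral>\<^sup>+x. \<phi> (z, x) \<partial>\<nu>) \<partial>distr M K Z)"
    unfolding eq using \<phi>' by (rule \<nu>.nn_integral_fst[symmetric])
  also have "\<dots> = (\<integral>\<^sup>+w. (\<integral>\<^sup>+x. \<phi> (Z w, x) \<partial>\<nu>) \<partial>M)"
    using \<nu>.borel_measurable_nn_integral_fst[OF \<phi>'] by (subst nn_integral_distr) auto
  finally show ?thesis .
qed

section \<open>The probabilistic setting and its time shifts\<close>

locale gaussian_cocycle = prob_space M
  for M :: "'w measure" and \<sigma> :: "'w \<Rightarrow> 'w" and Q N :: "'w \<Rightarrow> real^'d^'d" +
  assumes automorphism: "measure_preserving_automorphism M \<sigma>"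
    and Q [measurable]: "Q \<in> borel_measurable M"
    and orthogonal_Q: "\<And>w. w \<in> space M \<Longrightarrow> orthogonal_matrix (Q w)"
    and N [measurable]: "N \<in> borel_measurable M"
    and law_N: "has_conditional_law M (environment_algebra M \<sigma> Q N) N std_normal_matrix"
begin

abbreviation "\<tau> \<equiv> the_inv_into (space M) \<sigma>"
abbreviation "\<nu> \<equiv> std_normal_matrix :: (real^'d^'d) measure"

lemma \<sigma> [measurable]: "\<sigma> \<in> measurable M M" and \<tau> [measurable]: "\<tau> \<in> measurable M M"
  and bij_\<sigma>: "bij_betw \<sigma> (space M) (space M)" and distr_\<sigma>: "distr M M \<sigma> = M"
  using automorphism by (simp_all add: measure_preserving_automorphism_def)

lemma funpow_measurable [measurable]: "\<sigma> ^^ n \<in> measurable M M" "\<tau> ^^ n \<in> measurable M M"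
  by (rule measurable_compose_n[OF \<sigma>], rule measurable_compose_n[OF \<tau>])

lemma funpow_space: "w \<in> space M \<Longrightarrow> (\<sigma> ^^ n) w \<in> space M" "w \<in> space M \<Longrightarrow> (\<tau> ^^ n) w \<in> space M"
  by (erule measurable_space[OF funpow_measurable(1)], erule measurable_space[OF funpow_measurable(2)])

lemma \<tau>_\<sigma>_funpow: "w \<in> space M \<Longrightarrow> (\<tau> ^^ n) ((\<sigma> ^^ n) w) = w"
proof (induction n arbitrary: w)
  case (Suc n)
  have "\<tau> (\<sigma> ((\<sigma> ^^ n) w)) = (\<sigma> ^^ n) w"
    using bij_\<sigma> funpow_space(1)[OF Suc.prems] by (intro the_inv_into_f_f) (auto simp: bij_betw_def)
  moreover have "(\<tau> ^^ Suc n) ((\<sigma> ^^ Suc n) w) = (\<tau> ^^ n) (\<tau> (\<sigma> ((\<sigma> ^^ n) w)))"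
    by (simp only: funpow_Suc_right[of n \<tau>] funpow.simps(2)[of n \<sigma>] o_apply)
  ultimately show ?case using Suc.IH[OF Suc.prems] by simp
qed simp

lemma \<sigma>_\<tau>_funpow_le:
  assumes "w \<in> space M" "m \<le> n"
  shows "(\<sigma> ^^ m) ((\<tau> ^^ n) w) = (\<tau> ^^ (n - m)) w"
  using assms(2)
proof (induction m)
  case (Suc m)
  have "(\<sigma> ^^ m) ((\<tau> ^^ n) w) = (\<tau> ^^ (n - m)) w"
    by (rule Suc.IH) (use Suc.prems in linarith)
  also have "n - m = Suc (n - Suc m)" using Suc.prems by linarith
  finally have "(\<sigma> ^^ Suc m) ((\<tau> ^^ n) w) = \<sigma> (\<tau> ((\<tau> ^^ (n - Suc m)) w))"
    unfolding funpow.simps o_def by (rule arg_cong)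
  also have "\<dots> = (\<tau> ^^ (n - Suc m)) w"
    by (rule f_the_inv_into_f_bij_betw[OF bij_\<sigma>]) (rule funpow_space(2)[OF assms(1)])
  finally show ?case .
qed simp

lemma nn_integral_\<sigma>_funpow:
  assumes [measurable]: "f \<in> borel_measurable M"
  shows "(\<integral>\<^sup>+w. f ((\<sigma> ^^ n) w) \<partial>M) = (\<integral>\<^sup>+w. f w \<partial>M)"
proof (induction n)
  case (Suc n)
  have "(\<integral>\<^sup>+w. f ((\<sigma> ^^ n) w) \<partial>M) = (\<integral>\<^sup>+w. f ((\<sigma> ^^ n) w) \<partial>distr M M \<sigma>)"
    by (simp add: distr_\<sigma>)
  also have "\<dots> = (\<integral>\<^sup>+w. f ((\<sigma> ^^ n) (\<sigma> w)) \<partial>M)"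
    by (rule nn_integral_distr) measurable
  finally show ?case using Suc by (simp add: funpow_Suc_right del: funpow.simps(2))
qed simp

abbreviation "F \<equiv> environment_algebra M \<sigma> Q N"

lemma int_iterate_measurable [measurable]: "int_iterate M \<sigma> n \<in> measurable M M"
  by (simp add: int_iterate_def funpow_measurable)

lemma environment_map_measurable:
  "(\<lambda>w. (\<lambda>n\<in>UNIV. Q (int_iterate M \<sigma> n w), \<lambda>n\<in>- {0}. N (int_iterate M \<sigma> n w)))
    \<in> measurable M ((\<Pi>\<^sub>M n\<in>UNIV. borel) \<Otimes>\<^sub>M (\<Pi>\<^sub>M n\<in>- {0}. borel))"
  by (intro measurable_Pair measurable_restrict measurable_compose[OF int_iterate_measurable] Q N)

lemma subalgebra_F: "subalgebra M F"
  unfolding subalgebra_def environment_algebra_def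
  using sets_image_in_sets[OF refl environment_map_measurable] by simp

lemma environment_measurable:
  shows "(\<lambda>w. Q (int_iterate M \<sigma> n w)) \<in> borel_measurable F"
    and "n \<noteq> 0 \<Longrightarrow> (\<lambda>w. N (int_iterate M \<sigma> n w)) \<in> borel_measurable F"
proof -
  let ?g = "\<lambda>w. (\<lambda>n\<in>UNIV. Q (int_iterate M \<sigma> n w), \<lambda>n\<in>- {0}. N (int_iterate M \<sigma> n w))"
  let ?K = "(\<Pi>\<^sub>M n\<in>(UNIV :: int set). borel :: (real^'d^'d) measure) \<Otimes>\<^sub>M (\<Pi>\<^sub>M n\<in>- {0 :: int}. borel :: (real^'d^'d) measure)"
  have g: "?g \<in> measurable F ?K"
    unfolding environment_algebra_def
    using measurable_space[OF environment_map_measurable] by (intro measurable_vimage_algebra1) auto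
  from measurable_compose[OF measurable_compose[OF g measurable_fst] measurable_component_singleton[of n]]
  show "(\<lambda>w. Q (int_iterate M \<sigma> n w)) \<in> borel_measurable F" by simp
  show "(\<lambda>w. N (int_iterate M \<sigma> n w)) \<in> borel_measurable F" if "n \<noteq> 0"
    using measurable_compose[OF measurable_compose[OF g measurable_snd] measurable_component_singleton[of n]] that
    by simp
qed

definition A :: "real \<Rightarrow> 'w \<Rightarrow> real^'d^'d" where "A e w = Q w + e *\<^sub>R N w"

lemma A_measurable [measurable]: "A e \<in> borel_measurable M"
  unfolding A_def by measurable

lemma cocycle_measurable [measurable]: "cocycle \<sigma> (A e) n \<in> borel_measurable M"
proof (induction n)
  case (Suc n)
  note [measurable] = Suc
  have [measurable]: "(\<lambda>w. A e ((\<sigma> ^^ n) w)) \<in> borel_measurable M"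
    by (rule measurable_compose[OF funpow_measurable(1) A_measurable])
  show ?case by simp
qed simp

text \<open>Started at time \<open>- n\<close>, the \<open>n\<close>-step cocycle involves the noise
  at the times \<open>- n\<close> to \<open>- 1\<close> only. Time 0, the one at which
  \<open>N\<close> is omitted from the conditioning, is never reached.\<close>

lemma past_measurable: "(\<lambda>w. cocycle \<sigma> (A e) n ((\<tau> ^^ n) w)) \<in> borel_measurable F"
proof -
  have "(\<lambda>w. cocycle \<sigma> (A e) m ((\<tau> ^^ n) w)) \<in> borel_measurable F" if "m \<le> n" for m
    using that
  proof (induction m)
    case (Suc m)
    \<comment> \<open>The time of the next factor; it is nonzero because
      \<open>m < n\<close>.\<close>
    define j where "j = - int (n - m)"
    have j: "j \<noteq> 0" "(\<tau> ^^ (n - m)) w = int_iterate M \<sigma> j w" for w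
      using Suc.prems by (auto simp: j_def int_iterate_def nat_diff_distrib)
    note [measurable] = environment_measurable(1)[of j] environment_measurable(2)[OF j(1)]
    have "(\<lambda>w. A e (int_iterate M \<sigma> j w)) \<in> borel_measurable F"
      unfolding A_def by measurable
    then have *: "(\<lambda>w. A e (int_iterate M \<sigma> j w) ** cocycle \<sigma> (A e) m ((\<tau> ^^ n) w)) \<in> borel_measurable F"
      using Suc by (intro borel_measurable_matrix_mult) auto
    show ?case
    proof (rule measurable_cong[THEN iffD1, OF _ *])
      fix w assume "w \<in> space F"
      then have "w \<in> space M" using subalgebra_F by (simp add: subalgebra_def)
      then show "A e (int_iterate M \<sigma> j w) ** cocycle \<sigma> (A e) m ((\<tau> ^^ n) w) = cocycle \<sigma> (A e) (Suc m) ((\<tau> ^^ n) w)"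
        using Suc.prems by (simp add: \<sigma>_\<tau>_funpow_le j(2))
    qed
  qed simp
  then show ?thesis by simp
qed

text \<open>The conditional law is given at time 0, but is needed at time \<open>n\<close>.
  Invariance of the measure moves the integral back by \<open>n\<close> steps, where the cocycle
  lies in the past and \<open>N\<close> is independent of it and of \<open>Q\<close>; after
  replacing the noise by a copy, the integral is moved forward again.\<close>

lemma markov_step:
  assumes \<phi>: "\<phi> \<in> borel_measurable ((borel \<Otimes>\<^sub>M borel) \<Otimes>\<^sub>M borel)"
  shows "(\<integral>\<^sup>+w. \<phi> ((cocycle \<sigma> (A e) n w, Q ((\<sigma> ^^ n) w)), N ((\<sigma> ^^ n) w)) \<partial>M)
       = (\<integral>\<^sup>+w. (\<integral>\<^sup>+G. \<phi> ((cocycle \<sigma> (A e) n w, Q ((\<sigma> ^^ n) w)), G) \<partial>\<nu>) \<partial>M)"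
proof -
  interpret \<nu>: prob_space \<nu> by (rule prob_space_std_normal_matrix)
  let ?Z = "\<lambda>w. (cocycle \<sigma> (A e) n ((\<tau> ^^ n) w), Q w)"
  have Z: "?Z \<in> measurable F (borel \<Otimes>\<^sub>M borel)"
    using environment_measurable(1)[of 0] past_measurable
    by (intro measurable_Pair) (auto simp: int_iterate_def)
  then have ZM [measurable]: "?Z \<in> measurable M (borel \<Otimes>\<^sub>M borel)"
    using subalgebra_F by (rule measurable_from_subalg[rotated])
  note \<phi> [measurable]
  have \<phi>': "\<phi> \<in> borel_measurable ((borel \<Otimes>\<^sub>M borel) \<Otimes>\<^sub>M \<nu>)"
    using \<phi> by (simp cong: measurable_cong_sets sets_pair_measure_cong)
  have "(\<integral>\<^sup>+w. \<phi> ((cocycle \<sigma> (A e) n w, Q ((\<sigma> ^^ n) w)), N ((\<sigma> ^^ n) w)) \<partial>M)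
      = (\<integral>\<^sup>+w. \<phi> (?Z ((\<sigma> ^^ n) w), N ((\<sigma> ^^ n) w)) \<partial>M)"
    by (intro nn_integral_cong) (simp add: \<tau>_\<sigma>_funpow)
  also have "\<dots> = (\<integral>\<^sup>+w. \<phi> (?Z w, N w) \<partial>M)"
    by (rule nn_integral_\<sigma>_funpow) measurable
  also have "\<dots> = (\<integral>\<^sup>+w. (\<integral>\<^sup>+G. \<phi> (?Z w, G) \<partial>\<nu>) \<partial>M)"
    by (rule has_conditional_law_nn_integral[OF prob_space_axioms subalgebra_F law_N
          prob_space_std_normal_matrix _ Z N \<phi>]) simp
  also have "\<dots> = (\<integral>\<^sup>+w. (\<integral>\<^sup>+G. \<phi> (?Z ((\<sigma> ^^ n) w), G) \<partial>\<nu>) \<partial>M)"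
    by (rule nn_integral_\<sigma>_funpow[symmetric])
      (rule measurable_compose[OF ZM \<nu>.borel_measurable_nn_integral_fst[OF \<phi>']])
  also have "\<dots> = (\<integral>\<^sup>+w. (\<integral>\<^sup>+G. \<phi> ((cocycle \<sigma> (A e) n w, Q ((\<sigma> ^^ n) w)), G) \<partial>\<nu>) \<partial>M)"
    by (intro nn_integral_cong) (simp add: \<tau>_\<sigma>_funpow)
  finally show ?thesis .
qed

lemma step_law:
  assumes L: "distinct L" "k \<notin> set L" and L': "distinct L'" "k' \<notin> set L'" "length L = length L'"
    and good: "AE w in M. \<forall>(L :: 'd list) k. distinct L \<longrightarrow> k \<notin> set L \<longrightarrow> 0 < colres L k (cocycle \<sigma> (A e) n w)"
    and g [measurable]: "g \<in> borel_measurable borel"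
  shows "(\<integral>\<^sup>+w. g (colres L k (cocycle \<sigma> (A e) (Suc n) w)) \<partial>M)
       = (\<integral>\<^sup>+w. (\<integral>\<^sup>+G. g (colres L k (cocycle \<sigma> (A e) n w) * colres L' k' (mat 1 + e *\<^sub>R G)) \<partial>\<nu>) \<partial>M)"
proof -
  let ?\<phi> = "\<lambda>x :: ((real^'d^'d) \<times> (real^'d^'d)) \<times> (real^'d^'d). g (colres L k ((snd (fst x) + e *\<^sub>R snd x) ** fst (fst x)))"
  have \<phi>: "?\<phi> \<in> borel_measurable ((borel \<Otimes>\<^sub>M borel) \<Otimes>\<^sub>M borel)"
    by (intro measurable_compose[OF _ g] borel_measurable_colres borel_measurable_matrix_mult
        borel_measurable_add borel_measurable_scaleR) measurable
  have "(\<integral>\<^sup>+w. g (colres L k (cocycle \<sigma> (A e) (Suc n) w)) \<partial>M)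
      = (\<integral>\<^sup>+w. (\<integral>\<^sup>+G. g (colres L k ((Q ((\<sigma> ^^ n) w) + e *\<^sub>R G) ** cocycle \<sigma> (A e) n w)) \<partial>\<nu>) \<partial>M)"
    using markov_step[OF \<phi>, of e n] by (simp add: A_def)
  also have "\<dots> = (\<integral>\<^sup>+w. (\<integral>\<^sup>+G. g (colres L k (cocycle \<sigma> (A e) n w) * colres L' k' (mat 1 + e *\<^sub>R G)) \<partial>\<nu>) \<partial>M)"
    using good AE_space[of M]
  proof (intro nn_integral_cong_AE, eventually_elim)
    case (elim w)
    then show ?case
      using orthogonal_Q[OF funpow_space(1)] by (intro colres_step_law[OF L L']) auto
  qed
  finally show ?thesis .
qed

context
  fixes e :: real
  assumes pos: "\<And>(L :: 'd list) k. distinct L \<Longrightarrow> k \<notin> set L \<Longrightarrow> AE G in \<nu>. 0 < colres L k (mat 1 + e *\<^sub>R G)"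
begin

text \<open>Positivity of all residuals at time \<open>n\<close> is what makes the QR argument
  available for the step to \<open>n + 1\<close>, so it is carried by its own induction: integrating
  the indicator of nonpositive values through the step law gives 0.\<close>

lemma AE_colres_cocycle_pos:
  "AE w in M. \<forall>(L :: 'd list) k. distinct L \<longrightarrow> k \<notin> set L \<longrightarrow> 0 < colres L k (cocycle \<sigma> (A e) n w)"
proof (induction n)
  case (Suc n)
  have "AE w in M. 0 < colres L k (cocycle \<sigma> (A e) (Suc n) w)"
    if L: "distinct L" "k \<notin> set L" for L :: "'d list" and k
  proof -
    let ?g = "indicator {.. 0} :: real \<Rightarrow> ennreal"
    have "(\<integral>\<^sup>+w. ?g (colres L k (cocycle \<sigma> (A e) (Suc n) w)) \<partial>M)
        = (\<integral>\<^sup>+w. (\<integral>\<^sup>+G. ?g (colres L k (cocycle \<sigma> (A e) n w) * colres L k (mat 1 + e *\<^sub>R G)) \<partial>\<nu>) \<partial>M)"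
      by (rule step_law[OF L L refl]) (use Suc in auto)
    also have "\<dots> = (\<integral>\<^sup>+w. 0 \<partial>M)"
      using Suc
    proof (intro nn_integral_cong_AE, eventually_elim)
      case (elim w)
      then have B: "0 < colres L k (cocycle \<sigma> (A e) n w)" using L by blast
      have "(\<integral>\<^sup>+G. ?g (colres L k (cocycle \<sigma> (A e) n w) * colres L k (mat 1 + e *\<^sub>R G)) \<partial>\<nu>) = (\<integral>\<^sup>+G. 0 \<partial>\<nu>)"
        using pos[OF L] B
        by (intro nn_integral_cong_AE) (auto elim!: eventually_mono simp: indicator_def mult_le_0_iff)
      then show ?case by simp
    qed
    finally have "(\<integral>\<^sup>+w. ?g (colres L k (cocycle \<sigma> (A e) (Suc n) w)) \<partial>M) = 0" by simp
    then have "AE w in M. ?g (colres L k (cocycle \<sigma> (A e) (Suc n) w)) = 0"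
      by (subst (asm) nn_integral_0_iff_AE) auto
    then show ?thesis by (auto elim!: eventually_mono simp: indicator_def split: if_splits)
  qed
  then show ?case
    by (intro AE_all_countable[THEN iffD2] allI AE_impI) auto
qed (simp add: colres_mat_1)

text \<open>Each step contributes the same factor, computed from the fixed reference pair
  \<open>L'\<close>, \<open>k'\<close>. Hence all lists of one length share one growth rate.\<close>

lemma mgf_colres_cocycle:
  assumes L: "distinct L" "k \<notin> set L" and L': "distinct L'" "k' \<notin> set L'" "length L = length L'"
  shows "(\<integral>\<^sup>+w. exp (t * ln (colres L k (cocycle \<sigma> (A e) n w))) \<partial>M)
       = (\<integral>\<^sup>+G. exp (t * ln (colres L' k' (mat 1 + e *\<^sub>R G))) \<partial>\<nu>) ^ n"
proof (induction n)
  case 0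
  then show ?case by (simp add: colres_mat_1[OF L] emeasure_space_1)
next
  case (Suc n)
  let ?c = "\<integral>\<^sup>+G. exp (t * ln (colres L' k' (mat 1 + e *\<^sub>R G))) \<partial>\<nu>"
  let ?B = "cocycle \<sigma> (A e) n"
  have "(\<integral>\<^sup>+w. exp (t * ln (colres L k (cocycle \<sigma> (A e) (Suc n) w))) \<partial>M)
      = (\<integral>\<^sup>+w. (\<integral>\<^sup>+G. exp (t * ln (colres L k (?B w) * colres L' k' (mat 1 + e *\<^sub>R G))) \<partial>\<nu>) \<partial>M)"
    by (rule step_law[OF L L' AE_colres_cocycle_pos, of "\<lambda>x. ennreal (exp (t * ln x))"]) simp
  also have "\<dots> = (\<integral>\<^sup>+w. ennreal (exp (t * ln (colres L k (?B w)))) * ?c \<partial>M)"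
    using AE_colres_cocycle_pos[of n]
  proof (intro nn_integral_cong_AE, eventually_elim)
    case (elim w)
    then have B: "0 < colres L k (?B w)" using L by blast
    have "(\<integral>\<^sup>+G. exp (t * ln (colres L k (?B w) * colres L' k' (mat 1 + e *\<^sub>R G))) \<partial>\<nu>)
        = (\<integral>\<^sup>+G. ennreal (exp (t * ln (colres L k (?B w)))) * ennreal (exp (t * ln (colres L' k' (mat 1 + e *\<^sub>R G)))) \<partial>\<nu>)"
      using pos[OF L'(1,2)]
    proof (intro nn_integral_cong_AE, eventually_elim)
      case (elim G)
      with B show ?case
        by (simp add: ln_mult_pos distrib_left exp_add ennreal_mult')
    qed
    also have "\<dots> = ennreal (exp (t * ln (colres L k (?B w)))) * ?c"
      by (rule nn_integral_cmult) simp
    finally show ?case .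
  qed
  also have "\<dots> = ?c ^ n * ?c"
    using Suc by (simp add: nn_integral_multc)
  finally show ?case by (simp add: mult.commute)
qed

lemma AE_colres_cocycle_growth:
  assumes s: "0 < s" and L': "distinct L'" "k' \<notin> set L'"
    and int: "integrable \<nu> (\<lambda>G. exp (s * \<bar>ln (colres L' k' (mat 1 + e *\<^sub>R G))\<bar>))"
    and L: "distinct L" "k \<notin> set L" "length L = length L'" and \<delta>: "0 < \<delta>"
  shows "AE w in M. \<forall>\<^sub>F n in sequentially.
    \<bar>ln (colres L k (cocycle \<sigma> (A e) n w)) - real n * (\<integral>G. ln (colres L' k' (mat 1 + e *\<^sub>R G)) \<partial>\<nu>)\<bar> \<le> real n * \<delta>"
  by (rule AE_eventually_near_mean[OF prob_space_axioms prob_space_std_normal_matrix _ _ int s \<delta>])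
    (use mgf_colres_cocycle[OF L(1,2) L' L(3)] in auto)

end

end

section \<open>Expansion of a residual near the identity\<close>

lemma span_image_sum:
  assumes "finite S" "p \<in> span (f ` S)"
  obtains y where "p = (\<Sum>s\<in>S. y s *\<^sub>R f s)"
proof -
  let ?R = "range (\<lambda>y. \<Sum>s\<in>S. y s *\<^sub>R f s)"
  have "subspace ?R"
  proof (rule subspaceI)
    show "0 \<in> ?R" by (rule range_eqI[of _ _ "\<lambda>_. 0"]) simp
    fix a b assume "a \<in> ?R" "b \<in> ?R"
    then obtain y y' where "a = (\<Sum>s\<in>S. y s *\<^sub>R f s)" "b = (\<Sum>s\<in>S. y' s *\<^sub>R f s)" by blast
    then show "a + b \<in> ?R"
      by (intro range_eqI[of _ _ "\<lambda>s. y s + y' s"]) (simp add: scaleR_add_left sum.distrib)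
  next
    fix c a assume "a \<in> ?R"
    then obtain y where "a = (\<Sum>s\<in>S. y s *\<^sub>R f s)" by blast
    then show "c *\<^sub>R a \<in> ?R"
      by (intro range_eqI[of _ _ "\<lambda>s. c * y s"]) (simp add: scaleR_sum_right)
  qed
  moreover have "f s \<in> ?R" if "s \<in> S" for s
  proof (rule range_eqI[of _ _ "\<lambda>t. if t = s then 1 else 0"])
    have "(\<Sum>t\<in>S. (if t = s then 1 else 0) *\<^sub>R f t) = (\<Sum>t\<in>S. if t = s then f t else 0)"
      by (intro sum.cong) auto
    then show "f s = (\<Sum>t\<in>S. (if t = s then 1 else 0) *\<^sub>R f t)"
      using assms(1) that by simp
  qed
  ultimately have "span (f ` S) \<subseteq> ?R" by (intro span_minimal) auto
  then show thesis using assms(2) that by blast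
qed

lemma norm_column_le: "norm (column l H) \<le> norm (H :: real^'n^'n)"
proof -
  have "column l H = transpose H $ l" by (simp add: column_def transpose_def vec_eq_iff)
  then show ?thesis using Finite_Cartesian_Product.norm_nth_le[where x = "transpose H" and i = l] by (simp add: norm_matrix_transpose)
qed

lemma abs_entry_le: "\<bar>H $ i $ j\<bar> \<le> norm (H :: real^'n^'n)"
  using component_le_norm_cart[of "H $ i" j] Finite_Cartesian_Product.norm_nth_le[where x = H and i = i] by linarith

lemma abs_inner_le: "norm x \<le> a \<Longrightarrow> norm y \<le> b \<Longrightarrow> \<bar>x \<bullet> y\<bar> \<le> a * b"
  using Cauchy_Schwarz_ineq2[of x y] mult_mono[of "norm x" a "norm y" b]
  by (meson norm_ge_zero order_trans)

lemma norm_sum_scaleR_le: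
  assumes "\<And>l. l \<in> S \<Longrightarrow> \<bar>a l\<bar> \<le> A" "\<And>l. l \<in> S \<Longrightarrow> norm (v l) \<le> B" "0 \<le> A"
  shows "norm (\<Sum>l\<in>S. a l *\<^sub>R v l) \<le> real (card S) * (A * B)"
proof -
  have "norm (\<Sum>l\<in>S. a l *\<^sub>R v l) \<le> (\<Sum>l\<in>S. A * B)"
    using assms by (intro sum_norm_le) (auto intro!: mult_mono)
  then show ?thesis by simp
qed

text \<open>The test vector \<open>z = x - (\<Sum>l. (x \<bullet> c l) c l)\<close> is orthogonal to the columns \<open>c l\<close> up to
  second order, so its squared length equals that of the residual up to fourth order.\<close>

lemma colres_square_expansion:
  fixes L :: "'n::finite list"
  assumes L: "distinct L" "k \<notin> set L"
  obtains C \<delta> :: real and p3 :: "real^'n^'n \<Rightarrow> real"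
  where "0 < C" "0 < \<delta>" "\<delta> \<le> 1" "\<And>H. p3 (- H) = - p3 H"
    and "\<And>H. norm H \<le> \<delta> \<Longrightarrow> \<bar>p3 H\<bar> \<le> C * norm H ^ 3"
    and "\<And>H. norm H \<le> \<delta> \<Longrightarrow>
      \<bar>(colres L k (mat 1 + H))\<^sup>2 - (1 + 2 * H $ k $ k
        + ((norm (column k H))\<^sup>2 - (\<Sum>l\<in>set L. (H $ k $ l + H $ l $ k)\<^sup>2)) + p3 H)\<bar> \<le> C * norm H ^ 4"
proof -
  let ?S = "set L" and ?e = "\<lambda>m. axis m 1 :: real^'n"
  define D where "D = real (card ?S)"
  define K where "K = 1 + 3 * D"
  define \<beta> where "\<beta> H l = H $ k $ l + H $ l $ k" for H :: "real^'n^'n" and l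
  define \<gamma> where "\<gamma> H l = column l H \<bullet> column k H" for H :: "real^'n^'n" and l
  \<comment> \<open>Split by degree in \<open>H\<close>: the inner product of columns
    \<open>l\<close> and \<open>k\<close> of \<open>mat 1 + H\<close> is
    \<open>\<beta> H l + \<gamma> H l\<close>, and \<open>z1\<close>, \<open>z2\<close>,
    \<open>z3\<close> are the parts of degree 1, 2 and 3 of the test vector. The cubic part
    \<open>p3\<close> of its squared norm pairs degrees of opposite parity and is odd.\<close>
  define z1 where "z1 H = column k H - (\<Sum>l\<in>?S. \<beta> H l *\<^sub>R ?e l)" for H
  define z2 where "z2 H = - ((\<Sum>l\<in>?S. \<gamma> H l *\<^sub>R ?e l) + (\<Sum>l\<in>?S. \<beta> H l *\<^sub>R column l H))" for H
  define z3 where "z3 H = - (\<Sum>l\<in>?S. \<gamma> H l *\<^sub>R column l H)" for H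
  define p3 where "p3 H = 2 * (?e k \<bullet> z3 H + z1 H \<bullet> z2 H)" for H
  \<comment> \<open>Small enough that \<open>D * norm H \<le> 1 / 2\<close>, which keeps the columns
    in \<open>L\<close> uniformly independent.\<close>
  define \<delta> where "\<delta> = 1 / (2 * (D + 1))"
  \<comment> \<open>The three summands bound the cubic part, the terms of degree at least 4 in the
    squared norm of the test vector, and the squared norm of its projection onto the columns in
    \<open>L\<close>.\<close>
  define C where "C = 2 * (K + K * K) + 6 * (K * K) + 324 * D ^ 4"
  have D: "0 \<le> D" by (simp add: D_def)
  then have K: "1 \<le> K" "D \<le> K" "3 * D \<le> K" "1 + 2 * D \<le> K" by (auto simp: K_def)
  have \<delta>: "0 < \<delta>" "\<delta> \<le> 1" using D by (auto simp: \<delta>_def field_simps)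
  have C: "0 < C" "2 * (K + K * K) \<le> C" "6 * (K * K) + 324 * D ^ 4 \<le> C"
    using K D unfolding C_def by (auto intro!: add_pos_nonneg)
  have cneg: "column l (- H) = - column l H" for l and H :: "real^'n^'n"
    by (simp add: column_def vec_eq_iff)
  have odd: "p3 (- H) = - p3 H" for H
  proof -
    have "\<beta> (- H) l = - \<beta> H l" "\<gamma> (- H) l = \<gamma> H l" for l
      by (simp_all add: \<beta>_def \<gamma>_def cneg)
    then have "z1 (- H) = - z1 H" "z2 (- H) = z2 H" "z3 (- H) = - z3 H"
      by (simp_all add: z1_def z2_def z3_def cneg sum_negf)
    then show ?thesis by (simp add: p3_def)
  qed
  have main: "\<bar>p3 H\<bar> \<le> C * norm H ^ 3 \<and> \<bar>(colres L k (mat 1 + H))\<^sup>2 - (1 + 2 * H $ k $ k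
        + ((norm (column k H))\<^sup>2 - (\<Sum>l\<in>?S. (H $ k $ l + H $ l $ k)\<^sup>2)) + p3 H)\<bar> \<le> C * norm H ^ 4"
    if H: "norm H \<le> \<delta>" for H
  proof -
    define \<eta> where "\<eta> = norm H"
    have \<eta>: "0 \<le> \<eta>" "\<eta> \<le> 1" "D * \<eta> \<le> 1 / 2"
    proof -
      show "0 \<le> \<eta>" "\<eta> \<le> 1" using H \<delta> by (auto simp: \<eta>_def)
      have "D * \<eta> \<le> D * \<delta>" using H D by (auto simp: \<eta>_def intro: mult_left_mono)
      also have "\<dots> \<le> 1 / 2" using D by (simp add: \<delta>_def field_simps)
      finally show "D * \<eta> \<le> 1 / 2" .
    qed
    have pw: "\<eta> ^ 2 \<le> \<eta>" "\<eta> ^ 4 \<le> \<eta> ^ 3" "\<eta> ^ 5 \<le> \<eta> ^ 4" "\<eta> ^ 6 \<le> \<eta> ^ 4"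
      using \<eta> power_decreasing[of 1 2 \<eta>] power_decreasing[of 3 4 \<eta>] power_decreasing[of 4 5 \<eta>]
        power_decreasing[of 4 6 \<eta>] by simp_all
    let ?h = "\<lambda>m. column m H" and ?c = "\<lambda>m. column m (mat 1 + H)"
    have c: "?c m = ?e m + ?h m" for m
      by (simp add: column_def mat_def axis_def vec_eq_iff)
    have h: "norm (?h m) \<le> \<eta>" for m unfolding \<eta>_def by (rule norm_column_le)
    have ent: "\<bar>H $ i $ j\<bar> \<le> \<eta>" for i j unfolding \<eta>_def by (rule abs_entry_le)
    have b1: "\<bar>\<beta> H l\<bar> \<le> 2 * \<eta>" for l using ent[of k l] ent[of l k] by (simp add: \<beta>_def)
    have b2: "\<bar>\<gamma> H l\<bar> \<le> \<eta>\<^sup>2" for l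
      using abs_inner_le[OF h h] by (simp add: \<gamma>_def power2_eq_square)
    have ee: "?e i \<bullet> ?e j = (if i = j then 1 else 0)" for i j by (simp add: inner_axis_axis)
    have eh: "?e i \<bullet> ?h j = H $ i $ j" "?h j \<bullet> ?e i = H $ i $ j" for i j
      by (simp_all add: inner_axis inner_axis' column_def)
    define b where "b l = \<beta> H l + \<gamma> H l" for l
    have b: "?c l \<bullet> ?c k = b l" if "l \<in> ?S" for l
      using that L by (auto simp: c inner_add_left inner_add_right ee eh b_def \<beta>_def \<gamma>_def)
    have b3: "\<bar>b l\<bar> \<le> 3 * \<eta>" for l
      using b1[of l] b2[of l] pw(1) by (simp add: b_def)
    define z where "z = ?e k + z1 H + z2 H + z3 H"
    have z: "z = ?c k - (\<Sum>l\<in>?S. b l *\<^sub>R ?c l)"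
      unfolding z_def z1_def z2_def z3_def c b_def
      by (simp add: scaleR_add_left scaleR_add_right sum.distrib)
    have n1: "norm (z1 H) \<le> K * \<eta>"
    proof -
      have "norm (\<Sum>l\<in>?S. \<beta> H l *\<^sub>R ?e l) \<le> D * (2 * \<eta> * 1)"
        unfolding D_def by (rule norm_sum_scaleR_le) (use b1 \<eta> in auto)
      then have "norm (z1 H) \<le> \<eta> + D * (2 * \<eta> * 1)"
        unfolding z1_def using norm_triangle_ineq4[of "?h k" "\<Sum>l\<in>?S. \<beta> H l *\<^sub>R ?e l"] h[of k] by linarith
      also have "\<dots> = (1 + 2 * D) * \<eta>" by (simp add: algebra_simps)
      also have "\<dots> \<le> K * \<eta>" using K \<eta> by (intro mult_right_mono) auto
      finally show ?thesis .
    qed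
    have n2: "norm (z2 H) \<le> K * \<eta>\<^sup>2"
    proof -
      have "norm (\<Sum>l\<in>?S. \<gamma> H l *\<^sub>R ?e l) \<le> D * (\<eta>\<^sup>2 * 1)"
        unfolding D_def by (rule norm_sum_scaleR_le) (use b2 \<eta> in auto)
      moreover have "norm (\<Sum>l\<in>?S. \<beta> H l *\<^sub>R ?h l) \<le> D * (2 * \<eta> * \<eta>)"
        unfolding D_def by (rule norm_sum_scaleR_le) (use b1 h \<eta> in auto)
      ultimately have "norm (z2 H) \<le> D * (\<eta>\<^sup>2 * 1) + D * (2 * \<eta> * \<eta>)"
        unfolding z2_def norm_minus_cancel by (rule order_trans[OF norm_triangle_ineq add_mono])
      also have "\<dots> = 3 * D * \<eta>\<^sup>2" by (simp add: power2_eq_square)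
      also have "\<dots> \<le> K * \<eta>\<^sup>2" using K by (intro mult_right_mono) auto
      finally show ?thesis .
    qed
    have n3: "norm (z3 H) \<le> K * \<eta> ^ 3"
    proof -
      have "norm (z3 H) \<le> D * (\<eta>\<^sup>2 * \<eta>)"
        unfolding z3_def norm_minus_cancel D_def by (rule norm_sum_scaleR_le) (use b2 h \<eta> in auto)
      also have "\<dots> = D * \<eta> ^ 3" by (simp add: power2_eq_square power3_eq_cube)
      also have "\<dots> \<le> K * \<eta> ^ 3" using K \<eta> by (intro mult_right_mono) auto
      finally show ?thesis .
    qed
    have B3: "\<bar>p3 H\<bar> \<le> C * \<eta> ^ 3"
    proof -
      have aux: "\<bar>2 * (u + v)\<bar> \<le> 2 * (a + b)" if "\<bar>u\<bar> \<le> a" "\<bar>v\<bar> \<le> b" for u v a b :: real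
        using that by (auto simp: abs_le_iff algebra_simps)
      have "\<bar>?e k \<bullet> z3 H\<bar> \<le> K * \<eta> ^ 3"
        using abs_inner_le[of "?e k" 1 "z3 H" "K * \<eta> ^ 3"] n3 by simp
      moreover have "\<bar>z1 H \<bullet> z2 H\<bar> \<le> (K * \<eta>) * (K * \<eta>\<^sup>2)" by (rule abs_inner_le[OF n1 n2])
      ultimately have "\<bar>p3 H\<bar> \<le> 2 * (K * \<eta> ^ 3 + (K * \<eta>) * (K * \<eta>\<^sup>2))"
        unfolding p3_def by (rule aux)
      also have "\<dots> = 2 * (K + K * K) * \<eta> ^ 3" by (simp add: power2_eq_square power3_eq_cube algebra_simps)
      also have "\<dots> \<le> C * \<eta> ^ 3" using C \<eta> by (intro mult_right_mono) auto
      finally show ?thesis .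
    qed
    define R where "R = z2 H \<bullet> z2 H + 2 * (z1 H \<bullet> z3 H) + 2 * (z2 H \<bullet> z3 H) + z3 H \<bullet> z3 H"
    have zz: "z \<bullet> z = 1 + 2 * H $ k $ k + ((norm (?h k))\<^sup>2 - (\<Sum>l\<in>?S. (\<beta> H l)\<^sup>2)) + p3 H + R"
    proof -
      have eS: "?e k \<bullet> (\<Sum>l\<in>?S. f l *\<^sub>R ?e l) = 0" for f
        using L by (auto simp: inner_sum_right ee intro!: sum.neutral)
      have ez1: "?e k \<bullet> z1 H = H $ k $ k" by (simp add: z1_def inner_diff_right eh eS)
      have ez2: "?e k \<bullet> z2 H = - (\<Sum>l\<in>?S. \<beta> H l * H $ k $ l)"
        by (simp add: z2_def inner_diff_right eS) (simp add: inner_sum_right eh)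
      define E where "E = (\<Sum>l\<in>?S. \<beta> H l *\<^sub>R ?e l)"
      have Ee: "E \<bullet> ?e l = \<beta> H l" if "l \<in> ?S" for l
        using that by (simp add: E_def inner_sum_left ee if_distrib[of "(*) _"] cong: if_cong)
      have "E \<bullet> E = E \<bullet> (\<Sum>l\<in>?S. \<beta> H l *\<^sub>R ?e l)" by (simp only: E_def)
      also have "\<dots> = (\<Sum>l\<in>?S. \<beta> H l * (E \<bullet> ?e l))" by (simp only: inner_sum_right inner_scaleR_right)
      also have "\<dots> = (\<Sum>l\<in>?S. (\<beta> H l)\<^sup>2)"
        by (intro sum.cong) (simp_all add: Ee power2_eq_square)
      finally have EE: "E \<bullet> E = (\<Sum>l\<in>?S. (\<beta> H l)\<^sup>2)" .
      have hE: "?h k \<bullet> E = (\<Sum>l\<in>?S. \<beta> H l * H $ l $ k)"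
        by (simp add: E_def inner_sum_right eh)
      have "z1 H = ?h k - E" by (simp add: z1_def E_def)
      then have "z1 H \<bullet> z1 H = ?h k \<bullet> ?h k - 2 * (?h k \<bullet> E) + E \<bullet> E"
        by (simp add: inner_diff_left inner_diff_right inner_commute[of E "?h k"])
      then have "z1 H \<bullet> z1 H = ?h k \<bullet> ?h k - 2 * (\<Sum>l\<in>?S. \<beta> H l * H $ l $ k) + (\<Sum>l\<in>?S. (\<beta> H l)\<^sup>2)"
        by (simp add: EE hE)
      \<comment> \<open>One factor of each square is split into its two entries. The cross terms
        from \<open>z1 H \<bullet> z1 H\<close> and from \<open>2 * (?e k \<bullet> z2 H)\<close>
        then add up to minus twice this sum, which leaves the squared column minus the sum of
        squares.\<close>
      moreover have "(\<Sum>l\<in>?S. (\<beta> H l)\<^sup>2) = (\<Sum>l\<in>?S. \<beta> H l * H $ l $ k) + (\<Sum>l\<in>?S. \<beta> H l * H $ k $ l)"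
        by (simp add: sum.distrib[symmetric] \<beta>_def power2_eq_square algebra_simps)
      ultimately have "z1 H \<bullet> z1 H + 2 * (?e k \<bullet> z2 H) = (norm (?h k))\<^sup>2 - (\<Sum>l\<in>?S. (\<beta> H l)\<^sup>2)"
        by (simp add: ez2 power2_norm_eq_inner)
      moreover have "z \<bullet> z = 1 + 2 * (?e k \<bullet> z1 H) + (z1 H \<bullet> z1 H + 2 * (?e k \<bullet> z2 H)) + p3 H + R"
        unfolding z_def p3_def R_def
        by (simp add: inner_add_left inner_add_right ee inner_commute algebra_simps)
      ultimately show ?thesis by (simp add: ez1)
    qed
    have BR: "\<bar>R\<bar> \<le> 6 * (K * K) * \<eta> ^ 4"
    proof -
      have "\<bar>z2 H \<bullet> z2 H\<bar> \<le> (K * \<eta>\<^sup>2) * (K * \<eta>\<^sup>2)" by (rule abs_inner_le[OF n2 n2])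
      also have "\<dots> = K * K * \<eta> ^ 4" by (simp add: power2_eq_square power4_eq_xxxx)
      finally have r1: "\<bar>z2 H \<bullet> z2 H\<bar> \<le> K * K * \<eta> ^ 4" .
      have "\<bar>z1 H \<bullet> z3 H\<bar> \<le> (K * \<eta>) * (K * \<eta> ^ 3)" by (rule abs_inner_le[OF n1 n3])
      also have "\<dots> = K * K * \<eta> ^ 4" by (simp add: power3_eq_cube power4_eq_xxxx)
      finally have r2: "\<bar>z1 H \<bullet> z3 H\<bar> \<le> K * K * \<eta> ^ 4" .
      have "\<bar>z2 H \<bullet> z3 H\<bar> \<le> (K * \<eta>\<^sup>2) * (K * \<eta> ^ 3)" by (rule abs_inner_le[OF n2 n3])
      also have "\<dots> = K * K * \<eta> ^ 5" by (simp add: power_add[symmetric])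
      also have "\<dots> \<le> K * K * \<eta> ^ 4" using pw K by (intro mult_left_mono) auto
      finally have r3: "\<bar>z2 H \<bullet> z3 H\<bar> \<le> K * K * \<eta> ^ 4" .
      have "\<bar>z3 H \<bullet> z3 H\<bar> \<le> (K * \<eta> ^ 3) * (K * \<eta> ^ 3)" by (rule abs_inner_le[OF n3 n3])
      also have "\<dots> = K * K * \<eta> ^ 6" by (simp add: power_add[symmetric])
      also have "\<dots> \<le> K * K * \<eta> ^ 4" using pw K by (intro mult_left_mono) auto
      finally have r4: "\<bar>z3 H \<bullet> z3 H\<bar> \<le> K * K * \<eta> ^ 4" .
      show ?thesis unfolding R_def using r1 r2 r3 r4 by linarith
    qed
    let ?cs = "map ?c L"
    have set_cs: "set ?cs = ?c ` ?S" by simp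
    have "?c k = (\<Sum>l\<in>?S. b l *\<^sub>R ?c l) + 1 *\<^sub>R z" by (simp add: z)
    moreover have "(\<Sum>l\<in>?S. b l *\<^sub>R ?c l) \<in> span (set ?cs)"
      unfolding set_cs by (intro span_sum span_scale span_base) auto
    ultimately have rz: "resid ?cs (?c k) = resid ?cs z"
      using resid_add_scale[of "\<Sum>l\<in>?S. b l *\<^sub>R ?c l" ?cs 1 z] by (simp only: scaleR_one)
    define p where "p = z - resid ?cs z"
    have pS: "p \<in> span (set ?cs)" unfolding p_def by (rule diff_resid_in_span)
    have rp: "resid ?cs z \<bullet> p = 0" by (rule resid_orthogonal_span[OF pS])
    have zrp: "z = resid ?cs z + p" by (simp add: p_def)
    have pr: "p \<bullet> resid ?cs z = 0" using rp by (simp add: inner_commute)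
    have "(resid ?cs z + p) \<bullet> (resid ?cs z + p) = resid ?cs z \<bullet> resid ?cs z + p \<bullet> p"
      by (simp add: inner_add_left inner_add_right rp pr)
    then have zsplit: "z \<bullet> z = resid ?cs z \<bullet> resid ?cs z + p \<bullet> p"
      by (simp only: zrp[symmetric])
    have "p \<bullet> (resid ?cs z + p) = p \<bullet> p" by (simp add: inner_add_right pr)
    then have pz: "p \<bullet> p = p \<bullet> z" by (simp only: zrp[symmetric])
    obtain y where y: "p = (\<Sum>l\<in>?S. y l *\<^sub>R ?c l)"
      using span_image_sum[of ?S p ?c] pS set_cs by auto
    \<comment> \<open>With \<open>Y\<close> the same combination of the coordinate vectors,
      \<open>Y\<close> and \<open>p\<close> differ by at most half of \<open>norm Y\<close>, because
      the columns are close to the coordinate vectors.\<close>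
    have yle: "\<bar>y m\<bar> \<le> 2 * norm p" if "m \<in> ?S" for m
    proof -
      define Y where "Y = (\<Sum>l\<in>?S. y l *\<^sub>R ?e l)"
      have yY: "\<bar>y l\<bar> \<le> norm Y" if "l \<in> ?S" for l
      proof -
        have "y l = Y \<bullet> ?e l"
          using that by (simp add: Y_def inner_sum_left ee if_distrib[of "(*) _"] cong: if_cong)
        then show ?thesis using Cauchy_Schwarz_ineq2[of Y "?e l"] by simp
      qed
      have "p = Y + (\<Sum>l\<in>?S. y l *\<^sub>R ?h l)"
        unfolding y c Y_def by (simp add: scaleR_add_right sum.distrib)
      then have "norm Y \<le> norm p + norm (\<Sum>l\<in>?S. y l *\<^sub>R ?h l)"
        using norm_triangle_ineq4[of p "\<Sum>l\<in>?S. y l *\<^sub>R ?h l"] by simp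
      also have "norm (\<Sum>l\<in>?S. y l *\<^sub>R ?h l) \<le> D * (norm Y * \<eta>)"
        unfolding D_def by (rule norm_sum_scaleR_le) (use yY h in auto)
      also have "D * (norm Y * \<eta>) \<le> 1 / 2 * norm Y"
        using mult_right_mono[OF \<eta>(3), of "norm Y"] by (simp add: algebra_simps)
      finally show ?thesis using yY[OF that] by linarith
    qed
    \<comment> \<open>The coefficient \<open>b m\<close> is of first order, but it cancels against
      the identity part of the Gram matrix; what remains is a product of two first-order
      quantities.\<close>
    have cz: "\<bar>?c m \<bullet> z\<bar> \<le> 9 * D * \<eta>\<^sup>2" if m: "m \<in> ?S" for m
    proof -
      have g: "\<bar>?c m \<bullet> ?c l - (if m = l then 1 else 0)\<bar> \<le> 3 * \<eta>" for l
      proof -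
        have "?c m \<bullet> ?c l - (if m = l then 1 else 0) = H $ m $ l + H $ l $ m + ?h m \<bullet> ?h l"
          by (simp add: c inner_add_left inner_add_right ee eh)
        moreover have "\<bar>?h m \<bullet> ?h l\<bar> \<le> \<eta>"
          using abs_inner_le[OF h h, of m l] pw(1) by (simp add: power2_eq_square)
        ultimately show ?thesis using ent[of m l] ent[of l m] by linarith
      qed
      have "?c m \<bullet> z = b m - (\<Sum>l\<in>?S. b l * (?c m \<bullet> ?c l))"
        using b[OF m] by (simp add: z inner_diff_right inner_sum_right)
      also have "b m = (\<Sum>l\<in>?S. b l * (if m = l then 1 else 0))"
        using m by (simp add: if_distrib[of "(*) _"] cong: if_cong)
      finally have "?c m \<bullet> z = - (\<Sum>l\<in>?S. b l * (?c m \<bullet> ?c l - (if m = l then 1 else 0)))"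
        by (simp only: right_diff_distrib sum_subtractf minus_diff_eq)
      then have "\<bar>?c m \<bullet> z\<bar> = \<bar>\<Sum>l\<in>?S. b l * (?c m \<bullet> ?c l - (if m = l then 1 else 0))\<bar>" by simp
      also have "\<dots> \<le> (\<Sum>l\<in>?S. (3 * \<eta>) * (3 * \<eta>))"
        by (rule order_trans[OF sum_abs sum_mono]) (unfold abs_mult, intro mult_mono b3 g, use \<eta> in auto)
      also have "\<dots> = 9 * D * \<eta>\<^sup>2" by (simp add: D_def power2_eq_square)
      finally show ?thesis .
    qed
    \<comment> \<open>Since \<open>p \<bullet> p = p \<bullet> z\<close>, one factor
      \<open>norm p\<close> can be divided out, so that \<open>p\<close> itself is of second order;
      324 is the square of 18.\<close>
    have pp: "p \<bullet> p \<le> 324 * D ^ 4 * \<eta> ^ 4"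
    proof -
      have "p \<bullet> z = (\<Sum>l\<in>?S. y l * (?c l \<bullet> z))" by (subst y) (simp add: inner_sum_left)
      also have "\<dots> \<le> (\<Sum>l\<in>?S. (2 * norm p) * (9 * D * \<eta>\<^sup>2))"
      proof (rule sum_mono)
        fix l assume "l \<in> ?S"
        then have "\<bar>y l\<bar> * \<bar>?c l \<bullet> z\<bar> \<le> (2 * norm p) * (9 * D * \<eta>\<^sup>2)"
          by (intro mult_mono yle cz) auto
        then show "y l * (?c l \<bullet> z) \<le> (2 * norm p) * (9 * D * \<eta>\<^sup>2)"
          using abs_ge_self[of "y l * (?c l \<bullet> z)"] unfolding abs_mult by linarith
      qed
      also have "\<dots> = norm p * (18 * D\<^sup>2 * \<eta>\<^sup>2)" by (simp add: D_def power2_eq_square)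
      finally have "norm p * norm p \<le> norm p * (18 * D\<^sup>2 * \<eta>\<^sup>2)"
        using pz by (simp add: dot_square_norm power2_eq_square)
      then have "norm p \<le> 18 * D\<^sup>2 * \<eta>\<^sup>2"
        by (cases "p = 0") (auto simp: mult_le_cancel_left)
      then have "(norm p)\<^sup>2 \<le> (18 * D\<^sup>2 * \<eta>\<^sup>2)\<^sup>2" by (intro power_mono) auto
      also have "\<dots> = 324 * D ^ 4 * \<eta> ^ 4" by (simp add: power_mult_distrib flip: power_mult)
      finally show ?thesis by (simp add: dot_square_norm)
    qed
    have "(colres L k (mat 1 + H))\<^sup>2 = z \<bullet> z - p \<bullet> p"
      using zsplit by (simp add: colres_def rz power2_norm_eq_inner)
    then have "(colres L k (mat 1 + H))\<^sup>2 - (1 + 2 * H $ k $ k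
        + ((norm (column k H))\<^sup>2 - (\<Sum>l\<in>?S. (H $ k $ l + H $ l $ k)\<^sup>2)) + p3 H) = R - p \<bullet> p"
      unfolding zz \<beta>_def by simp
    moreover have "\<bar>R - p \<bullet> p\<bar> \<le> (6 * (K * K) + 324 * D ^ 4) * \<eta> ^ 4"
      using BR pp inner_ge_zero[of p] unfolding distrib_right by linarith
    moreover have "\<dots> \<le> C * \<eta> ^ 4" using C \<eta> by (intro mult_right_mono) auto
    ultimately show ?thesis using B3 by (simp add: \<eta>_def)
  qed
  show thesis using that[of C \<delta> p3, OF C(1) \<delta> odd] main by blast
qed

text \<open>The logarithms are added as the logarithm of a product. In the product the odd parts
  form a difference of squares, so no term of degree 1 or 3 is left and
  \<open>1 + (2 * b - a\<^sup>2)\<close> is exact up to degree 4.\<close>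

lemma ln_symmetric_product_bound:
  fixes a b c R R' C \<eta> :: real
  assumes \<eta>: "0 \<le> \<eta>" and C: "1 \<le> C" "C * \<eta> \<le> 1 / 8"
    and a: "\<bar>a\<bar> \<le> C * \<eta>" and b: "\<bar>b\<bar> \<le> C * \<eta>\<^sup>2" and c: "\<bar>c\<bar> \<le> C * \<eta> ^ 3"
    and R: "\<bar>R\<bar> \<le> C * \<eta> ^ 4" and R': "\<bar>R'\<bar> \<le> C * \<eta> ^ 4"
  shows "0 < 1 + a + b + c + R" "0 < 1 - a + b - c + R'"
    and "\<bar>ln (1 + a + b + c + R) + ln (1 - a + b - c + R') - (2 * b - a\<^sup>2)\<bar> \<le> 525 * C ^ 4 * \<eta> ^ 4"
proof -
  have \<eta>1: "\<eta> \<le> 1" using mult_right_mono[OF C(1) \<eta>] C(2) by simp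
  define u where "u = C * \<eta>"
  have u: "0 \<le> u" "u \<le> 1 / 8" using \<eta> C by (auto simp: u_def)
  have pw: "C * \<eta> ^ m \<le> u" if "1 \<le> m" for m
    using power_decreasing[OF that \<eta> \<eta>1] C by (simp add: u_def)
  have small: "\<bar>b\<bar> \<le> u" "\<bar>c\<bar> \<le> u" "\<bar>R\<bar> \<le> u" "\<bar>R'\<bar> \<le> u" "\<bar>a\<bar> \<le> u"
    using a b c R R' pw[of 2] pw[of 3] pw[of 4] by (simp_all add: u_def)
  show pos: "0 < 1 + a + b + c + R" "0 < 1 - a + b - c + R'"
    using small u by linarith+
  define T where "T = C\<^sup>2 * \<eta> ^ 4"
  have CT: "C * \<eta> ^ 4 \<le> T"
    using C by (simp add: T_def power2_eq_square mult_right_mono)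
  have prod: "\<bar>x * y\<bar> \<le> T" if "\<bar>x\<bar> \<le> C * \<eta> ^ i" "\<bar>y\<bar> \<le> C * \<eta> ^ j" "4 \<le> i + j" for x y i j
  proof -
    have "\<bar>x * y\<bar> \<le> (C * \<eta> ^ i) * (C * \<eta> ^ j)"
      unfolding abs_mult using that \<eta> C by (intro mult_mono) auto
    also have "\<dots> = C\<^sup>2 * \<eta> ^ (i + j)" by (simp add: power2_eq_square power_add)
    also have "\<dots> \<le> T"
      unfolding T_def using power_decreasing[OF that(3) \<eta> \<eta>1] by (intro mult_left_mono) auto
    finally show ?thesis .
  qed
  \<comment> \<open>All terms of degree at least 4 in the product. Counted with multiplicity there
    are 13 of them, each at most \<open>T\<close>.\<close>
  define E where "E = b * b - 2 * (a * c) - c * c + ((R + R') + b * R + b * R') + (a * R' - a * R + c * R' - c * R) + R * R'"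
  have a': "\<bar>a\<bar> \<le> C * \<eta> ^ 1" using a by simp
  have E: "\<bar>E\<bar> \<le> 13 * T"
  proof -
    have "\<bar>b * b\<bar> \<le> T" by (rule prod[OF b b]) simp
    moreover have "\<bar>a * c\<bar> \<le> T" by (rule prod[OF a' c]) simp
    moreover have "\<bar>c * c\<bar> \<le> T" by (rule prod[OF c c]) simp
    moreover have "\<bar>b * R\<bar> \<le> T" by (rule prod[OF b R]) simp
    moreover have "\<bar>b * R'\<bar> \<le> T" by (rule prod[OF b R']) simp
    moreover have "\<bar>a * R'\<bar> \<le> T" by (rule prod[OF a' R']) simp
    moreover have "\<bar>a * R\<bar> \<le> T" by (rule prod[OF a' R]) simp
    moreover have "\<bar>c * R'\<bar> \<le> T" by (rule prod[OF c R']) simp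
    moreover have "\<bar>c * R\<bar> \<le> T" by (rule prod[OF c R]) simp
    moreover have "\<bar>R * R'\<bar> \<le> T" by (rule prod[OF R R']) simp
    moreover have "\<bar>R\<bar> \<le> T" "\<bar>R'\<bar> \<le> T" using R R' CT by linarith+
    ultimately show ?thesis unfolding E_def abs_le_iff by (intro conjI; linarith)
  qed
  define w where "w = 2 * b - a\<^sup>2 + E"
  have DD: "(1 + a + b + c + R) * (1 - a + b - c + R') = 1 + w"
    unfolding w_def E_def by (simp add: power2_eq_square algebra_simps)
  define V where "V = C\<^sup>2 * \<eta>\<^sup>2"
  have V: "0 \<le> V" "V \<le> 1 / 64"
  proof -
    have "V = u * u" by (simp add: V_def u_def power2_eq_square)
    then show "0 \<le> V" "V \<le> 1 / 64" using mult_mono[OF u(2) u(2)] u by auto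
  qed
  have w: "\<bar>w\<bar> \<le> 16 * V"
  proof -
    have "\<bar>b\<bar> \<le> V"
    proof -
      have "C * \<eta>\<^sup>2 \<le> V" using C by (simp add: V_def power2_eq_square mult_right_mono)
      then show ?thesis using b by linarith
    qed
    moreover have "a\<^sup>2 \<le> V"
      using power_mono[OF a, of 2] by (simp add: V_def power_mult_distrib)
    moreover have "T \<le> V"
      unfolding T_def V_def using power_decreasing[of 2 4 \<eta>] \<eta> \<eta>1 by (intro mult_left_mono) auto
    ultimately show ?thesis unfolding w_def using E by (smt (verit) zero_le_power2)
  qed
  \<comment> \<open>The bound \<open>16 * V\<close> counts 2 for \<open>2 * b\<close>, 1 for
    \<open>a\<^sup>2\<close> and 13 for \<open>E\<close>, and is at most 1/4. Twice its square gives
    512, and adding the 13 of \<open>E\<close> gives the final 525.\<close>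
  have "\<bar>ln (1 + w) - w\<bar> \<le> 2 * w\<^sup>2"
    using w V by (intro abs_ln_one_plus_x_minus_x_bound) linarith
  also have "w\<^sup>2 \<le> (16 * V)\<^sup>2" using power_mono[OF w, of 2] by simp
  also have "(16 * V)\<^sup>2 = 256 * (C ^ 4 * \<eta> ^ 4)"
    by (simp add: V_def power_mult_distrib flip: power_mult)
  finally have l: "\<bar>ln (1 + w) - w\<bar> \<le> 512 * (C ^ 4 * \<eta> ^ 4)" by simp
  have "T \<le> C ^ 4 * \<eta> ^ 4"
    unfolding T_def using C power_increasing[of 2 4 C] by (intro mult_right_mono) auto
  then have "\<bar>ln (1 + w) - (2 * b - a\<^sup>2)\<bar> \<le> 525 * (C ^ 4 * \<eta> ^ 4)"
    using l E unfolding w_def by linarith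
  moreover have "ln (1 + a + b + c + R) + ln (1 - a + b - c + R') = ln (1 + w)"
    using pos by (simp add: ln_mult_pos[symmetric] DD)
  ultimately show "\<bar>ln (1 + a + b + c + R) + ln (1 - a + b - c + R') - (2 * b - a\<^sup>2)\<bar> \<le> 525 * C ^ 4 * \<eta> ^ 4"
    by (simp add: mult.assoc)
qed

text \<open>Twice the quadratic Taylor part at the identity of the logarithm of the residual. The
  last term is the contribution \<open>- a\<^sup>2 / 2\<close> of the linear part
  \<open>a = 2 * H $ k $ k\<close> of the squared residual.\<close>

definition quad_form :: "'n list \<Rightarrow> 'n \<Rightarrow> real^'n^'n \<Rightarrow> real" where
  "quad_form L k H = (norm (column k H))\<^sup>2 - (\<Sum>l\<in>set L. (H $ k $ l + H $ l $ k)\<^sup>2) - 2 * (H $ k $ k)\<^sup>2"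

lemma ln_colres_symmetric_expansion:
  fixes L :: "'n::finite list"
  assumes L: "distinct L" "k \<notin> set L"
  obtains K \<delta> :: real where "0 < K" "0 < \<delta>" "\<delta> \<le> 1"
    and "\<And>H. norm H \<le> \<delta> \<Longrightarrow>
      \<bar>ln (colres L k (mat 1 + H)) + ln (colres L k (mat 1 - H)) - quad_form L k H\<bar> \<le> K * norm H ^ 4"
proof -
  obtain C0 \<delta>0 and p3 :: "real^'n^'n \<Rightarrow> real" where C0: "0 < C0" and \<delta>0: "0 < \<delta>0" "\<delta>0 \<le> 1"
    and odd: "\<And>H. p3 (- H) = - p3 H"
    and p3: "\<And>H. norm H \<le> \<delta>0 \<Longrightarrow> \<bar>p3 H\<bar> \<le> C0 * norm H ^ 3"
    and ex: "\<And>H. norm H \<le> \<delta>0 \<Longrightarrow>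
      \<bar>(colres L k (mat 1 + H))\<^sup>2 - (1 + 2 * H $ k $ k
        + ((norm (column k H))\<^sup>2 - (\<Sum>l\<in>set L. (H $ k $ l + H $ l $ k)\<^sup>2)) + p3 H)\<bar> \<le> C0 * norm H ^ 4"
    by (rule colres_square_expansion[OF L], rule that)
  define D where "D = real (card (set L))"
  define C where "C = C0 + 2 + (1 + 4 * D)"
  have D: "0 \<le> D" by (simp add: D_def)
  have C: "1 \<le> C" "C0 \<le> C" "2 \<le> C" "1 + 4 * D \<le> C" using C0 D by (auto simp: C_def)
  define \<delta> where "\<delta> = min \<delta>0 (1 / (8 * C))"
  have \<delta>: "0 < \<delta>" "\<delta> \<le> 1" "\<delta> \<le> \<delta>0" "\<delta> \<le> 1 / (8 * C)" using \<delta>0 C by (auto simp: \<delta>_def)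
  \<comment> \<open>The product bound concerns squared residuals, so its constant 525 is halved, and
    263 exceeds that half.\<close>
  have main: "\<bar>ln (colres L k (mat 1 + H)) + ln (colres L k (mat 1 - H)) - quad_form L k H\<bar>
      \<le> 263 * C ^ 4 * norm H ^ 4" if H: "norm H \<le> \<delta>" for H
  proof -
    let ?\<eta> = "norm H"
    define a where "a = 2 * H $ k $ k"
    define b where "b = (norm (column k H))\<^sup>2 - (\<Sum>l\<in>set L. (H $ k $ l + H $ l $ k)\<^sup>2)"
    define R where "R = (colres L k (mat 1 + H))\<^sup>2 - (1 + a + b + p3 H)"
    define R' where "R' = (colres L k (mat 1 - H))\<^sup>2 - (1 - a + b - p3 H)"
    have mono: "C0 * ?\<eta> ^ m \<le> C * ?\<eta> ^ m" for m using C by (intro mult_right_mono) auto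
    have "?\<eta> \<le> 1 / (8 * C)" using H \<delta> by linarith
    then have C\<eta>: "C * ?\<eta> \<le> 1 / 8" using C by (simp add: field_simps)
    have ba: "\<bar>a\<bar> \<le> C * ?\<eta>"
    proof -
      have "\<bar>a\<bar> \<le> 2 * ?\<eta>" using abs_entry_le[of H k k] by (simp add: a_def abs_mult)
      also have "\<dots> \<le> C * ?\<eta>" using C by (intro mult_right_mono) auto
      finally show ?thesis .
    qed
    have bb: "\<bar>b\<bar> \<le> C * ?\<eta>\<^sup>2"
    proof -
      have "(H $ k $ l + H $ l $ k)\<^sup>2 \<le> (2 * ?\<eta>)\<^sup>2" for l
      proof -
        have "\<bar>H $ k $ l + H $ l $ k\<bar> \<le> 2 * ?\<eta>"
          using abs_entry_le[of H k l] abs_entry_le[of H l k] by linarith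
        from power_mono[OF this abs_ge_zero, of 2] show ?thesis by simp
      qed
      then have "(\<Sum>l\<in>set L. (H $ k $ l + H $ l $ k)\<^sup>2) \<le> (\<Sum>l\<in>set L. (2 * ?\<eta>)\<^sup>2)"
        by (intro sum_mono)
      also have "\<dots> = 4 * D * ?\<eta>\<^sup>2" by (simp add: D_def power_mult_distrib)
      finally have s: "(\<Sum>l\<in>set L. (H $ k $ l + H $ l $ k)\<^sup>2) \<le> 4 * D * ?\<eta>\<^sup>2" .
      have n: "(norm (column k H))\<^sup>2 \<le> ?\<eta>\<^sup>2" using norm_column_le[of k H] by (intro power_mono) auto
      have "0 \<le> (\<Sum>l\<in>set L. (H $ k $ l + H $ l $ k)\<^sup>2)" by (intro sum_nonneg) auto
      then have "\<bar>b\<bar> \<le> (1 + 4 * D) * ?\<eta>\<^sup>2"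
        unfolding b_def distrib_right using s n zero_le_power2[of "norm (column k H)"] by linarith
      also have "\<dots> \<le> C * ?\<eta>\<^sup>2" using C by (intro mult_right_mono) auto
      finally show ?thesis .
    qed
    have bc: "\<bar>p3 H\<bar> \<le> C * ?\<eta> ^ 3" using p3[of H] mono[of 3] H \<delta> by linarith
    have bR: "\<bar>R\<bar> \<le> C * ?\<eta> ^ 4"
      using ex[of H] mono[of 4] H \<delta> unfolding R_def a_def b_def by linarith
    have cneg: "column k (- H) = - column k H" by (simp add: column_def vec_eq_iff)
    have "\<bar>R'\<bar> \<le> C0 * ?\<eta> ^ 4"
    proof -
      have "(\<Sum>l\<in>set L. ((- H) $ k $ l + (- H) $ l $ k)\<^sup>2) = (\<Sum>l\<in>set L. (H $ k $ l + H $ l $ k)\<^sup>2)"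
        by (intro sum.cong refl) (simp add: power2_eq_square algebra_simps)
      then show ?thesis
        using ex[of "- H"] H \<delta> by (simp add: R'_def a_def b_def odd cneg)
    qed
    then have bR': "\<bar>R'\<bar> \<le> C * ?\<eta> ^ 4" using mono[of 4] by linarith
    note bound = ln_symmetric_product_bound[OF norm_ge_zero C(1) C\<eta> ba bb bc bR bR']
    have eq: "1 + a + b + p3 H + R = (colres L k (mat 1 + H))\<^sup>2"
      "1 - a + b - p3 H + R' = (colres L k (mat 1 - H))\<^sup>2"
      by (simp_all add: R_def R'_def)
    have nn: "0 \<le> colres L k X" for X :: "real^'n^'n" by (simp add: colres_def)
    have "0 < colres L k (mat 1 + H)" "0 < colres L k (mat 1 - H)"
      using bound(1,2) nn[of "mat 1 + H"] nn[of "mat 1 - H"] unfolding eq by (auto simp: less_le)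
    then have "ln ((colres L k (mat 1 + H))\<^sup>2) = 2 * ln (colres L k (mat 1 + H))"
      "ln ((colres L k (mat 1 - H))\<^sup>2) = 2 * ln (colres L k (mat 1 - H))"
      by (simp_all add: ln_realpow)
    moreover have "2 * b - a\<^sup>2 = 2 * quad_form L k H"
      by (simp add: a_def b_def quad_form_def power_mult_distrib)
    ultimately have "\<bar>2 * ln (colres L k (mat 1 + H)) + 2 * ln (colres L k (mat 1 - H)) - 2 * quad_form L k H\<bar>
        \<le> 525 * C ^ 4 * ?\<eta> ^ 4"
      using bound(3) unfolding eq by simp
    moreover have "0 \<le> C ^ 4 * ?\<eta> ^ 4" using C by simp
    ultimately show ?thesis by (simp add: mult.assoc)
  qed
  show thesis
    by (rule that[of "263 * C ^ 4" \<delta>]) (use C \<delta> main in auto)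
qed

section \<open>Gaussian moments and a small-ball estimate\<close>

text \<open>The power -1/2 is integrable at 0 against Lebesgue measure, while -1 is not. The values
  are extended reals with \<open>inv_sqrt 0 = \<top>\<close>, so that a finite integral also shows
  that the argument is almost surely nonzero.\<close>

definition inv_sqrt :: "real \<Rightarrow> ennreal" where "inv_sqrt x = inverse (ennreal (sqrt \<bar>x\<bar>))"

lemma inv_sqrt_measurable [measurable]: "inv_sqrt \<in> borel_measurable borel"
  unfolding inv_sqrt_def by measurable

lemma inv_sqrt_mult: "0 < b \<Longrightarrow> inv_sqrt (b * x) = ennreal (1 / sqrt b) * inv_sqrt x"
  by (cases "x = 0")
    (simp_all add: inv_sqrt_def abs_mult real_sqrt_mult inverse_ennreal ennreal_mult'[symmetric]
      divide_inverse ennreal_mult_top)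

lemma inv_sqrt_uminus: "inv_sqrt (- x) = inv_sqrt x"
  by (simp add: inv_sqrt_def)

lemma inv_sqrt_pos: "x \<noteq> 0 \<Longrightarrow> inv_sqrt x = ennreal (1 / sqrt \<bar>x\<bar>)"
  by (simp add: inv_sqrt_def inverse_ennreal divide_inverse)

lemma inv_sqrt_zero: "inv_sqrt 0 = \<top>"
  by (simp add: inv_sqrt_def)

lemma inv_sqrt_antimono:
  assumes "\<bar>x\<bar> \<le> \<bar>y\<bar>"
  shows "inv_sqrt y \<le> inv_sqrt x"
proof (cases "x = 0")
  case False
  with assms have "y \<noteq> 0" by auto
  then show ?thesis
    using assms False by (simp add: inv_sqrt_pos ennreal_leI frac_le)
qed (simp add: inv_sqrt_zero)

lemma nn_integral_inv_sqrt_unit: "(\<integral>\<^sup>+u. inv_sqrt u * indicator {0..1} u \<partial>lborel) = 2"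
proof -
  have "((\<lambda>x. x powr (- 1 / 2)) has_integral (1 powr (- 1 / 2 + 1) / (- 1 / 2 + 1))) {0..1 :: real}"
    by (rule has_integral_powr_from_0) auto
  then have hi: "((\<lambda>x. x powr (- 1 / 2)) has_integral 2) {0..1 :: real}" by simp
  have "(\<integral>\<^sup>+u. inv_sqrt u * indicator {0..1} u \<partial>lborel)
      = (\<integral>\<^sup>+u. ennreal (indicator {0..1} u * u powr (- 1 / 2)) \<partial>lborel)"
  proof (rule nn_integral_cong_AE)
    have "AE u in lborel. u \<noteq> (0 :: real)" by (rule AE_lborel_singleton)
    then show "AE u in lborel. inv_sqrt u * indicator {0..1} u = ennreal (indicator {0..1} u * u powr (- 1 / 2))"
    proof eventually_elim
      case (elim u)
      then show ?case
        by (cases "u \<in> {0..1}") (auto simp: inv_sqrt_pos powr_minus_divide powr_half_sqrt)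
    qed
  qed
  also have "\<dots> = ennreal 2"
    by (rule nn_integral_has_integral_lebesgue[OF _ hi]) auto
  finally show ?thesis by simp
qed

text \<open>Uniform in the shift \<open>a\<close>, which will depend on all other entries. For
  \<open>b = 1\<close> the constant 5 is 4 from the unit interval around the singularity, where the
  density is at most 1, plus 1 from outside, where \<open>inv_sqrt\<close> is at most 1; scaling
  supplies \<open>1 / sqrt \<bar>b\<bar>\<close>.\<close>

lemma nn_integral_inv_sqrt_std_normal:
  assumes b: "b \<noteq> 0"
  shows "(\<integral>\<^sup>+y. inv_sqrt (a + b * y) \<partial>std_normal) \<le> ennreal (5 / sqrt \<bar>b\<bar>)"
proof -
  have loc: "(\<integral>\<^sup>+u. inv_sqrt u * indicator {-1..1} u \<partial>lborel) \<le> 4"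
  proof -
    have "(\<integral>\<^sup>+u. inv_sqrt u * indicator {-1..1} u \<partial>lborel)
        \<le> (\<integral>\<^sup>+u. inv_sqrt u * indicator {0..1} u + inv_sqrt (- u) * indicator {0..1} (- u) \<partial>lborel)"
      by (intro nn_integral_mono) (auto simp: inv_sqrt_uminus indicator_def)
    also have "\<dots> = (\<integral>\<^sup>+u. inv_sqrt u * indicator {0..1} u \<partial>lborel)
        + (\<integral>\<^sup>+u. inv_sqrt (- u) * indicator {0..1} (- u) \<partial>lborel)"
      by (intro nn_integral_add) measurable
    also have "(\<integral>\<^sup>+u. inv_sqrt (- u) * indicator {0..1} (- u) \<partial>lborel)
        = (\<integral>\<^sup>+u. inv_sqrt u * indicator {0..1} u \<partial>lborel)"
      by (subst (2) lborel_distr_uminus[symmetric]) (simp add: nn_integral_distr)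
    finally show ?thesis by (simp add: nn_integral_inv_sqrt_unit)
  qed
  have unit: "(\<integral>\<^sup>+y. inv_sqrt (c + y) \<partial>std_normal) \<le> 5" for c
  proof -
    have phi: "std_normal_density y \<le> 1" for y
    proof -
      have "1 \<le> sqrt (2 * pi)" using pi_gt3 by simp
      moreover have "exp (- y\<^sup>2 / 2) \<le> 1" by simp
      ultimately show ?thesis
        unfolding std_normal_density_def
        by (metis divide_le_eq_1_pos less_le_trans mult_le_one zero_less_one divide_nonneg_nonneg order_less_imp_le exp_ge_zero)
    qed
    have "(\<integral>\<^sup>+y. inv_sqrt (c + y) \<partial>std_normal) = (\<integral>\<^sup>+y. ennreal (std_normal_density y) * inv_sqrt (c + y) \<partial>lborel)"
      by (simp add: std_normal_def nn_integral_density)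
    also have "\<dots> \<le> (\<integral>\<^sup>+y. ennreal (std_normal_density y) + inv_sqrt (c + y) * indicator {-1..1} (c + y) \<partial>lborel)"
    proof (rule nn_integral_mono)
      fix y :: real
      show "ennreal (std_normal_density y) * inv_sqrt (c + y)
          \<le> ennreal (std_normal_density y) + inv_sqrt (c + y) * indicator {-1..1} (c + y)"
      proof (cases "c + y \<in> {-1..1}")
        case True
        have "ennreal (std_normal_density y) * inv_sqrt (c + y) \<le> 1 * inv_sqrt (c + y)"
          using phi[of y] by (intro mult_right_mono) auto
        then show ?thesis using True by (simp add: add_increasing)
      next
        case False
        then have "inv_sqrt (c + y) \<le> inv_sqrt 1" by (intro inv_sqrt_antimono) auto
        then have "ennreal (std_normal_density y) * inv_sqrt (c + y) \<le> ennreal (std_normal_density y) * 1"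
          by (intro mult_left_mono) (auto simp: inv_sqrt_def)
        then show ?thesis using False by simp
      qed
    qed
    also have "\<dots> = (\<integral>\<^sup>+y. ennreal (std_normal_density y) \<partial>lborel)
        + (\<integral>\<^sup>+y. inv_sqrt (c + y) * indicator {-1..1} (c + y) \<partial>lborel)"
      by (intro nn_integral_add) measurable
    also have "(\<integral>\<^sup>+y. inv_sqrt (c + y) * indicator {-1..1} (c + y) \<partial>lborel)
        = (\<integral>\<^sup>+u. inv_sqrt u * indicator {-1..1} u \<partial>lborel)"
      by (rule nn_integral_lborel_translate) measurable
    also have "(\<integral>\<^sup>+y. ennreal (std_normal_density y) \<partial>lborel) = 1"
      using prob_space.emeasure_space_1[OF prob_space_std_normal]
      by (simp add: std_normal_def emeasure_density)
    finally show ?thesis using add_left_mono[OF loc, of 1] by (simp add: order_trans)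
  qed
  have pos: "(\<integral>\<^sup>+y. inv_sqrt (a + b * y) \<partial>std_normal) \<le> ennreal (5 / sqrt b)" if "0 < b" for a b
  proof -
    have "inv_sqrt (a + b * y) = ennreal (1 / sqrt b) * inv_sqrt (a / b + y)" for y
      using inv_sqrt_mult[OF that, of "a / b + y"] that by (simp add: distrib_left)
    then have "(\<integral>\<^sup>+y. inv_sqrt (a + b * y) \<partial>std_normal) = ennreal (1 / sqrt b) * (\<integral>\<^sup>+y. inv_sqrt (a / b + y) \<partial>std_normal)"
      by (simp add: nn_integral_cmult)
    also have "\<dots> \<le> ennreal (1 / sqrt b) * 5" by (intro mult_left_mono unit) simp
    also have "\<dots> = ennreal (5 / sqrt b)"
      using ennreal_mult'[of "1 / sqrt b" 5] that by (simp add: ennreal_mult'')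
    finally show ?thesis .
  qed
  show ?thesis
  proof (cases "0 < b")
    case True
    then show ?thesis using pos[of b a] by simp
  next
    case False
    have "inv_sqrt (a + b * y) = inv_sqrt (- a + (- b) * y)" for y
      using inv_sqrt_uminus[of "a + b * y"] by simp
    then show ?thesis using pos[of "- b" "- a"] False b by simp
  qed
qed

text \<open>All columns except \<open>k\<close> are frozen. A unit normal \<open>n\<close> to the
  columns in \<open>L\<close> is then fixed, the residual is at least the absolute value of
  \<open>n\<close> paired with column \<open>k\<close>, and that pairing is affine in the entries of
  column \<open>k\<close>. Integrating over a single entry with a large coefficient is
  enough.\<close>

lemma nn_integral_inv_sqrt_colres:
  fixes L :: "'n::finite list"
  assumes L: "distinct L" "k \<notin> set L" and e: "0 < e"
  shows "(\<integral>\<^sup>+G. inv_sqrt (colres L k (mat 1 + e *\<^sub>R G)) \<partial>std_normal_matrix)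
    \<le> ennreal (5 * sqrt (real CARD('n)) / sqrt e)"
proof -
  interpret N: prob_space std_normal by (rule prob_space_std_normal)
  interpret product_sigma_finite "\<lambda>_ :: 'n \<times> 'n. std_normal"
    by (intro product_sigma_finite.intro prob_space_imp_sigma_finite prob_space_std_normal)
  let ?I = "{p :: 'n \<times> 'n. snd p \<noteq> k}" and ?J = "{p :: 'n \<times> 'n. snd p = k}"
  let ?P = "\<lambda>I. \<Pi>\<^sub>M p\<in>I. std_normal" and ?bd = "ennreal (5 * sqrt (real CARD('n)) / sqrt e)"
  have prob: "prob_space (?P I)" for I :: "('n \<times> 'n) set"
    by (intro prob_space_PiM prob_space_std_normal)
  let ?f = "\<lambda>x. inv_sqrt (colres L k (mat 1 + e *\<^sub>R matrix_of x))"
  have IJ: "?I \<union> ?J = UNIV" "?I \<inter> ?J = {}" by auto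
  have meas: "?f \<in> borel_measurable (?P UNIV)"
    using measurable_matrix_of[where 'n = 'n] unfolding entries_law_def by measurable
  have inner: "(\<integral>\<^sup>+y. ?f (merge ?I ?J (x, y)) \<partial>?P ?J) \<le> ?bd" for x
  proof -
    define V where "V l = axis l 1 + e *\<^sub>R column l (matrix_of x)" for l
    have col: "column l (mat 1 + e *\<^sub>R matrix_of (merge ?I ?J (x, y))) = V l" if "l \<noteq> k" for l y
      using that by (simp add: V_def column_def matrix_of_def merge_def mat_def axis_def vec_eq_iff)
    have "dim (V ` set L) \<le> card (set L)"
      using dim_le_card'[of "V ` set L"] card_image_le[of "set L" V] by simp
    also have "card (set L) < DIM(real^'n)"
    proof -
      have "card (set L) < CARD('n)" using L(2) by (intro psubset_card_mono) auto
      then show ?thesis by simp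
    qed
    finally obtain w where w: "w \<noteq> 0" "\<And>y. y \<in> span (V ` set L) \<Longrightarrow> orthogonal w y"
      using orthogonal_to_subspace_exists by metis
    define n where "n = sgn w"
    have n: "norm n = 1" "\<And>l. l \<in> set L \<Longrightarrow> n \<bullet> V l = 0"
      using w by (auto simp: n_def norm_sgn sgn_div_norm orthogonal_def intro: span_base)
    \<comment> \<open>The absolute coordinates of a unit vector sum to at least 1, so one of them is
      at least the average.\<close>
    obtain m where m: "1 / real CARD('n) \<le> \<bar>n $ m\<bar>"
    proof (rule ccontr)
      assume "\<not> thesis"
      then have "(\<Sum>m\<in>UNIV. \<bar>n $ m\<bar>) < (\<Sum>m\<in>(UNIV :: 'n set). 1 / real CARD('n))"
        using that by (intro sum_strict_mono) (auto simp: not_le[symmetric])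
      then show False using norm_le_l1_cart[of n] n(1) by simp
    qed
    let ?g = "\<lambda>y :: 'n \<times> 'n \<Rightarrow> real. n $ k + e * (\<Sum>i\<in>UNIV. n $ i * y (i, k))"
    have le: "?f (merge ?I ?J (x, y)) \<le> inv_sqrt (?g y)" for y
    proof (rule inv_sqrt_antimono)
      let ?C = "mat 1 + e *\<^sub>R matrix_of (merge ?I ?J (x, y))"
      have "column k ?C = axis k 1 + e *\<^sub>R (\<chi> i. y (i, k))"
        by (simp add: column_def matrix_of_def merge_def mat_def axis_def vec_eq_iff)
      then have "n \<bullet> column k ?C = ?g y"
        by (simp add: inner_add_right inner_axis) (simp add: inner_vec_def)
      moreover have "n \<bullet> b = 0" if "b \<in> set (map (\<lambda>l. column l ?C) L)" for b
      proof -
        obtain l where l: "l \<in> set L" "b = column l ?C" using \<open>b \<in> _\<close> by auto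
        then have "b = V l" using col[of l y] L(2) by auto
        then show ?thesis using n(2)[OF l(1)] by simp
      qed
      ultimately show "\<bar>?g y\<bar> \<le> \<bar>colres L k ?C\<bar>"
        using inner_le_norm_resid[OF n(1), of "map (\<lambda>l. column l ?C) L" "column k ?C"]
        by (simp add: colres_def)
    qed
    let ?J' = "?J - {(m, k)}"
    have J: "?J = insert (m, k) ?J'" by auto
    have gm: "(\<lambda>y. inv_sqrt (?g y)) \<in> borel_measurable (?P ?J)"
    proof -
      have "(\<lambda>y. y (i, k)) \<in> borel_measurable (?P ?J)" for i
        using measurable_component_singleton[of "(i, k)" ?J "\<lambda>_. std_normal"] by simp
      then show ?thesis by measurable
    qed
    have "(\<integral>\<^sup>+y. ?f (merge ?I ?J (x, y)) \<partial>?P ?J) \<le> (\<integral>\<^sup>+y. inv_sqrt (?g y) \<partial>?P ?J)"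
      by (intro nn_integral_mono le)
    \<comment> \<open>The entry at position \<open>m\<close> of column \<open>k\<close> is
      integrated innermost; the remaining entries enter only through the shift, to which the
      one-dimensional bound is insensitive.\<close>
    also have "\<dots> = (\<integral>\<^sup>+y. (\<integral>\<^sup>+t. inv_sqrt (?g (y((m, k) := t))) \<partial>std_normal) \<partial>?P ?J')"
      using gm by (subst (asm) (1) J, subst (1) J) (rule product_nn_integral_insert, auto)
    also have "\<dots> \<le> (\<integral>\<^sup>+y. ?bd \<partial>?P ?J')"
    proof (rule nn_integral_mono)
      fix y :: "'n \<times> 'n \<Rightarrow> real"
      have g: "?g (y((m, k) := t)) = (n $ k + e * (\<Sum>i\<in>UNIV - {m}. n $ i * y (i, k))) + (e * n $ m) * t" for t
      proof -
        have "(\<Sum>i\<in>UNIV. n $ i * (y((m, k) := t)) (i, k))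
            = n $ m * t + (\<Sum>i\<in>UNIV - {m}. n $ i * (y((m, k) := t)) (i, k))"
          by (subst sum.remove[of UNIV m]) auto
        also have "(\<Sum>i\<in>UNIV - {m}. n $ i * (y((m, k) := t)) (i, k)) = (\<Sum>i\<in>UNIV - {m}. n $ i * y (i, k))"
          by (intro sum.cong) auto
        finally show ?thesis by (simp add: algebra_simps)
      qed
      have pos: "0 < 1 / real CARD('n)" by simp
      then have nm: "0 < \<bar>n $ m\<bar>" using m by linarith
      have "(\<integral>\<^sup>+t. inv_sqrt (?g (y((m, k) := t))) \<partial>std_normal) \<le> ennreal (5 / sqrt \<bar>e * n $ m\<bar>)"
        unfolding g using e nm by (intro nn_integral_inv_sqrt_std_normal) auto
      also have "\<dots> \<le> ?bd"
      proof (rule ennreal_leI)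
        have "e / real CARD('n) \<le> \<bar>e * n $ m\<bar>"
          using mult_left_mono[OF m, of e] e by (simp add: abs_mult)
        then have "sqrt (e / real CARD('n)) \<le> sqrt \<bar>e * n $ m\<bar>" by simp
        then have "5 / sqrt \<bar>e * n $ m\<bar> \<le> 5 / sqrt (e / real CARD('n))"
          using e nm by (intro divide_left_mono mult_pos_pos) auto
        then show "5 / sqrt \<bar>e * n $ m\<bar> \<le> 5 * sqrt (real CARD('n)) / sqrt e"
          by (simp add: real_sqrt_divide)
      qed
      finally show "(\<integral>\<^sup>+t. inv_sqrt (?g (y((m, k) := t))) \<partial>std_normal) \<le> ?bd" .
    qed
    also have "\<dots> = ?bd" by (simp add: prob_space.emeasure_space_1[OF prob])
    finally show ?thesis .
  qed
  have "(\<integral>\<^sup>+G. inv_sqrt (colres L k (mat 1 + e *\<^sub>R G)) \<partial>std_normal_matrix) = (\<integral>\<^sup>+x. ?f x \<partial>?P UNIV)"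
    unfolding std_normal_matrix_eq by (subst nn_integral_distr) (auto simp: entries_law_def[symmetric] sets_std_normal_matrix)
  also have "\<dots> = (\<integral>\<^sup>+x. (\<integral>\<^sup>+y. ?f (merge ?I ?J (x, y)) \<partial>?P ?J) \<partial>?P ?I)"
    using product_nn_integral_fold[of ?I ?J ?f] IJ meas by simp
  also have "\<dots> \<le> (\<integral>\<^sup>+x. ?bd \<partial>?P ?I)" by (intro nn_integral_mono inner)
  also have "\<dots> = ?bd" by (simp add: prob_space.emeasure_space_1[OF prob])
  finally show ?thesis .
qed

section \<open>Moments of the Gaussian matrix\<close>

lemma distr_entry: "distr (std_normal_matrix :: (real^'n^'n) measure) borel (\<lambda>G. G $ i $ j) = std_normal"
proof -
  have "distr (std_normal_matrix :: (real^'n^'n) measure) borel (\<lambda>G. G $ i $ j)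
      = distr entries_law borel (\<lambda>x. x (i, j))"
    unfolding std_normal_matrix_eq
    by (subst distr_distr) (auto simp: matrix_of_def o_def)
  also have "\<dots> = distr (\<Pi>\<^sub>M p\<in>UNIV. std_normal) std_normal (\<lambda>x. x (i, j))"
    unfolding entries_law_def by (rule distr_cong) auto
  also have "\<dots> = std_normal"
    by (rule distr_PiM_component) (auto intro: prob_space_std_normal)
  finally show ?thesis .
qed

lemma integrable_entry_power: "integrable std_normal_matrix (\<lambda>G :: real^'n^'n. \<bar>G $ i $ j\<bar> ^ m)"
proof -
  have "integrable std_normal (\<lambda>x. \<bar>x\<bar> ^ m)"
    using integrable_std_normal_moment_abs[of m] unfolding std_normal_def
    by (subst integrable_density) auto
  then show ?thesis
    unfolding distr_entry[of i j, symmetric] by (subst (asm) integrable_distr_eq) auto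
qed

lemma integral_entry_square: "(\<integral>G. (G $ i $ j)\<^sup>2 \<partial>(std_normal_matrix :: (real^'n^'n) measure)) = 1"
proof -
  have "(\<integral>G. (G $ i $ j)\<^sup>2 \<partial>(std_normal_matrix :: (real^'n^'n) measure)) = (\<integral>x. x\<^sup>2 \<partial>std_normal)"
    unfolding distr_entry[of i j, symmetric] by (subst integral_distr) auto
  also have "\<dots> = (\<integral>x. std_normal_density x * x\<^sup>2 \<partial>lborel)"
    unfolding std_normal_def by (subst integral_density) auto
  also have "\<dots> = 1" using integral_std_normal_moment_even[of 1] by simp
  finally show ?thesis .
qed

lemma integrable_norm_power: "integrable std_normal_matrix (\<lambda>G :: real^'n^'n. norm G ^ m)"
proof -
  let ?D = "real CARD('n \<times> 'n)"
  have le: "norm G ^ m \<le> ?D ^ m * (\<Sum>p\<in>UNIV. \<bar>G $ fst p $ snd p\<bar> ^ m)" for G :: "real^'n^'n"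
  proof -
    have "norm G \<le> (\<Sum>i\<in>UNIV. norm (G $ i))"
      unfolding norm_vec_def by (rule L2_set_le_sum) simp
    also have "\<dots> \<le> (\<Sum>i\<in>UNIV. \<Sum>j\<in>UNIV. \<bar>G $ i $ j\<bar>)" by (intro sum_mono norm_le_l1_cart)
    also have "\<dots> = (\<Sum>p\<in>UNIV. \<bar>G $ fst p $ snd p\<bar>)"
      by (simp add: sum.cartesian_product UNIV_Times_UNIV[symmetric] case_prod_beta del: UNIV_Times_UNIV)
    finally have 1: "norm G \<le> (\<Sum>p\<in>UNIV. \<bar>G $ fst p $ snd p\<bar>)" .
    define b where "b = Max (range (\<lambda>p. \<bar>G $ fst p $ snd p\<bar>))"
    have "b \<in> range (\<lambda>p. \<bar>G $ fst p $ snd p\<bar>)" unfolding b_def by (intro Max_in) auto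
    then obtain q where q: "b = \<bar>G $ fst q $ snd q\<bar>" by blast
    have "(\<Sum>p\<in>UNIV. \<bar>G $ fst p $ snd p\<bar>) \<le> (\<Sum>p\<in>(UNIV :: ('n \<times> 'n) set). b)"
      unfolding b_def by (intro sum_mono Max_ge) auto
    then have "norm G \<le> ?D * b" using 1 by simp
    then have "norm G ^ m \<le> ?D ^ m * b ^ m"
      using power_mono[of "norm G" "?D * b" m] by (simp add: power_mult_distrib)
    also have "b ^ m \<le> (\<Sum>p\<in>UNIV. \<bar>G $ fst p $ snd p\<bar> ^ m)"
      unfolding q by (rule member_le_sum[of q UNIV "\<lambda>p. \<bar>G $ fst p $ snd p\<bar> ^ m"]) auto
    finally show ?thesis by (simp add: mult_left_mono)
  qed
  have "integrable std_normal_matrix (\<lambda>G :: real^'n^'n. ?D ^ m * (\<Sum>p\<in>UNIV. \<bar>G $ fst p $ snd p\<bar> ^ m))"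
    by (intro integrable_mult_right Bochner_Integration.integrable_sum integrable_entry_power)
  then show ?thesis
    by (rule Bochner_Integration.integrable_bound)
      (use le in \<open>auto intro!: AE_I2 order_trans[OF _ abs_ge_self]\<close>)
qed

lemma distr_std_normal_matrix_orthogonal:
  fixes f :: "real^'n^'n \<Rightarrow> real^'n^'n"
  assumes f: "orthogonal_transformation f"
  shows "distr std_normal_matrix borel f = std_normal_matrix"
proof (rule measure_eqI)
  have [measurable]: "f \<in> borel_measurable borel"
    using orthogonal_transformation_linear[OF f]
    by (intro borel_measurable_continuous_onI linear_continuous_on linear_conv_bounded_linear[THEN iffD1])
  fix X assume "X \<in> sets (distr std_normal_matrix borel f)"
  then have [measurable]: "X \<in> sets borel" by simp
  have "emeasure (distr std_normal_matrix borel f) X = (\<integral>\<^sup>+C. indicator X C \<partial>distr std_normal_matrix borel f)"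
    by simp
  also have "\<dots> = (\<integral>\<^sup>+C. indicator X (f C) \<partial>std_normal_matrix)"
    by (rule nn_integral_distr) simp_all
  also have "\<dots> = (\<integral>\<^sup>+C. indicator X C \<partial>std_normal_matrix)"
    by (rule nn_integral_std_normal_matrix_orthogonal[OF f]) simp
  also have "\<dots> = emeasure std_normal_matrix X" by simp
  finally show "emeasure (distr std_normal_matrix borel f) X = emeasure std_normal_matrix X" .
qed simp

lemma integral_std_normal_matrix_orthogonal:
  fixes f :: "real^'n^'n \<Rightarrow> real^'n^'n" and g :: "real^'n^'n \<Rightarrow> real"
  assumes f: "orthogonal_transformation f" and [measurable]: "g \<in> borel_measurable borel"
  shows "(\<integral>C. g (f C) \<partial>std_normal_matrix) = (\<integral>C. g C \<partial>std_normal_matrix)"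
proof -
  have [measurable]: "f \<in> borel_measurable borel"
    using orthogonal_transformation_linear[OF f]
    by (intro borel_measurable_continuous_onI linear_continuous_on linear_conv_bounded_linear[THEN iffD1])
  show ?thesis
    by (subst (2) distr_std_normal_matrix_orthogonal[OF f, symmetric]) (simp add: integral_distr)
qed

lemma integrable_entry_mult: "integrable std_normal_matrix (\<lambda>G :: real^'n^'n. G $ i $ j * G $ i' $ j')"
proof (rule Bochner_Integration.integrable_bound[OF integrable_norm_power[of 2]])
  show "AE G :: real^'n^'n in std_normal_matrix. norm (G $ i $ j * G $ i' $ j') \<le> norm (norm G ^ 2)"
    by (intro AE_I2) (auto simp: abs_mult power2_eq_square intro!: mult_mono abs_entry_le)
qed measurable

text \<open>Changing the sign of column \<open>k\<close> preserves the law and reverses the sign of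
  exactly one of the two factors.\<close>

lemma integral_entry_mult_transposed:
  assumes "k \<noteq> l"
  shows "(\<integral>G. G $ k $ l * G $ l $ k \<partial>(std_normal_matrix :: (real^'n^'n) measure)) = 0"
proof -
  define P :: "real^'n^'n" where "P = (\<chi> i j. if i = j then (if i = k then - 1 else 1) else 0)"
  have GP: "(G ** P) $ i $ j = (if j = k then - 1 else 1) * G $ i $ j" for G :: "real^'n^'n" and i j
    by (simp add: P_def matrix_matrix_mult_def if_distrib[of "(*) _"] cong: if_cong)
  have "column c P = (if c = k then - axis c 1 else axis c 1)" for c
    by (simp add: P_def column_def axis_def vec_eq_iff)
  then have "orthogonal_matrix P"
    unfolding orthogonal_matrix_orthonormal_columns
    by (simp add: orthogonal_def inner_axis_axis)
  from integral_std_normal_matrix_orthogonal[OF orthogonal_transformation_mult_right[OF this],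
      of "\<lambda>G. G $ k $ l * G $ l $ k"]
  show ?thesis using assms by (simp add: GP)
qed

text \<open>The squared column contributes \<open>CARD('n)\<close>, every \<open>l\<close> in
  \<open>L\<close> contributes \<open>- 2\<close> since the mixed products have mean zero, and the
  diagonal entry contributes the last \<open>- 2\<close>. With \<open>length L = j - 1\<close> the
  total is \<open>CARD('n) - 2 * j\<close>.\<close>

lemma integral_quad_form:
  fixes L :: "'n::finite list"
  assumes L: "distinct L" "k \<notin> set L"
  shows "integrable std_normal_matrix (quad_form L k)"
    and "(\<integral>G. quad_form L k G \<partial>std_normal_matrix) = real CARD('n) - 2 * real (length L) - 2"
proof -
  let ?M = "std_normal_matrix :: (real^'n^'n) measure"
  have sq: "integrable ?M (\<lambda>G. (G $ i $ j)\<^sup>2)" for i j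
    using integrable_entry_power[of i j 2] by simp
  note [simp] = sq integrable_entry_mult integral_entry_square
  have eq: "quad_form L k = (\<lambda>G. (\<Sum>i\<in>UNIV. (G $ i $ k)\<^sup>2)
      - (\<Sum>l\<in>set L. (G $ k $ l)\<^sup>2 + (G $ l $ k)\<^sup>2 + 2 * (G $ k $ l * G $ l $ k)) - 2 * (G $ k $ k)\<^sup>2)"
  proof
    fix G :: "real^'n^'n"
    have "(norm (column k G))\<^sup>2 = (\<Sum>i\<in>UNIV. (G $ i $ k)\<^sup>2)"
      unfolding power2_norm_eq_inner by (simp add: inner_vec_def column_def power2_eq_square)
    moreover have "(G $ k $ l + G $ l $ k)\<^sup>2 = (G $ k $ l)\<^sup>2 + (G $ l $ k)\<^sup>2 + 2 * (G $ k $ l * G $ l $ k)" for l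
      by (simp add: power2_eq_square algebra_simps)
    ultimately show "quad_form L k G = (\<Sum>i\<in>UNIV. (G $ i $ k)\<^sup>2)
      - (\<Sum>l\<in>set L. (G $ k $ l)\<^sup>2 + (G $ l $ k)\<^sup>2 + 2 * (G $ k $ l * G $ l $ k)) - 2 * (G $ k $ k)\<^sup>2"
      by (simp add: quad_form_def)
  qed
  show "integrable ?M (quad_form L k)" unfolding eq by simp
  have cross: "(\<integral>G. G $ k $ l * G $ l $ k \<partial>?M) = 0" if "l \<in> set L" for l
    using that L by (intro integral_entry_mult_transposed) auto
  have "(\<Sum>l\<in>set L. \<integral>G. (G $ k $ l)\<^sup>2 + (G $ l $ k)\<^sup>2 + 2 * (G $ k $ l * G $ l $ k) \<partial>?M) = (\<Sum>l\<in>set L. 2)"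
    by (intro sum.cong refl) (simp add: cross)
  then show "(\<integral>G. quad_form L k G \<partial>?M) = real CARD('n) - 2 * real (length L) - 2"
    unfolding eq using L by (simp add: Bochner_Integration.integral_sum distinct_card)
qed

section \<open>Expansion of the mean logarithm\<close>

lemma colres_le: "colres L k (mat 1 + e *\<^sub>R G) \<le> 1 + \<bar>e\<bar> * norm (G :: real^'n^'n)"
proof -
  have c: "column k (mat 1 + e *\<^sub>R G) = axis k 1 + e *\<^sub>R column k G"
    by (simp add: column_def mat_def axis_def vec_eq_iff)
  have "colres L k (mat 1 + e *\<^sub>R G) \<le> norm (column k (mat 1 + e *\<^sub>R G))"
    unfolding colres_def by (rule order_trans[OF norm_resid_le[OF span_zero]]) simp
  also have "\<dots> \<le> 1 + \<bar>e\<bar> * norm (column k G)"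
    unfolding c by (rule order_trans[OF norm_triangle_ineq]) simp
  also have "\<dots> \<le> 1 + \<bar>e\<bar> * norm G" by (simp add: mult_left_mono norm_column_le)
  finally show ?thesis .
qed

context
  fixes L :: "'n::finite list" and k
  assumes L: "distinct L" "k \<notin> set L"
begin

interpretation \<nu>: prob_space "std_normal_matrix :: (real^'n^'n) measure"
  by (rule prob_space_std_normal_matrix)

lemma AE_colres_pos:
  assumes e: "0 < e"
  shows "AE G :: real^'n^'n in std_normal_matrix. 0 < colres L k (mat 1 + e *\<^sub>R G)"
proof -
  have "AE G :: real^'n^'n in std_normal_matrix. inv_sqrt (colres L k (mat 1 + e *\<^sub>R G)) \<noteq> \<infinity>"
    using nn_integral_inv_sqrt_colres[OF L e]
    by (intro nn_integral_PInf_AE) (measurable, auto simp: top_unique)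
  then show ?thesis
  proof eventually_elim
    case (elim G)
    then have "colres L k (mat 1 + e *\<^sub>R G) \<noteq> 0" using inv_sqrt_zero by auto
    then show ?case by (simp add: colres_def)
  qed
qed

text \<open>For a positive residual \<open>r\<close> the integrand is the larger of
  \<open>sqrt r\<close> and \<open>1 / sqrt r\<close>. The first is bounded by \<open>1 + r\<close>,
  hence by the norm of \<open>G\<close>; the second is the small-ball estimate, which is why the
  exponent is 1/2.\<close>

lemma nn_integral_exp_ln_colres:
  assumes e: "0 < e"
  shows "(\<integral>\<^sup>+G. exp (1 / 2 * \<bar>ln (colres L k (mat 1 + e *\<^sub>R G))\<bar>) \<partial>std_normal_matrix)
    \<le> ennreal (2 + e * (\<integral>G. norm G \<partial>(std_normal_matrix :: (real^'n^'n) measure)) + 5 * sqrt (real CARD('n)) / sqrt e)"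
proof -
  let ?M = "std_normal_matrix :: (real^'n^'n) measure"
  have i1: "integrable ?M norm" using integrable_norm_power[of 1] by simp
  have pw: "exp (1 / 2 * \<bar>ln r\<bar>) \<le> 1 + r + 1 / sqrt r" if r: "0 < r" for r :: real
  proof -
    have h: "exp (1 / 2 * ln r) = sqrt r"
      using r by (simp add: ln_sqrt[symmetric])
    have "r \<le> (1 + r)\<^sup>2" using r by (simp add: power2_eq_square algebra_simps)
    then have s: "sqrt r \<le> 1 + r" using r by (intro real_le_lsqrt) auto
    show ?thesis
    proof (cases "0 \<le> ln r")
      case True
      have "0 \<le> 1 / sqrt r" using r by simp
      moreover have "exp (1 / 2 * \<bar>ln r\<bar>) = sqrt r" using True h by simp
      ultimately show ?thesis using s by linarith
    next
      case False
      then have "exp (1 / 2 * \<bar>ln r\<bar>) = 1 / sqrt r"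
        using h by (simp add: exp_minus inverse_eq_divide)
      then show ?thesis using r by simp
    qed
  qed
  have "(\<integral>\<^sup>+G. exp (1 / 2 * \<bar>ln (colres L k (mat 1 + e *\<^sub>R G))\<bar>) \<partial>?M)
      \<le> (\<integral>\<^sup>+G. ennreal (2 + e * norm G) + inv_sqrt (colres L k (mat 1 + e *\<^sub>R G)) \<partial>?M)"
    using AE_colres_pos[OF e]
  proof (intro nn_integral_mono_AE, eventually_elim)
    case (elim G)
    let ?r = "colres L k (mat 1 + e *\<^sub>R G)"
    have r: "0 < ?r" by (rule elim(2))
    have "exp (1 / 2 * \<bar>ln ?r\<bar>) \<le> (2 + e * norm G) + 1 / sqrt ?r"
      using pw[OF r] colres_le[of L k e G] e by simp
    then have "ennreal (exp (1 / 2 * \<bar>ln ?r\<bar>)) \<le> ennreal ((2 + e * norm G) + 1 / sqrt ?r)"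
      by (rule ennreal_leI)
    also have "\<dots> = ennreal (2 + e * norm G) + inv_sqrt ?r"
      using r e by (subst ennreal_plus) (auto simp: inv_sqrt_pos)
    finally show ?case .
  qed
  also have "\<dots> = (\<integral>\<^sup>+G. ennreal (2 + e * norm G) \<partial>?M) + (\<integral>\<^sup>+G. inv_sqrt (colres L k (mat 1 + e *\<^sub>R G)) \<partial>?M)"
    by (intro nn_integral_add) measurable
  also have "(\<integral>\<^sup>+G. ennreal (2 + e * norm G) \<partial>?M) = ennreal (\<integral>G. 2 + e * norm G \<partial>?M)"
    using e i1 by (intro nn_integral_eq_integral) auto
  also have "(\<integral>G. 2 + e * norm G \<partial>?M) = 2 + e * (\<integral>G. norm G \<partial>?M)"
    using i1 by (simp add: \<nu>.prob_space[simplified])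
  finally have "(\<integral>\<^sup>+G. exp (1 / 2 * \<bar>ln (colres L k (mat 1 + e *\<^sub>R G))\<bar>) \<partial>?M)
      \<le> ennreal (2 + e * (\<integral>G. norm G \<partial>?M)) + ennreal (5 * sqrt (real CARD('n)) / sqrt e)"
    using nn_integral_inv_sqrt_colres[OF L e] by (meson add_left_mono order_trans)
  then show ?thesis
    using e by (subst ennreal_plus) (auto intro!: add_nonneg_nonneg mult_nonneg_nonneg integral_nonneg_AE)
qed

lemma integrable_exp_ln_colres:
  assumes e: "0 < e"
  shows "integrable (std_normal_matrix :: (real^'n^'n) measure) (\<lambda>G. exp (1 / 2 * \<bar>ln (colres L k (mat 1 + e *\<^sub>R G))\<bar>))"
  by (rule integrableI_nonneg)
    (use nn_integral_exp_ln_colres[OF e] in \<open>auto simp: less_top[symmetric] top_unique\<close>)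

text \<open>A coarse form of the preceding bound: a fixed power of \<open>1 / e\<close> is all that
  is needed, because it is later multiplied by \<open>e ^ 5\<close>.\<close>

lemma integral_exp_ln_colres_le:
  obtains C where "0 < C" "\<And>e. 0 < e \<Longrightarrow> e \<le> 1 \<Longrightarrow>
    (\<integral>G. exp (1 / 2 * \<bar>ln (colres L k (mat 1 + e *\<^sub>R G))\<bar>) \<partial>(std_normal_matrix :: (real^'n^'n) measure)) \<le> C / e"
proof -
  let ?M = "std_normal_matrix :: (real^'n^'n) measure"
  define m where "m = (\<integral>G. norm G \<partial>?M)"
  define C where "C = 2 + m + 5 * sqrt (real CARD('n))"
  have m: "0 \<le> m" unfolding m_def by (intro integral_nonneg_AE) simp
  have "(\<integral>G. exp (1 / 2 * \<bar>ln (colres L k (mat 1 + e *\<^sub>R G))\<bar>) \<partial>?M) \<le> C / e" if e: "0 < e" "e \<le> 1" for e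
  proof -
    have "ennreal (\<integral>G. exp (1 / 2 * \<bar>ln (colres L k (mat 1 + e *\<^sub>R G))\<bar>) \<partial>?M)
        \<le> ennreal (2 + e * m + 5 * sqrt (real CARD('n)) / sqrt e)"
      using nn_integral_exp_ln_colres[OF e(1)] integrable_exp_ln_colres[OF e(1)]
      by (subst (asm) nn_integral_eq_integral) (auto simp: m_def)
    then have "(\<integral>G. exp (1 / 2 * \<bar>ln (colres L k (mat 1 + e *\<^sub>R G))\<bar>) \<partial>?M)
        \<le> 2 + e * m + 5 * sqrt (real CARD('n)) / sqrt e"
      by (subst (asm) ennreal_le_iff) (use e m in \<open>auto intro!: add_nonneg_nonneg\<close>)
    also have "\<dots> \<le> 2 / e + m / e + 5 * sqrt (real CARD('n)) / e"
    proof (intro add_mono)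
      show "2 \<le> 2 / e" using e by (simp add: field_simps)
      have "e * m \<le> 1 * m" using e m by (intro mult_right_mono) auto
      also have "1 * m \<le> m / e" using e m mult_right_mono[OF e(2) m] by (simp add: field_simps)
      finally show "e * m \<le> m / e" .
      have "e \<le> sqrt e" using e real_le_rsqrt[of e e] power_decreasing[of 1 2 e] by simp
      then show "5 * sqrt (real CARD('n)) / sqrt e \<le> 5 * sqrt (real CARD('n)) / e"
        using e by (intro divide_left_mono) auto
    qed
    also have "\<dots> = C / e" by (simp add: C_def add_divide_distrib)
    finally show ?thesis .
  qed
  then show thesis
    using m by (intro that[of C]) (auto simp: C_def intro!: add_pos_nonneg)
qed

lemma integrable_ln_colres:
  assumes e: "0 < e"
  shows "integrable (std_normal_matrix :: (real^'n^'n) measure) (\<lambda>G. ln (colres L k (mat 1 + e *\<^sub>R G)))"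
    and "integrable (std_normal_matrix :: (real^'n^'n) measure) (\<lambda>G. (ln (colres L k (mat 1 + e *\<^sub>R G)))\<^sup>2)"
    and "(\<integral>G. (ln (colres L k (mat 1 + e *\<^sub>R G)))\<^sup>2 \<partial>(std_normal_matrix :: (real^'n^'n) measure))
      \<le> 8 * (\<integral>G. exp (1 / 2 * \<bar>ln (colres L k (mat 1 + e *\<^sub>R G))\<bar>) \<partial>std_normal_matrix)"
proof -
  let ?X = "\<lambda>G :: real^'n^'n. ln (colres L k (mat 1 + e *\<^sub>R G))"
  have sq: "x\<^sup>2 \<le> 8 * exp (1 / 2 * \<bar>x\<bar>)" for x :: real
  proof -
    have "0 \<le> 1 / 2 * \<bar>x\<bar>" by simp
    from exp_lower_Taylor_quadratic[OF this] have "(1 / 2 * \<bar>x\<bar>)\<^sup>2 / 2 \<le> exp (1 / 2 * \<bar>x\<bar>)"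
      using abs_ge_zero[of x] by linarith
    then show ?thesis by (simp add: power_mult_distrib power_divide)
  qed
  have lin: "\<bar>x\<bar> \<le> 2 * exp (1 / 2 * \<bar>x\<bar>)" for x :: real
    using exp_ge_add_one_self[of "1 / 2 * \<bar>x\<bar>"] by linarith
  note int = integrable_exp_ln_colres[OF e]
  show "integrable std_normal_matrix ?X"
    by (rule Bochner_Integration.integrable_bound[OF integrable_mult_right[OF int, of 2]])
      (use lin in auto)
  show i2: "integrable std_normal_matrix (\<lambda>G. (?X G)\<^sup>2)"
    by (rule Bochner_Integration.integrable_bound[OF integrable_mult_right[OF int, of 8]])
      (use sq in auto)
  have "(\<integral>G. (?X G)\<^sup>2 \<partial>std_normal_matrix) \<le> (\<integral>G. 8 * exp (1 / 2 * \<bar>?X G\<bar>) \<partial>std_normal_matrix)"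
    using i2 int sq by (intro integral_mono) auto
  then show "(\<integral>G. (?X G)\<^sup>2 \<partial>std_normal_matrix) \<le> 8 * (\<integral>G. exp (1 / 2 * \<bar>?X G\<bar>) \<partial>std_normal_matrix)"
    by simp
qed

lemma quad_form_scale: "quad_form L k (e *\<^sub>R G) = e\<^sup>2 * quad_form L k G"
proof -
  have "column k (e *\<^sub>R G) = e *\<^sub>R column k G" by (simp add: column_def vec_eq_iff)
  moreover have "(e * x + e * y)\<^sup>2 = e\<^sup>2 * (x + y)\<^sup>2" for x y :: real
    by (simp add: power2_eq_square algebra_simps)
  ultimately show ?thesis
    by (simp add: quad_form_def power_mult_distrib sum_distrib_left right_diff_distrib)
qed

lemma quad_form_bound: "\<bar>quad_form L k G\<bar> \<le> (3 + 4 * real (length L)) * (norm G)\<^sup>2"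
proof -
  have ent: "(G $ i $ j)\<^sup>2 \<le> (norm G)\<^sup>2" for i j
    using power_mono[OF abs_entry_le abs_ge_zero, of G i j 2] by simp
  have "(G $ k $ l + G $ l $ k)\<^sup>2 \<le> 4 * (norm G)\<^sup>2" for l
  proof -
    have "\<bar>G $ k $ l + G $ l $ k\<bar> \<le> 2 * norm G"
      using abs_entry_le[of G k l] abs_entry_le[of G l k] by linarith
    from power_mono[OF this abs_ge_zero, of 2] show ?thesis by (simp add: power_mult_distrib)
  qed
  then have "(\<Sum>l\<in>set L. (G $ k $ l + G $ l $ k)\<^sup>2) \<le> (\<Sum>l\<in>set L. 4 * (norm G)\<^sup>2)"
    by (intro sum_mono)
  also have "\<dots> = 4 * real (length L) * (norm G)\<^sup>2" using L by (simp add: distinct_card)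
  finally have "(\<Sum>l\<in>set L. (G $ k $ l + G $ l $ k)\<^sup>2) \<le> 4 * real (length L) * (norm G)\<^sup>2" .
  moreover have "0 \<le> (\<Sum>l\<in>set L. (G $ k $ l + G $ l $ k)\<^sup>2)" by (intro sum_nonneg) auto
  moreover have "(norm (column k G))\<^sup>2 \<le> (norm G)\<^sup>2" by (intro power_mono norm_column_le) auto
  moreover have "0 \<le> (norm (column k G))\<^sup>2" "0 \<le> (G $ k $ k)\<^sup>2" by auto
  ultimately show ?thesis
    using ent[of k k] unfolding quad_form_def distrib_right by linarith
qed

text \<open>Averaging \<open>G\<close> and \<open>- G\<close> removes the odd terms of the expansion. The event
  \<open>norm (e G) > \<delta>\<close> is negligible because all moments of \<open>G\<close> are finite, while the second
  moment of the logarithm is only \<open>O(1 / e)\<close>.\<close>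

lemma integral_ln_colres_expansion:
  obtains C \<delta> where "0 < \<delta>" "\<And>e. 0 < e \<Longrightarrow> e \<le> \<delta> \<Longrightarrow>
    \<bar>(\<integral>G. ln (colres L k (mat 1 + e *\<^sub>R G)) \<partial>(std_normal_matrix :: (real^'n^'n) measure))
      - (real CARD('n) - 2 * real (Suc (length L))) * (e\<^sup>2 / 2)\<bar> \<le> C * e ^ 4"
proof -
  let ?M = "std_normal_matrix :: (real^'n^'n) measure"
  obtain K \<delta> where K: "0 < K" and \<delta>: "0 < \<delta>" "\<delta> \<le> 1"
    and near: "\<And>H. norm H \<le> \<delta> \<Longrightarrow>
      \<bar>ln (colres L k (mat 1 + H)) + ln (colres L k (mat 1 - H)) - quad_form L k H\<bar> \<le> K * norm H ^ 4"
    by (rule ln_colres_symmetric_expansion[OF L], rule that)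
  obtain C1 where C1: "0 < C1" "\<And>e. 0 < e \<Longrightarrow> e \<le> 1 \<Longrightarrow>
      (\<integral>G. exp (1 / 2 * \<bar>ln (colres L k (mat 1 + e *\<^sub>R G))\<bar>) \<partial>?M) \<le> C1 / e"
    by (rule integral_exp_ln_colres_le, rule that)
  define q where "q = 3 + 4 * real (length L)"
  define m where "m i = (\<integral>G. norm G ^ i \<partial>?M)" for i :: nat
  define C where "C = (K + q / \<delta>\<^sup>2) * m 4 + 2 / \<delta> ^ 10 * m 10 + 16 * C1"
  have q: "0 \<le> q" by (simp add: q_def)
  have uminus: "orthogonal_transformation (uminus :: real^'n^'n \<Rightarrow> _)"
    by (simp add: orthogonal_transformation_def linear_uminus)
  have main: "\<bar>(\<integral>G. ln (colres L k (mat 1 + e *\<^sub>R G)) \<partial>?M)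
      - (real CARD('n) - 2 * real (Suc (length L))) * (e\<^sup>2 / 2)\<bar> \<le> C * e ^ 4"
    if e: "0 < e" "e \<le> \<delta>" for e
  proof -
    have e1: "e \<le> 1" using e \<delta> by simp
    let ?X = "\<lambda>G :: real^'n^'n. ln (colres L k (mat 1 + e *\<^sub>R G))"
    have [measurable]: "?X \<in> borel_measurable borel" by measurable
    have un: "distr ?M borel uminus = ?M" by (rule distr_std_normal_matrix_orthogonal[OF uminus])
    have flip_int: "integrable ?M (\<lambda>G. f (- G))" if "integrable ?M f" "f \<in> borel_measurable borel"
      for f :: "real^'n^'n \<Rightarrow> real"
      using that by (subst (asm) un[symmetric], subst (asm) integrable_distr_eq) auto
    have flip: "(\<integral>G. f (- G) \<partial>?M) = (\<integral>G. f G \<partial>?M)" if "f \<in> borel_measurable borel"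
      for f :: "real^'n^'n \<Rightarrow> real"
      by (rule integral_std_normal_matrix_orthogonal[OF uminus that])
    note iX = integrable_ln_colres(1)[OF e(1)] and iX2 = integrable_ln_colres(2)[OF e(1)]
    have iX': "integrable ?M (\<lambda>G. ?X (- G))" by (rule flip_int[OF iX]) simp
    have iX2': "integrable ?M (\<lambda>G. (?X (- G))\<^sup>2)" by (rule flip_int[OF iX2]) simp
    have EX2: "(\<integral>G. (?X G)\<^sup>2 \<partial>?M) \<le> 8 * (C1 / e)"
      using integrable_ln_colres(3)[OF e(1)] C1(2)[OF e(1) e1] by linarith
    \<comment> \<open>One integrable majorant for both regimes: the first term serves the expansion
      for small \<open>e *\<^sub>R G\<close> as well as the quadratic form elsewhere, the other two
      serve the logarithms where \<open>e *\<^sub>R G\<close> is large.\<close>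
    let ?W = "\<lambda>G. e ^ 4 * (K + q / \<delta>\<^sup>2) * norm G ^ 4 + e ^ 4 * (2 / \<delta> ^ 10) * norm G ^ 10
      + e ^ 5 * ((?X G)\<^sup>2 + (?X (- G))\<^sup>2)"
    have pw: "\<bar>?X G + ?X (- G) - e\<^sup>2 * quad_form L k G\<bar> \<le> ?W G" for G
    proof (cases "norm (e *\<^sub>R G) \<le> \<delta>")
      case True
      have "\<bar>?X G + ?X (- G) - e\<^sup>2 * quad_form L k G\<bar> \<le> K * norm (e *\<^sub>R G) ^ 4"
        using near[OF True] by (simp add: quad_form_scale)
      also have "\<dots> = e ^ 4 * K * norm G ^ 4" using e by (simp add: power_mult_distrib)
      also have "\<dots> \<le> e ^ 4 * (K + q / \<delta>\<^sup>2) * norm G ^ 4"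
        using q e by (intro mult_right_mono mult_left_mono) auto
      also have "\<dots> \<le> ?W G" using e \<delta> by simp
      finally show ?thesis .
    next
      case False
      then have big: "1 \<le> e * norm G / \<delta>" using e \<delta> by (simp add: field_simps)
      \<comment> \<open>The weight \<open>e ^ 5\<close> is tuned so that a second moment of order
        \<open>1 / e\<close> yields \<open>e ^ 4\<close>. The inequality
        \<open>\<bar>x\<bar> \<le> e ^ 5 * x\<^sup>2 + 1 / e ^ 5\<close> holds for all
        \<open>x\<close>, and on the event at hand the last term is absorbed by the tenth power of
        \<open>e * norm G / \<delta> \<ge> 1\<close>.\<close>
      have amgm: "\<bar>x\<bar> \<le> e ^ 5 * x\<^sup>2 + e ^ 4 * (1 / \<delta> ^ 10) * norm G ^ 10" for x
      proof -
        have "0 \<le> (e ^ 5 * \<bar>x\<bar> - 1)\<^sup>2 + e ^ 5 * \<bar>x\<bar>" using e by simp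
        also have "\<dots> = e ^ 10 * x\<^sup>2 - e ^ 5 * \<bar>x\<bar> + 1"
          by (simp add: power2_eq_square algebra_simps flip: power_add)
        finally have "e ^ 5 * \<bar>x\<bar> \<le> e ^ 10 * x\<^sup>2 + 1" by simp
        also have "1 \<le> (e * norm G / \<delta>) ^ 10" using big by (rule one_le_power)
        also have "(e * norm G / \<delta>) ^ 10 = e ^ 10 * (norm G ^ 10 / \<delta> ^ 10)"
          by (simp add: power_mult_distrib power_divide)
        finally have "e ^ 5 * \<bar>x\<bar> \<le> e ^ 5 * (e ^ 5 * x\<^sup>2 + e ^ 5 * (norm G ^ 10 / \<delta> ^ 10))"
          by (simp add: algebra_simps flip: power_add)
        then have "\<bar>x\<bar> \<le> e ^ 5 * x\<^sup>2 + e ^ 5 * (norm G ^ 10 / \<delta> ^ 10)"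
          using e by (simp add: mult_le_cancel_left_pos)
        also have "e ^ 5 * (norm G ^ 10 / \<delta> ^ 10) \<le> e ^ 4 * (norm G ^ 10 / \<delta> ^ 10)"
          using e e1 \<delta> power_decreasing[of 4 5 e] by (intro mult_right_mono) auto
        finally show ?thesis by (simp add: mult.assoc)
      qed
      have "\<bar>quad_form L k G\<bar> \<le> q * (norm G)\<^sup>2" unfolding q_def by (rule quad_form_bound)
      \<comment> \<open>Inserting the square of a quantity that is at least 1 raises the order in
        \<open>e\<close> by two.\<close>
      also have "\<dots> \<le> q * (norm G)\<^sup>2 * (e * norm G / \<delta>)\<^sup>2"
        using mult_left_mono[OF one_le_power[OF big, of 2], of "q * (norm G)\<^sup>2"] q by simp
      also have "\<dots> = e\<^sup>2 * (q / \<delta>\<^sup>2) * norm G ^ 4"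
        by (simp add: power_mult_distrib power_divide flip: power_add)
      finally have "e\<^sup>2 * \<bar>quad_form L k G\<bar> \<le> e\<^sup>2 * (e\<^sup>2 * (q / \<delta>\<^sup>2) * norm G ^ 4)"
        by (intro mult_left_mono) auto
      also have "\<dots> = e ^ 4 * (q / \<delta>\<^sup>2) * norm G ^ 4" by (simp flip: power_add)
      finally have "\<bar>e\<^sup>2 * quad_form L k G\<bar> \<le> e ^ 4 * (q / \<delta>\<^sup>2) * norm G ^ 4"
        by (simp add: abs_mult)
      moreover have "0 \<le> e ^ 4 * K * norm G ^ 4" using K e by simp
      moreover have "?W G = e ^ 4 * K * norm G ^ 4 + e ^ 4 * (q / \<delta>\<^sup>2) * norm G ^ 4
          + 2 * (e ^ 4 * (1 / \<delta> ^ 10) * norm G ^ 10) + e ^ 5 * (?X G)\<^sup>2 + e ^ 5 * (?X (- G))\<^sup>2"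
        by (simp add: distrib_left distrib_right)
      ultimately show ?thesis
        using amgm[of "?X G"] amgm[of "?X (- G)"] by linarith
    qed
    have im: "integrable ?M (\<lambda>G. norm G ^ i)" for i by (rule integrable_norm_power)
    note iq = integral_quad_form(1)[OF L]
    have iW: "integrable ?M ?W"
      by (intro Bochner_Integration.integrable_add integrable_mult_right im iX2 iX2')
    \<comment> \<open>\<open>G\<close> and \<open>- G\<close> have the same law, so the symmetrised
      logarithm has twice the mean.\<close>
    have "2 * (\<integral>G. ?X G \<partial>?M) - e\<^sup>2 * (\<integral>G. quad_form L k G \<partial>?M)
        = (\<integral>G. ?X G + ?X (- G) - e\<^sup>2 * quad_form L k G \<partial>?M)"
      using iX iX' iq flip[of ?X] by simp
    also have "\<bar>\<dots>\<bar> \<le> (\<integral>G. \<bar>?X G + ?X (- G) - e\<^sup>2 * quad_form L k G\<bar> \<partial>?M)"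
      by (rule integral_abs_bound)
    also have "\<dots> \<le> (\<integral>G. ?W G \<partial>?M)"
      using iX iX' iq by (intro integral_mono iW pw) auto
    also have "\<dots> = e ^ 4 * (K + q / \<delta>\<^sup>2) * m 4 + e ^ 4 * (2 / \<delta> ^ 10) * m 10
        + e ^ 5 * (2 * (\<integral>G. (?X G)\<^sup>2 \<partial>?M))"
      using im iX2 iX2' flip[of "\<lambda>G. (?X G)\<^sup>2"] by (simp add: m_def)
    also have "\<dots> \<le> e ^ 4 * (K + q / \<delta>\<^sup>2) * m 4 + e ^ 4 * (2 / \<delta> ^ 10) * m 10 + e ^ 5 * (2 * (8 * (C1 / e)))"
      using EX2 e by (intro add_left_mono mult_left_mono) auto
    also have "e ^ 5 * (2 * (8 * (C1 / e))) = 16 * C1 * e ^ 4"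
      using e by (simp add: power_Suc[of e 4, simplified] field_simps eval_nat_numeral)
    finally have "\<bar>2 * (\<integral>G. ?X G \<partial>?M) - e\<^sup>2 * (\<integral>G. quad_form L k G \<partial>?M)\<bar> \<le> C * e ^ 4"
      by (simp add: C_def algebra_simps)
    moreover have "2 * (\<integral>G. ?X G \<partial>?M) - e\<^sup>2 * (\<integral>G. quad_form L k G \<partial>?M)
        = 2 * ((\<integral>G. ?X G \<partial>?M) - (real CARD('n) - 2 * real (Suc (length L))) * (e\<^sup>2 / 2))"
      by (simp add: integral_quad_form(2)[OF L] algebra_simps)
    ultimately show ?thesis by (simp add: abs_mult)
  qed
  show thesis by (rule that[OF \<delta>(1) main])
qed

end

section \<open>Lyapunov exponents\<close>

text \<open>The dimensional factor \<open>d\<close> costs \<open>ln d / real n\<close> after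
  normalisation and vanishes in the limit. Positivity is drawn from the lower bound itself, because
  the convention \<open>ln 0 = 0\<close> would hide a vanishing sequence.\<close>

lemma exponential_growth_rate:
  fixes s :: "nat \<Rightarrow> real"
  assumes d: "1 \<le> d" and growth: "\<And>\<delta>. 0 < \<delta> \<Longrightarrow> \<forall>\<^sub>F n in sequentially.
      exp (real n * (l - \<delta>)) / d \<le> s n \<and> s n \<le> d * exp (real n * (l + \<delta>))"
  shows "\<forall>\<^sub>F n in sequentially. 0 < s n"
    and "(\<lambda>n. 1 / real n * ln (s n)) \<longlonglongrightarrow> l"
proof -
  have pos: "0 < s n" if "exp (real n * (l - \<delta>)) / d \<le> s n" for n \<delta>
    using that d by (intro less_le_trans[OF _ that]) auto
  show "\<forall>\<^sub>F n in sequentially. 0 < s n"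
    using growth[of 1] by (auto elim!: eventually_mono intro: pos)
  show "(\<lambda>n. 1 / real n * ln (s n)) \<longlonglongrightarrow> l"
  proof (rule tendstoI)
    fix r :: real assume r: "0 < r"
    have "(\<lambda>n. ln d / real n) \<longlonglongrightarrow> 0"
      by (rule tendsto_divide_0[OF tendsto_const filterlim_real_sequentially[THEN filterlim_mono]])
        (simp_all add: at_top_le_at_infinity)
    then have "\<forall>\<^sub>F n in sequentially. ln d / real n < r / 2"
      by (rule order_tendstoD) (use r in simp)
    moreover have "\<forall>\<^sub>F n in sequentially. exp (real n * (l - r / 4)) / d \<le> s n \<and> s n \<le> d * exp (real n * (l + r / 4))"
      by (rule growth) (use r in simp)
    moreover have "\<forall>\<^sub>F n in sequentially. 0 < n" by (rule eventually_gt_at_top)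
    ultimately show "\<forall>\<^sub>F n in sequentially. dist (1 / real n * ln (s n)) l < r"
    proof eventually_elim
      case (elim n)
      have s: "0 < s n" using elim pos by blast
      have "ln (exp (real n * (l - r / 4)) / d) \<le> ln (s n)" "ln (s n) \<le> ln (d * exp (real n * (l + r / 4)))"
        using elim s d by (subst ln_le_cancel_iff; auto)+
      then have "real n * (l - r / 4) - ln d \<le> ln (s n)" "ln (s n) \<le> ln d + real n * (l + r / 4)"
        using d by (simp_all add: ln_div ln_mult_pos)
      then have "\<bar>ln (s n) - real n * l\<bar> \<le> ln d + real n * (r / 4)"
        by (simp add: abs_le_iff algebra_simps)
      then have "\<bar>ln (s n) - real n * l\<bar> / real n \<le> ln d / real n + r / 4"
        using elim by (simp add: field_simps)
      also have "\<dots> < r" using elim r by simp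
      also have "\<bar>ln (s n) - real n * l\<bar> / real n = dist (1 / real n * ln (s n)) l"
      proof -
        have "1 / real n * ln (s n) - l = (ln (s n) - real n * l) / real n"
          using elim by (simp add: field_simps)
        then show ?thesis by (simp add: dist_real_def abs_divide)
      qed
      finally show ?case .
    qed
  qed
qed

lemma is_lyapunov_exponent_unique:
  assumes "prob_space M" "is_lyapunov_exponent M T A j l" "is_lyapunov_exponent M T A j l'"
  shows "l = l'"
proof -
  interpret prob_space M by fact
  have "AE w in M. l = l'"
    using assms(2,3) unfolding is_lyapunov_exponent_def
  proof eventually_elim
    case (elim w)
    then show ?case using LIMSEQ_unique by blast
  qed
  then show ?thesis by simp
qed

lemma lyapunov_exponent_eq:
  assumes "prob_space M" "is_lyapunov_exponent M T A j l"
  shows "lyapunov_exponent M T A j = l"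
  unfolding lyapunov_exponent_def
  using assms is_lyapunov_exponent_unique[OF assms(1)] by blast

context gaussian_cocycle
begin

text \<open>The finitely many pairs in \<open>S\<close> and the countable tolerances
  \<open>1 / real (Suc m)\<close> lead to one null set outside which every residual of the given
  length has rate \<open>l\<close>. The upper and lower comparisons for the singular value then
  share that rate.\<close>

lemma is_lyapunov_exponent_A:
  fixes L0 :: "'d list"
  assumes L0: "distinct L0" "k0 \<notin> set L0" and e: "0 < e"
  shows "is_lyapunov_exponent M \<sigma> (A e) (Suc (length L0)) (\<integral>G. ln (colres L0 k0 (mat 1 + e *\<^sub>R G)) \<partial>\<nu>)"
proof -
  define l where "l = (\<integral>G. ln (colres L0 k0 (mat 1 + e *\<^sub>R G)) \<partial>\<nu>)"
  define S where "S = {(L :: 'd list, k). distinct L \<and> k \<notin> set L \<and> length L = length L0}"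
  have pos: "AE G in \<nu>. 0 < colres L k (mat 1 + e *\<^sub>R G)" if "distinct L" "k \<notin> set L" for L :: "'d list" and k
    by (rule AE_colres_pos[OF that e])
  have "finite {L :: 'd list. set L \<subseteq> UNIV \<and> length L = length L0}"
    by (rule finite_lists_length_eq) simp
  then have finS: "finite S"
    by (rule finite_subset[rotated, OF finite_cartesian_product[OF _ finite[of "UNIV :: 'd set"]]])
      (auto simp: S_def)
  have len: "length L0 < CARD('d)" using extend_distinct[OF L0] by metis
  have "AE w in M. \<forall>m. \<forall>p\<in>S. \<forall>\<^sub>F n in sequentially.
      \<bar>ln (colres (fst p) (snd p) (cocycle \<sigma> (A e) n w)) - real n * l\<bar> \<le> real n * (1 / real (Suc m))"
    unfolding AE_all_countable
  proof (intro allI AE_finite_allI[OF finS])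
    fix m p assume "p \<in> S"
    then show "AE w in M. \<forall>\<^sub>F n in sequentially.
        \<bar>ln (colres (fst p) (snd p) (cocycle \<sigma> (A e) n w)) - real n * l\<bar> \<le> real n * (1 / real (Suc m))"
      unfolding l_def
      by (intro AE_colres_cocycle_growth[OF pos _ L0 integrable_exp_ln_colres[OF L0 e]]) (auto simp: S_def)
  qed
  moreover have "AE w in M. \<forall>n. \<forall>(L :: 'd list) k. distinct L \<longrightarrow> k \<notin> set L \<longrightarrow> 0 < colres L k (cocycle \<sigma> (A e) n w)"
    by (rule AE_all_countable[THEN iffD2], rule allI, rule AE_colres_cocycle_pos[OF pos])
  ultimately have "AE w in M. (\<forall>\<^sub>F n in sequentially. 0 < singular_value (Suc (length L0)) (cocycle \<sigma> (A e) n w)) \<and>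
        (\<lambda>n. 1 / real n * ln (singular_value (Suc (length L0)) (cocycle \<sigma> (A e) n w))) \<longlonglongrightarrow> l"
  proof eventually_elim
    case (elim w)
    let ?B = "\<lambda>n. cocycle \<sigma> (A e) n w"
    have "\<forall>\<^sub>F n in sequentially. exp (real n * (l - \<delta>)) / real CARD('d) \<le> singular_value (Suc (length L0)) (?B n)
        \<and> singular_value (Suc (length L0)) (?B n) \<le> real CARD('d) * exp (real n * (l + \<delta>))" if \<delta>: "0 < \<delta>" for \<delta>
    proof -
      obtain m where m: "1 / real (Suc m) < \<delta>" using reals_Archimedean[OF \<delta>] by (auto simp: inverse_eq_divide)
      have "\<forall>\<^sub>F n in sequentially. \<forall>p\<in>S. \<bar>ln (colres (fst p) (snd p) (?B n)) - real n * l\<bar> \<le> real n * (1 / real (Suc m))"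
        using elim(1) finS by (intro eventually_ball_finite) auto
      then show ?thesis
      proof eventually_elim
        case (elim n)
        have bd: "exp (real n * (l - \<delta>)) \<le> colres L k (?B n)" "colres L k (?B n) \<le> exp (real n * (l + \<delta>))"
          if "distinct L" "k \<notin> set L" "length L = length L0" for L k
        proof -
          have r: "0 < colres L k (?B n)" using \<open>\<forall>n L k. _ n L k\<close> that by blast
          have "\<bar>ln (colres L k (?B n)) - real n * l\<bar> \<le> real n * (1 / real (Suc m))"
            using elim that by (auto simp: S_def)
          also have "\<dots> \<le> real n * \<delta>" using m by (intro mult_left_mono) auto
          finally have ln_bd: "real n * (l - \<delta>) \<le> ln (colres L k (?B n))" "ln (colres L k (?B n)) \<le> real n * (l + \<delta>)"
            by (simp_all add: abs_le_iff algebra_simps)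
          show "exp (real n * (l - \<delta>)) \<le> colres L k (?B n)" "colres L k (?B n) \<le> exp (real n * (l + \<delta>))"
            using ln_bd[THEN exp_le_cancel_iff[THEN iffD2]] r by simp_all
        qed
        have "singular_value (Suc (length L0)) (?B n) \<le> real CARD('d) * exp (real n * (l + \<delta>))"
          using L0 len by (intro singular_value_le_colres bd(2)) auto
        \<comment> \<open>Any list of \<open>Suc (length L0)\<close> distinct indices would do;
          removing one entry of \<open>k0 # L0\<close> leaves a list of length
          \<open>length L0\<close>, whose residuals are covered by \<open>S\<close>.\<close>
        moreover have "exp (real n * (l - \<delta>)) / real CARD('d) \<le> singular_value (length (k0 # L0)) (?B n)"
        proof (rule singular_value_ge_colres)
          fix l' assume l': "l' \<in> set (k0 # L0)"
          have dist: "distinct (k0 # L0)" using L0 by simp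
          show "exp (real n * (l - \<delta>)) \<le> colres (remove1 l' (k0 # L0)) l' (?B n)"
            using l' dist by (intro bd(1) distinct_remove1) (auto simp: set_remove1_eq length_remove1 simp del: remove1.simps)
        qed (use L0 in auto)
        ultimately show ?case by simp
      qed
    qed
    from exponential_growth_rate[of "real CARD('d)", OF _ this] show ?case by auto
  qed
  then show ?thesis by (simp add: is_lyapunov_exponent_def l_def)
qed

lemma lyapunov_exponent_expansion:
  assumes j: "j \<in> {1..CARD('d)}"
  shows "(\<forall>e>0. is_lyapunov_exponent M \<sigma> (A e) j (lyapunov_exponent M \<sigma> (A e) j)) \<and>
    (\<lambda>e. lyapunov_exponent M \<sigma> (A e) j - (real CARD('d) - 2 * real j) * (e\<^sup>2 / 2))
      \<in> O[at_right 0](\<lambda>e. e ^ 4 * \<bar>ln e\<bar> ^ 4)"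
proof -
  obtain X :: "'d list" where X: "distinct X" "set X = UNIV"
    using finite_distinct_list[of "UNIV :: 'd set"] by auto
  then have lX: "length X = CARD('d)" by (metis distinct_card)
  \<comment> \<open>Any ordering of the indices serves. Positions start at 0, so the exponent of
    index \<open>j\<close> uses the first \<open>j - 1\<close> columns and the column after
    them.\<close>
  define L where "L = take (j - 1) X"
  define k where "k = X ! (j - 1)"
  have L: "distinct L" "k \<notin> set L" "Suc (length L) = j"
    using X(1) lX j by (auto simp: L_def k_def in_set_conv_nth nth_eq_iff_index_eq)
  have ly: "is_lyapunov_exponent M \<sigma> (A e) j (\<integral>G. ln (colres L k (mat 1 + e *\<^sub>R G)) \<partial>\<nu>)" if "0 < e" for e
    using is_lyapunov_exponent_A[OF L(1,2) that] L(3) by simp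
  have eq: "lyapunov_exponent M \<sigma> (A e) j = (\<integral>G. ln (colres L k (mat 1 + e *\<^sub>R G)) \<partial>\<nu>)" if "0 < e" for e
    by (rule lyapunov_exponent_eq[OF prob_space_axioms ly[OF that]])
  obtain C \<delta> where \<delta>: "0 < \<delta>" and C: "\<And>e. 0 < e \<Longrightarrow> e \<le> \<delta> \<Longrightarrow>
      \<bar>(\<integral>G. ln (colres L k (mat 1 + e *\<^sub>R G)) \<partial>\<nu>) - (real CARD('d) - 2 * real (Suc (length L))) * (e\<^sup>2 / 2)\<bar> \<le> C * e ^ 4"
    by (rule integral_ln_colres_expansion[OF L(1,2)], rule that)
  have C0: "0 \<le> C"
  proof -
    have "0 \<le> C * \<delta> ^ 4" using C[OF \<delta> order_refl] abs_ge_zero order_trans by blast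
    then show ?thesis using \<delta> by (simp add: zero_le_mult_iff)
  qed
  \<comment> \<open>The error obtained is of order \<open>e ^ 4\<close>. Below
    \<open>exp (- 1)\<close> the factor \<open>\<bar>ln e\<bar> ^ 4\<close> is at least 1, which
    gives the stated form.\<close>
  have ev: "\<forall>\<^sub>F e in at_right 0. e \<in> {0<..<min \<delta> (exp (- 1))}"
    using \<delta> by (intro eventually_at_right_real) auto
  have "(\<lambda>e. lyapunov_exponent M \<sigma> (A e) j - (real CARD('d) - 2 * real j) * (e\<^sup>2 / 2))
      \<in> O[at_right 0](\<lambda>e. e ^ 4 * \<bar>ln e\<bar> ^ 4)"
  proof (rule bigoI[where c = C])
    show "\<forall>\<^sub>F e in at_right 0. norm (lyapunov_exponent M \<sigma> (A e) j - (real CARD('d) - 2 * real j) * (e\<^sup>2 / 2))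
        \<le> C * norm (e ^ 4 * \<bar>ln e\<bar> ^ 4)"
      using ev
    proof eventually_elim
      case (elim e)
      then have e: "0 < e" "e \<le> \<delta>" "e < exp (- 1)" by auto
      then have "ln e < - 1" by (metis exp_less_cancel_iff exp_ln)
      then have "1 \<le> \<bar>ln e\<bar> ^ 4" by (intro one_le_power) simp
      then have "C * (e ^ 4 * 1) \<le> C * (e ^ 4 * \<bar>ln e\<bar> ^ 4)"
        using C0 e by (intro mult_left_mono) auto
      then show ?case using C[OF e(1,2)] by (simp add: eq[OF e(1)] L(3))
    qed
  qed
  then show ?thesis using ly eq by auto
qed

end

theorem theorem2:
  fixes M :: "'w measure"
    and \<sigma> :: "'w \<Rightarrow> 'w"
    and Q N :: "'w \<Rightarrow> real^'d^'d"
  assumes "prob_space M"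
    and "measure_preserving_automorphism M \<sigma>"
    and "ergodic M \<sigma>"
    and "Q \<in> borel_measurable M"
    and "\<And>w. w \<in> space M \<Longrightarrow> orthogonal_matrix (Q w)"
    and "N \<in> borel_measurable M"
    and "has_conditional_law M (environment_algebra M \<sigma> Q N) N std_normal_matrix"
  shows "let A = (\<lambda>\<epsilon> w. Q w + \<epsilon> *\<^sub>R N w);
             lam = (\<lambda>j \<epsilon>. lyapunov_exponent M \<sigma> (A \<epsilon>) j)
         in \<forall>j\<in>{1..CARD('d)}.
              (\<forall>\<epsilon>>0. is_lyapunov_exponent M \<sigma> (A \<epsilon>) j (lam j \<epsilon>)) \<and>
              (\<lambda>\<epsilon>. lam j \<epsilon> - (real CARD('d) - 2 * real j) * (\<epsilon>\<^sup>2 / 2))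
                \<in> O[at_right 0](\<lambda>\<epsilon>. \<epsilon> ^ 4 * \<bar>ln \<epsilon>\<bar> ^ 4)"
proof -
  interpret gaussian_cocycle M \<sigma> Q N
    using assms by (simp add: gaussian_cocycle_def gaussian_cocycle_axioms_def)
  have "(\<lambda>w. Q w + e *\<^sub>R N w) = A e" for e
    by (rule ext) (simp add: A_def)
  then show ?thesis
    unfolding Let_def using lyapunov_exponent_expansion by simp
qed

end
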